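(* Let $p$ be a prime, let $G=(\mathbb Z/p)^n$ with $n\ge1$ be a $p$-torus, $q=|G|$, and let $m\ge1$ and $2\le k\le q$ be integers. Then $$g_G(V(1,q,k))=g_G(W(q,k))=k-1$$ and $$g_G(V_1(m,q,k))=(m-1)(q-1)+k-1.$$ If, in addition, $k>q/2$, then $$g_G(V(m,q,k))=(m-1)(q-1)+k-1.$$
   Context: For a topological space $Y$ the $k$-wise diagonal is $\Delta_q^k(Y)=\{(y_1,\dots,y_q)\in Y^q:\ y_{i_1}=\dots=y_{i_k}\text{ for some } i_1<\dots<i_k\}$, and the $k$-wise maximum diagonal is $$\Delta'^{\,k}_q(\mathbb R)=\{(y_1,\dots,y_q)\in\mathbb R^q:\ y_{i_1}=\dots=y_{i_k}=c\text{ for some } i_1<\dots<i_k\text{ and } c\in\mathbb R,\text{ and } y_j\le c\ \forall j\}.$$ Put $V(m,q,k)=(\mathbb R^m)^q\setminus\Delta_q^k(\mathbb R^m)$, $W(q,k)=\mathbb R^q\setminus\Delta'^{\,k}_q(\mathbb R)$, and, using $\mathbb R^m=\mathbb R\times\mathbb R^{m-1}$ so that $(\mathbb R^m)^q=\mathbb R^q\times(\mathbb R^{m-1})^q$, $$V_1(m,q,k)=(\mathbb R^m)^q\setminus\bigl(\Delta_q^k(\mathbb R)\times\Delta_q^q(\mathbb R^{m-1})\bigr).$$ For a finite group $G$ with $|G|=q$, the power $Y^q$ is identified (via a bijection of $G$ with the index set) with the space $\mathrm{Map}(G,Y)$ of all maps $G\to Y$, with the left $G$-action $(g\phi)(h)=\phi(g^{-1}h)$;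 the subspaces $V(m,q,k)$ and $V_1(m,q,k)$ of $(\mathbb R^m)^q$ and the subspace $W(q,k)$ of $\mathbb R^q$ are $G$-invariant. A $G$-space is fixed point free if no point is fixed by all of $G$. Let $D_G$ be the (discrete) disjoint union of all orbits $G/H$ over subgroups $H\ne G$. The fixed point free genus $g_G(X)$ of a fixed point free $G$-space $X$ is the least $n\ge0$ such that $X$ can be covered by $n$ ($G$-invariant) open subsets $X_1,\dots,X_n$, each admitting a $G$-equivariant continuous map $X_i\to D_G$ ($\infty$ if there is no such $n$; the empty space has genus $0$). *)

theory Defs
  imports
    "HOL-Analysis.Analysis"
    "HOL-Algebra.Left_Coset"
    "HOL-Algebra.Elementary_Groups"
    "HOL-Algebra.Product_Groups"
    "HOL-Library.Extended_Nat"
begin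

section \<open>Complements of diagonals\<close>

text \<open>
  The power \<open>Y^q\<close> is modelled as the product of copies of \<open>Y\<close> over an index set \<open>I\<close> with \<open>q\<close>
  elements.  Points are extensional functions on \<open>I\<close>, so for \<open>I = carrier G\<close> this is
  \<open>Map(G, Y)\<close> itself.  The Euclidean space of dimension \<open>m\<close> is \<^term>\<open>Euclidean_space m\<close>, whose points
  are the real sequences vanishing from index \<open>m\<close> on; dimension 0 is a single point.
\<close>

definition diagonal :: "'i set \<Rightarrow> nat \<Rightarrow> 'y topology \<Rightarrow> ('i \<Rightarrow> 'y) set" where
  "diagonal I k Y = {y \<in> I \<rightarrow>\<^sub>E topspace Y. \<exists>J\<subseteq>I. card J = k \<and> y constant_on J}"

definition max_diagonal :: "'i set \<Rightarrow> nat \<Rightarrow> ('i \<Rightarrow> real) set" where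
  "max_diagonal I k =
     {y \<in> I \<rightarrow>\<^sub>E UNIV. \<exists>J\<subseteq>I. \<exists>c. card J = k \<and> (\<forall>i\<in>J. y i = c) \<and> (\<forall>j\<in>I. y j \<le> c)}"

definition V_space :: "'i set \<Rightarrow> nat \<Rightarrow> nat \<Rightarrow> ('i \<Rightarrow> nat \<Rightarrow> real) topology" where
  "V_space I m k =
     subtopology (product_topology (\<lambda>_. Euclidean_space m) I)
       ((I \<rightarrow>\<^sub>E topspace (Euclidean_space m)) - diagonal I k (Euclidean_space m))"

definition W_space :: "'i set \<Rightarrow> nat \<Rightarrow> ('i \<Rightarrow> real) topology" where
  "W_space I k =
     subtopology (product_topology (\<lambda>_. euclideanreal) I) ((I \<rightarrow>\<^sub>E UNIV) - max_diagonal I k)"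

text \<open>
  For \<open>m \<ge> 1\<close> the next map is the identification of the \<open>I\<close>-th power of \<open>\<real>\<^sup>m = \<real> \<times> \<real>\<^sup>m\<^sup>-\<^sup>1\<close> with the
  product of the \<open>I\<close>-th powers of the two factors: coordinate 0 is split off from every component
  and the remaining coordinates are shifted down by one.
\<close>

definition split_power :: "'i set \<Rightarrow> ('i \<Rightarrow> nat \<Rightarrow> real) \<Rightarrow> ('i \<Rightarrow> real) \<times> ('i \<Rightarrow> nat \<Rightarrow> real)" where
  "split_power I y = ((\<lambda>i\<in>I. y i 0), (\<lambda>i\<in>I. \<lambda>l. y i (Suc l)))"

definition V1_space :: "'i set \<Rightarrow> nat \<Rightarrow> nat \<Rightarrow> ('i \<Rightarrow> nat \<Rightarrow> real) topology" where
  "V1_space I m k =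
     subtopology (product_topology (\<lambda>_. Euclidean_space m) I)
       {y \<in> I \<rightarrow>\<^sub>E topspace (Euclidean_space m).
          split_power I y \<notin>
            diagonal I k euclideanreal \<times> diagonal I (card I) (Euclidean_space (m - 1))}"


section \<open>Group actions and the fixed point free genus\<close>

definition map_action :: "('g, 'b) monoid_scheme \<Rightarrow> 'g \<Rightarrow> ('g \<Rightarrow> 'y) \<Rightarrow> ('g \<Rightarrow> 'y)" where
  "map_action G g \<phi> = (\<lambda>h\<in>carrier G. \<phi> (inv\<^bsub>G\<^esub> g \<otimes>\<^bsub>G\<^esub> h))"

definition fixed_point_free_G_space ::
    "('g, 'b) monoid_scheme \<Rightarrow> 'x topology \<Rightarrow> ('g \<Rightarrow> 'x \<Rightarrow> 'x) \<Rightarrow> bool" where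
  "fixed_point_free_G_space G X act \<longleftrightarrow>
     group G \<and>
     (\<forall>g\<in>carrier G. continuous_map X X (act g)) \<and>
     (\<forall>x\<in>topspace X. act \<one>\<^bsub>G\<^esub> x = x) \<and>
     (\<forall>g\<in>carrier G. \<forall>h\<in>carrier G. \<forall>x\<in>topspace X. act (g \<otimes>\<^bsub>G\<^esub> h) x = act g (act h x)) \<and>
     \<not> (\<exists>x\<in>topspace X. \<forall>g\<in>carrier G. act g x = x)"

text \<open>Points of \<open>D_G\<close> are pairs of a proper subgroup \<open>H\<close> and a left coset of \<open>H\<close>.\<close>

definition D_space :: "('g, 'b) monoid_scheme \<Rightarrow> ('g set \<times> 'g set) topology" where
  "D_space G = sum_topology (\<lambda>H. discrete_topology (lcosets\<^bsub>G\<^esub> H))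
                 {H. subgroup H G \<and> H \<noteq> carrier G}"

definition D_action :: "('g, 'b) monoid_scheme \<Rightarrow> 'g \<Rightarrow> 'g set \<times> 'g set \<Rightarrow> 'g set \<times> 'g set" where
  "D_action G g = (\<lambda>(H, C). (H, g <#\<^bsub>G\<^esub> C))"

definition maps_to_D :: "('g, 'b) monoid_scheme \<Rightarrow> 'x topology \<Rightarrow> ('g \<Rightarrow> 'x \<Rightarrow> 'x) \<Rightarrow> bool" where
  "maps_to_D G X act \<longleftrightarrow>
     (\<exists>f. continuous_map X (D_space G) f \<and>
          (\<forall>g\<in>carrier G. \<forall>x\<in>topspace X. f (act g x) = D_action G g (f x)))"

text \<open>
  The genus is meant for fixed point free \<open>G\<close>-spaces.  The infimum of the empty set in
  \<^typ>\<open>enat\<close> is \<open>\<infinity>\<close>.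
\<close>

definition genus :: "('g, 'b) monoid_scheme \<Rightarrow> 'x topology \<Rightarrow> ('g \<Rightarrow> 'x \<Rightarrow> 'x) \<Rightarrow> enat" where
  "genus G X act =
     Inf {enat n | n.
       \<exists>U :: nat \<Rightarrow> 'x set.
         (\<forall>i\<in>{1..n}.
            openin X (U i) \<and>
            (\<forall>g\<in>carrier G. \<forall>x\<in>U i. act g x \<in> U i) \<and>
            maps_to_D G (subtopology X (U i)) act) \<and>
         (\<Union>i\<in>{1..n}. U i) = topspace X}"


section \<open>The spaces above are fixed point free \<open>G\<close>-spaces\<close>

lemma map_action_in:
  assumes "group G" "g \<in> carrier G" "\<phi> \<in> carrier G \<rightarrow>\<^sub>E S"
  shows "map_action G g \<phi> \<in> carrier G \<rightarrow>\<^sub>E S"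
proof -
  interpret group G by fact
  show ?thesis using assms by (auto simp: map_action_def PiE_iff)
qed

lemma continuous_map_map_action:
  assumes "group G" "g \<in> carrier G"
  shows "continuous_map (product_topology (\<lambda>_. Y) (carrier G)) (product_topology (\<lambda>_. Y) (carrier G))
           (map_action G g)"
proof -
  interpret group G by fact
  show ?thesis
    using assms unfolding continuous_map_componentwise
    by (auto simp: map_action_def intro!: continuous_map_product_projection)
qed

lemma translate_index_set:
  assumes "group G" "g \<in> carrier G" "J \<subseteq> carrier G"
  shows "(\<lambda>h. inv\<^bsub>G\<^esub> g \<otimes>\<^bsub>G\<^esub> h) ` J \<subseteq> carrier G"
    and "card ((\<lambda>h. inv\<^bsub>G\<^esub> g \<otimes>\<^bsub>G\<^esub> h) ` J) = card J"
proof -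
  interpret group G by fact
  show "(\<lambda>h. inv\<^bsub>G\<^esub> g \<otimes>\<^bsub>G\<^esub> h) ` J \<subseteq> carrier G"
    using assms by auto
  have "inj_on (\<lambda>h. inv\<^bsub>G\<^esub> g \<otimes>\<^bsub>G\<^esub> h) J"
    using assms by (intro inj_onI) (metis inv_closed Units_eq Units_l_cancel subsetD)
  then show "card ((\<lambda>h. inv\<^bsub>G\<^esub> g \<otimes>\<^bsub>G\<^esub> h) ` J) = card J"
    by (rule card_image)
qed

lemma map_action_diagonal:
  assumes "group G" "g \<in> carrier G" "\<phi> \<in> carrier G \<rightarrow>\<^sub>E topspace Y"
    and "map_action G g \<phi> \<in> diagonal (carrier G) k Y"
  shows "\<phi> \<in> diagonal (carrier G) k Y"
proof -
  obtain J c where J: "J \<subseteq> carrier G" "card J = k" "\<And>h. h \<in> J \<Longrightarrow> map_action G g \<phi> h = c"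
    using assms(4) by (auto simp: diagonal_def constant_on_def)
  have "\<phi> constant_on (\<lambda>h. inv\<^bsub>G\<^esub> g \<otimes>\<^bsub>G\<^esub> h) ` J"
    unfolding constant_on_def using J(1) J(3)[unfolded map_action_def]
    by (intro exI[of _ c]) fastforce
  then show ?thesis
    using translate_index_set[OF assms(1,2) J(1)] J(2) assms(3)
    by (auto simp: diagonal_def)
qed

lemma map_action_max_diagonal:
  assumes "group G" "g \<in> carrier G" "\<phi> \<in> carrier G \<rightarrow>\<^sub>E UNIV"
    and "map_action G g \<phi> \<in> max_diagonal (carrier G) k"
  shows "\<phi> \<in> max_diagonal (carrier G) k"
proof -
  interpret group G by fact
  obtain J c where J: "J \<subseteq> carrier G" "card J = k" "\<And>h. h \<in> J \<Longrightarrow> map_action G g \<phi> h = c"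
      "\<And>h. h \<in> carrier G \<Longrightarrow> map_action G g \<phi> h \<le> c"
    using assms(4) by (auto simp: max_diagonal_def)
  have "\<phi> h \<le> c" if "h \<in> carrier G" for h
    using J(4)[of "g \<otimes>\<^bsub>G\<^esub> h"] that assms(2) by (simp add: map_action_def m_assoc[symmetric])
  moreover have "\<forall>h \<in> (\<lambda>h. inv\<^bsub>G\<^esub> g \<otimes>\<^bsub>G\<^esub> h) ` J. \<phi> h = c"
    using J(1) J(3)[unfolded map_action_def] by fastforce
  ultimately show ?thesis
    using translate_index_set[OF assms(1,2) J(1)] J(2) assms(3)
    unfolding max_diagonal_def by blast
qed

lemma fixed_point_constant:
  assumes "group G" "\<And>g. g \<in> carrier G \<Longrightarrow> map_action G g \<phi> = \<phi>" "h \<in> carrier G"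
  shows "\<phi> h = \<phi> \<one>\<^bsub>G\<^esub>"
proof -
  interpret group G by fact
  have "map_action G h \<phi> h = \<phi> \<one>\<^bsub>G\<^esub>"
    using assms(3) by (simp add: map_action_def)
  then show ?thesis using assms by simp
qed

lemma fixed_point_free_subspace:
  assumes "group G" and S: "S \<subseteq> carrier G \<rightarrow>\<^sub>E topspace Y"
    and inv: "\<And>g \<phi>. g \<in> carrier G \<Longrightarrow> \<phi> \<in> S \<Longrightarrow> map_action G g \<phi> \<in> S"
    and nonconst: "\<And>\<phi>. \<phi> \<in> S \<Longrightarrow> \<not> \<phi> constant_on carrier G"
  shows "fixed_point_free_G_space G
           (subtopology (product_topology (\<lambda>_. Y) (carrier G)) S) (map_action G)"
proof -
  interpret group G by fact
  have top: "topspace (subtopology (product_topology (\<lambda>_. Y) (carrier G)) S) = S"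
    using S by auto
  have ext: "\<phi> \<in> extensional (carrier G)" if "\<phi> \<in> S" for \<phi>
    using that S by (auto simp: PiE_def)
  show ?thesis
    unfolding fixed_point_free_G_space_def top
  proof (intro conjI ballI notI)
    show "group G" by fact
  next
    fix g assume g: "g \<in> carrier G"
    show "continuous_map (subtopology (product_topology (\<lambda>_. Y) (carrier G)) S)
                 (subtopology (product_topology (\<lambda>_. Y) (carrier G)) S) (map_action G g)"
      unfolding continuous_map_in_subtopology top
      using inv[OF g] continuous_map_from_subtopology[OF continuous_map_map_action[OF assms(1) g]]
      by blast
  next
    fix \<phi> assume "\<phi> \<in> S"
    then show "map_action G \<one>\<^bsub>G\<^esub> \<phi> = \<phi>"
      using ext by (intro extensionalityI[where A = "carrier G"]) (auto simp: map_action_def)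
  next
    fix g h \<phi> assume "g \<in> carrier G" "h \<in> carrier G" "\<phi> \<in> S"
    then show "map_action G (g \<otimes>\<^bsub>G\<^esub> h) \<phi> = map_action G g (map_action G h \<phi>)"
      by (auto simp: map_action_def inv_mult_group m_assoc restrict_def fun_eq_iff)
  next
    assume "\<exists>\<phi>\<in>S. \<forall>g\<in>carrier G. map_action G g \<phi> = \<phi>"
    then obtain \<phi> where "\<phi> \<in> S" "\<And>g. g \<in> carrier G \<Longrightarrow> map_action G g \<phi> = \<phi>" by blast
    then show False
      using nonconst fixed_point_constant[OF assms(1)] unfolding constant_on_def by metis
  qed
qed

lemma constant_diagonal:
  assumes "finite I" "k \<le> card I" "y \<in> I \<rightarrow>\<^sub>E topspace Y" "y constant_on I"
  shows "y \<in> diagonal I k Y"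
proof -
  obtain J where "J \<subseteq> I" "card J = k"
    using assms(1,2) by (meson obtain_subset_with_card_n)
  then show ?thesis
    using assms(3) constant_on_subset[OF assms(4)] unfolding diagonal_def by blast
qed

proposition fixed_point_free_V:
  assumes "group G" "finite (carrier G)" "k \<le> order G"
  shows "fixed_point_free_G_space G (V_space (carrier G) m k) (map_action G)"
  unfolding V_space_def
proof (intro fixed_point_free_subspace assms(1) notI)
  let ?S = "(carrier G \<rightarrow>\<^sub>E topspace (Euclidean_space m))
              - diagonal (carrier G) k (Euclidean_space m)"
  {
    fix g \<phi> assume "g \<in> carrier G" "\<phi> \<in> ?S"
    then show "map_action G g \<phi> \<in> ?S"
      using map_action_in[OF assms(1)] map_action_diagonal[OF assms(1)] by blast
  next
    fix \<phi> assume "\<phi> \<in> ?S" "\<phi> constant_on carrier G"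
    then show False
      using constant_diagonal[OF assms(2)] assms(3) unfolding order_def by blast
  }
qed auto

proposition fixed_point_free_W:
  assumes "group G" "finite (carrier G)" "k \<le> order G"
  shows "fixed_point_free_G_space G (W_space (carrier G) k) (map_action G)"
  unfolding W_space_def
proof (intro fixed_point_free_subspace assms(1) notI)
  fix g and \<phi> :: "'a \<Rightarrow> real"
  assume g: "g \<in> carrier G" and \<phi>: "\<phi> \<in> (carrier G \<rightarrow>\<^sub>E UNIV) - max_diagonal (carrier G) k"
  show "map_action G g \<phi> \<in> (carrier G \<rightarrow>\<^sub>E UNIV) - max_diagonal (carrier G) k"
    using \<phi> map_action_in[OF assms(1) g, of \<phi> UNIV] map_action_max_diagonal[OF assms(1) g, of \<phi> k]
    by (simp only: Diff_iff) argo
next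
  fix \<phi> :: "'a \<Rightarrow> real"
  assume \<phi>: "\<phi> \<in> (carrier G \<rightarrow>\<^sub>E UNIV) - max_diagonal (carrier G) k" "\<phi> constant_on carrier G"
  obtain J where J: "J \<subseteq> carrier G" "card J = k"
    using assms(2,3) unfolding order_def by (meson obtain_subset_with_card_n)
  obtain c where c: "\<forall>h\<in>carrier G. \<phi> h = c"
    using \<phi>(2) by (auto simp: constant_on_def)
  have "(\<forall>i\<in>J. \<phi> i = c) \<and> (\<forall>j\<in>carrier G. \<phi> j \<le> c)"
    using J c by auto
  then have "\<phi> \<in> max_diagonal (carrier G) k"
    using \<phi>(1) J unfolding max_diagonal_def by blast
  then show False using \<phi>(1) by blast
qed auto

proposition fixed_point_free_V1:
  assumes "group G" "finite (carrier G)" "k \<le> order G" "m \<ge> 1"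
  shows "fixed_point_free_G_space G (V1_space (carrier G) m k) (map_action G)"
  unfolding V1_space_def
proof (intro fixed_point_free_subspace assms(1) notI)
  interpret group G by fact
  let ?E = "carrier G \<rightarrow>\<^sub>E topspace (Euclidean_space m)"
  let ?D = "diagonal (carrier G) k euclideanreal \<times>
            diagonal (carrier G) (card (carrier G)) (Euclidean_space (m - 1))"
  have split_in: "fst (split_power (carrier G) \<phi>) \<in> carrier G \<rightarrow>\<^sub>E topspace euclideanreal"
      "snd (split_power (carrier G) \<phi>) \<in> carrier G \<rightarrow>\<^sub>E topspace (Euclidean_space (m - 1))"
    if "\<phi> \<in> ?E" for \<phi>
    using that assms(4) by (auto simp: split_power_def topspace_Euclidean_space PiE_iff)
  {
    fix g \<phi> assume g: "g \<in> carrier G" and \<phi>: "\<phi> \<in> {y \<in> ?E. split_power (carrier G) y \<notin> ?D}"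
    have "split_power (carrier G) (map_action G g \<phi>) =
            (map_action G g (fst (split_power (carrier G) \<phi>)),
             map_action G g (snd (split_power (carrier G) \<phi>)))"
      using g by (auto simp: split_power_def map_action_def intro!: restrict_ext)
    then have "split_power (carrier G) (map_action G g \<phi>) \<notin> ?D"
      using \<phi> map_action_diagonal[OF assms(1) g split_in(1)]
        map_action_diagonal[OF assms(1) g split_in(2)]
      by (auto simp: mem_Times_iff)
    then show "map_action G g \<phi> \<in> {y \<in> ?E. split_power (carrier G) y \<notin> ?D}"
      using \<phi> map_action_in[OF assms(1) g] by blast
  next
    fix \<phi> assume \<phi>: "\<phi> \<in> {y \<in> ?E. split_power (carrier G) y \<notin> ?D}" "\<phi> constant_on carrier G"
    have "fst (split_power (carrier G) \<phi>) constant_on carrier G"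
         "snd (split_power (carrier G) \<phi>) constant_on carrier G"
      using \<phi>(2) by (auto simp: split_power_def constant_on_def)
    then have "split_power (carrier G) \<phi> \<in> ?D"
      using \<phi>(1) assms(3) constant_diagonal[OF assms(2) _ split_in(1)]
        constant_diagonal[OF assms(2) _ split_in(2)]
      unfolding order_def mem_Times_iff by blast
    then show False using \<phi>(1) by simp
  }
qed auto

end

theory Submission
  imports Defs "HOL-Computational_Algebra.Polynomial"
begin

text \<open>
  Let \<open>q\<close> be the order of \<open>G\<close>, and call an invariant open set with an equivariant map to \<open>D\<^sub>G\<close> a piece.

  The upper bounds come from explicit covers.  A real function on \<open>G\<close> that attains its maximum fewer than
  \<open>k\<close> times has, for some \<open>t\<close> with \<open>1 \<le> t < k\<close>, a top set of size \<open>t\<close>: a set of \<open>t\<close> elements on which the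
  function is larger than on all others.  A top set of given size is unique, depends equivariantly on the
  function and is locally constant, and as a proper nonempty subset it is not fixed by \<open>G\<close>.  So the functions
  with a top set of size \<open>t\<close> form a piece (\<open>piece_size\<close>).  This yields \<open>k - 1\<close> pieces for \<open>W\<close>, hence for \<open>V\<close> in
  dimension one.  For \<open>V\<^sub>1\<close>, and for \<open>V\<close>, which is contained in it, these \<open>k - 1\<close> pieces for the first coordinate
  are joined by \<open>q - 1\<close> pieces for each of the other \<open>m - 1\<close> coordinates.

  The lower bounds are reduced to one: the space \<open>S\<close> of all nonconstant maps from \<open>G\<close> to \<open>\<real>\<^sup>m\<close> is not covered by
  fewer than \<open>m (q - 1)\<close> pieces (\<open>sphere_not_covered\<close>).  The spaces \<open>V\<close> and \<open>V\<^sub>1\<close> are open in \<open>S\<close>, and their complements in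
  \<open>S\<close> lie in the union of \<open>q - k\<close> further pieces.  For this one needs an equivariant map \<open>F\<close> from \<open>S\<close> to the real
  functions on \<open>G\<close> whose value on the complement is a nonconstant function that repeats some value \<open>k\<close> times.  Such a
  function has at least one and at most \<open>q - k\<close> positive gaps between consecutive values, and the sets of its \<open>t\<close>
  largest gaps determine a piece for each \<open>t\<close> (\<open>piece_gap\<close>, \<open>lower_bound\<close>).  The first coordinate serves for \<open>V\<^sub>1\<close> and for
  \<open>V\<close> in dimension one; for \<open>V\<close> in dimension \<open>m\<close> and \<open>k > q / 2\<close> the sum of the distances to all values does, which is
  smaller at a majority value than elsewhere.  The space \<open>W\<close> receives an equivariant map from \<open>V\<close>.

  The statement on \<open>S\<close> is a Borsuk-Ulam theorem.  Its proof replaces equivariant cohomology by one operator \<open>t\<close>: a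
  group ring element with generic coefficients in \<open>\<int>[x]\<close> and sum of coefficients zero, considered modulo \<open>p\<close>, where
  \<open>t\<^sup>p = 0\<close>.  On the one hand, the simplices spanned by translated unit vectors, \<open>q - 1\<close> in each direction, contain no
  constant map; they carry chains \<open>x\<^sub>0, x\<^sub>1, \<dots>\<close> up to dimension \<open>m (q - 1) - 1\<close> such that the boundary of \<open>x\<^sub>i\<^sub>+\<^sub>1\<close> is
  \<open>t\<^sup>p\<^sup>-\<^sup>1 x\<^sub>i\<close> or \<open>t x\<^sub>i\<close>, alternately (\<open>tst_cobdry\<close>).  On the other hand, \<open>M\<close> pieces covering \<open>S\<close> give, after
  subdivision, an equivariant simplicial map to a complex of dimension \<open>M - 1\<close> all of whose isotropy groups are
  proper.  A proper isotropy group leaves a coordinate modulo \<open>p\<close> that \<open>G\<close> translates by a nonzero character.  With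
  this coordinate \<open>t\<close> satisfies the Weyl relation, so that the kernel of \<open>t\<^sup>e\<close> on cochains is the image of \<open>t\<^sup>p\<^sup>-\<^sup>e\<close>, up to
  nonzero scalars (\<open>kernel_in_image_power\<close>).  Starting from the cocycle 1, which \<open>t\<close> kills, one therefore finds
  cochains \<open>w\<^sub>0, w\<^sub>1, \<dots>\<close> with \<open>1 = t\<^sup>p\<^sup>-\<^sup>1 w\<^sub>0\<close> and such that the coboundary of \<open>w\<^sub>i\<close> is \<open>t w\<^sub>i\<^sub>+\<^sub>1\<close> or
  \<open>t\<^sup>p\<^sup>-\<^sup>1 w\<^sub>i\<^sub>+\<^sub>1\<close>, alternately, until the dimension is exhausted.  Pairing the two sequences gives
  \<open>1 = \<langle>t\<^sup>p\<^sup>-\<^sup>1 w\<^sub>0, x\<^sub>0\<rangle> = \<langle>w\<^sub>0, \<partial>x\<^sub>1\<rangle> = \<langle>t w\<^sub>1, x\<^sub>1\<rangle> = \<dots> = 0\<close> if \<open>M < m (q - 1)\<close> (\<open>no_test_functional\<close>).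
\<close>

(* Below, the symbol denotes left cosets. *)
no_notation (ASCII) subset_mset  (infix "<#" 50)

section \<open>Cochains on lists\<close>

definition del :: "nat \<Rightarrow> 'a list \<Rightarrow> 'a list" where
  "del k s = take k s @ drop (Suc k) s"

text \<open>
  The simplicial coboundary, with all tuples (also degenerate ones) as simplices.  On lists of length
  one it returns the value at the empty list, so the complex is augmented.
\<close>

definition cobdry :: "('a list \<Rightarrow> 'r::comm_ring_1) \<Rightarrow> 'a list \<Rightarrow> 'r" where
  "cobdry w s = (\<Sum>k<length s. (-1)^k * w (del k s))"

lemma length_del: "k < length s \<Longrightarrow> length (del k s) = length s - 1"
  by (simp add: del_def)

lemma del_map: "del k (map f s) = map f (del k s)"
  by (simp add: del_def take_map drop_map)

lemma set_del: "set (del k s) \<subseteq> set s"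
  by (auto simp: del_def dest: in_set_takeD in_set_dropD)

lemma sorted_wrt_del:
  assumes "sorted_wrt P s"
  shows "sorted_wrt P (del k s)"
proof (cases "k < length s")
  case True
  then have "sorted_wrt P (take k s @ s ! k # drop (Suc k) s)"
    using assms by (simp add: id_take_nth_drop[symmetric])
  then show ?thesis by (simp add: del_def sorted_wrt_append)
qed (use assms in \<open>simp add: del_def\<close>)

lemma del_snoc: "k < length s \<Longrightarrow> del k (s @ [a]) = del k s @ [a]"
  by (simp add: del_def)

lemma del_last: "del (length s) (s @ [a]) = s"
  by (simp add: del_def)

lemma cobdry_Nil [simp]: "cobdry w [] = 0"
  by (simp add: cobdry_def)

lemma cobdry_snoc:
  "cobdry w (s @ [a]) = cobdry (\<lambda>s. w (s @ [a])) s + (-1)^length s * w s"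
  by (simp add: cobdry_def del_snoc del_last)

lemma cobdry_cong:
  assumes "\<And>s'. length s = Suc (length s') \<Longrightarrow> set s' \<subseteq> set s \<Longrightarrow> w s' = w' s'"
  shows "cobdry w s = cobdry w' s"
  unfolding cobdry_def
  using assms set_del[of _ s] by (intro sum.cong refl) (auto simp: length_del)

lemma cobdry_add: "cobdry (\<lambda>s. u s + w s) s = cobdry u s + cobdry w s"
  by (simp add: cobdry_def algebra_simps sum.distrib)

lemma cobdry_scale: "cobdry (\<lambda>s. c * w s) s = c * cobdry w s"
  by (simp add: cobdry_def sum_distrib_left algebra_simps)

lemma cobdry_diff: "cobdry (\<lambda>s. u s - w s) s = cobdry u s - cobdry w s"
  by (simp add: cobdry_def algebra_simps sum_subtractf)

lemma cobdry_sum: "cobdry (\<lambda>s. \<Sum>i\<in>I. w i s) s = (\<Sum>i\<in>I. cobdry (w i) s)"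
  unfolding cobdry_def by (subst sum.swap) (simp add: sum_distrib_left)

lemma cobdry_map: "cobdry (\<lambda>s. w (map f s)) s = cobdry w (map f s)"
  by (simp add: cobdry_def del_map)

lemma cobdry_cobdry: "cobdry (cobdry w) s = 0"
proof (induction s arbitrary: w rule: rev_induct)
  case Nil
  show ?case by simp
next
  case (snoc a s)
  have "cobdry (\<lambda>s. cobdry w (s @ [a])) s
        = cobdry (\<lambda>r. cobdry (\<lambda>s. w (s @ [a])) r + (-1)^(length s - 1) * w r) s"
    by (rule cobdry_cong) (simp add: cobdry_snoc)
  also have "\<dots> = (-1)^(length s - 1) * cobdry w s"
    by (simp add: cobdry_add cobdry_scale snoc.IH)
  finally have "cobdry (cobdry w) (s @ [a]) = (-1)^(length s - 1) * cobdry w s + (-1)^length s * cobdry w s"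
    by (subst cobdry_snoc) simp
  then show ?case by (cases s) simp_all
qed

text \<open>
  A cochain that vanishes on lists with two equal neighbours has a coboundary with the same
  property: the two terms that delete one of the equal neighbours cancel.
\<close>

lemma cobdry_repeated:
  assumes "\<And>as b bs. w (as @ [b, b] @ bs) = 0"
  shows "cobdry w (as @ [b, b] @ bs) = 0"
proof -
  let ?s = "as @ [b, b] @ bs" and ?n = "length as"
  have zero: "w (del k ?s) = 0" if k: "k < length ?s" "k \<noteq> ?n" "k \<noteq> Suc ?n" for k
  proof (cases "k < ?n")
    case True
    then have "del k ?s = del k as @ [b, b] @ bs" by (simp add: del_def)
    then show ?thesis using assms by simp
  next
    case False
    then obtain j where j: "k = Suc (Suc (?n + j))"
      using k by (metis Suc_leI linorder_not_less le_Suc_ex nat_less_le add_Suc)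
    have "del k ?s = as @ [b, b] @ del j bs"
      by (simp add: del_def j numeral_3_eq_3)
    then show ?thesis using assms by simp
  qed
  have "cobdry w ?s = (\<Sum>k\<in>{?n, Suc ?n}. (-1)^k * w (del k ?s))"
    unfolding cobdry_def by (rule sum.mono_neutral_right) (use zero in auto)
  also have "\<dots> = 0"
    by (simp add: del_def)
  finally show ?thesis .
qed

section \<open>Subdivision of cochains\<close>

text \<open>
  Pullback along a barycentric subdivision.  Dually, the subdivision of a simplex \<open>s\<close> is the cone over
  the subdivision of its boundary.  The apex \<open>\<beta> s\<close> will be the barycentre when simplices are made
  small, and a label chosen among the labels of the vertices of \<open>s\<close> in the last step.
\<close>

function pull :: "('a list \<Rightarrow> 'b) \<Rightarrow> ('b list \<Rightarrow> 'r::comm_ring_1) \<Rightarrow> 'a list \<Rightarrow> 'r" where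
  "pull \<beta> w s = (if s = [] then w []
     else (-1)^(length s - 1) *
          (\<Sum>k<length s. (-1)^k * pull \<beta> (\<lambda>r. w (r @ [\<beta> s])) (del k s)))"
  by auto
termination
  by (relation "Wellfounded.measure (\<lambda>(_, _, s). length s)") (auto simp: length_del)

declare pull.simps [simp del]

lemma pull_Nil [simp]: "pull \<beta> w [] = w []"
  by (simp add: pull.simps)

lemma pull_nonempty:
  assumes "s \<noteq> []"
  shows "pull \<beta> w s = (-1)^(length s - 1) * cobdry (pull \<beta> (\<lambda>r. w (r @ [\<beta> s]))) s"
  using assms by (simp add: pull.simps[of \<beta> w s] cobdry_def)

lemma pull_singleton [simp]: "pull \<beta> w [a] = w [\<beta> [a]]"
  by (simp add: pull_nonempty cobdry_def del_def)

lemma pull_sum_scale: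
  "pull \<beta> (\<lambda>s. \<Sum>i\<in>I. c i * w i s) s = (\<Sum>i\<in>I. c i * pull \<beta> (w i) s)"
proof (induction "length s" arbitrary: s w rule: less_induct)
  case less
  show ?case
  proof (cases "s = []")
    case False
    have "cobdry (pull \<beta> (\<lambda>r. \<Sum>i\<in>I. c i * w i (r @ [\<beta> s]))) s
         = cobdry (\<lambda>r. \<Sum>i\<in>I. c i * pull \<beta> (\<lambda>r. w i (r @ [\<beta> s])) r) s"
      by (rule cobdry_cong) (rule less, simp)
    then show ?thesis
      using False by (simp add: pull_nonempty cobdry_sum cobdry_scale sum_distrib_left mult.left_commute)
  qed simp
qed

lemma pull_scale: "pull \<beta> (\<lambda>s. c * w s) s = c * pull \<beta> w s"
  using pull_sum_scale[of \<beta> "\<lambda>_. c" "\<lambda>_. w" "{()}" s] by simp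

lemma pull_add: "pull \<beta> (\<lambda>s. u s + w s) s = pull \<beta> u s + pull \<beta> w s"
  using pull_sum_scale[of \<beta> "\<lambda>_. 1" "\<lambda>b. if b then u else w" UNIV s]
  by (simp add: UNIV_bool add.commute)

lemma pull_map:
  assumes "\<And>s. s \<noteq> [] \<Longrightarrow> \<beta> (map f s) = g (\<beta> s)"
  shows "pull \<beta> (\<lambda>s. w (map g s)) s = pull \<beta> w (map f s)"
proof (induction "length s" arbitrary: s w rule: less_induct)
  case less
  show ?case
  proof (cases "s = []")
    case False
    have "cobdry (pull \<beta> (\<lambda>r. w (map g (r @ [\<beta> s])))) s
         = cobdry (\<lambda>r. pull \<beta> (\<lambda>r. w (r @ [g (\<beta> s)])) (map f r)) s"
      by (rule cobdry_cong) (use less[of _ "\<lambda>r. w (r @ [g (\<beta> s)])"] in simp)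
    then show ?thesis
      using False assms by (simp add: pull_nonempty cobdry_map)
  qed simp
qed

text \<open>
  The lists on which the pullback of a cochain to \<open>s\<close> depends: the new vertices of a complete flag of
  faces of \<open>s\<close>, from small to large.
\<close>

inductive_set flags :: "('a list \<Rightarrow> 'b) \<Rightarrow> ('a list \<times> 'b list) set" for \<beta> where
  flags_Nil: "([], []) \<in> flags \<beta>"
| flags_step: "s \<noteq> [] \<Longrightarrow> k < length s \<Longrightarrow> (del k s, r) \<in> flags \<beta> \<Longrightarrow> (s, r @ [\<beta> s]) \<in> flags \<beta>"

lemma length_flags: "(s, r) \<in> flags \<beta> \<Longrightarrow> length r = length s"
  by (induction rule: flags.induct) (auto simp: length_del)

lemma pull_dvd:
  assumes "\<And>r. (s, r) \<in> flags \<beta> \<Longrightarrow> P dvd w r"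
  shows "P dvd pull \<beta> w s"
  using assms
proof (induction "length s" arbitrary: s w rule: less_induct)
  case less
  show ?case
  proof (cases "s = []")
    case True
    then show ?thesis using less.prems[of "[]"] flags_Nil[of \<beta>] by simp
  next
    case False
    have "P dvd pull \<beta> (\<lambda>r. w (r @ [\<beta> s])) (del k s)" if "k < length s" for k
      using that False less.prems flags_step[of s k _ \<beta>] by (intro less.hyps) (auto simp: length_del)
    then show ?thesis
      using False by (auto simp: pull_nonempty cobdry_def intro!: dvd_mult dvd_sum)
  qed
qed

lemma pull_cong:
  assumes "\<And>r. (s, r) \<in> flags \<beta> \<Longrightarrow> w r = w' r"
  shows "pull \<beta> w s = pull \<beta> w' s"
proof -
  have "0 dvd pull \<beta> (\<lambda>r. w r + (-1) * w' r) s"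
    by (rule pull_dvd) (simp add: assms)
  then show ?thesis
    by (simp only: pull_add pull_scale) simp
qed

text \<open>
  In the expansion of the right-hand side the terms that drop the apex add up to the left-hand side;
  the others are, by induction, a coboundary of a coboundary.
\<close>

lemma cobdry_pull:
  fixes s :: "'b list"
  shows "cobdry (pull \<beta> w) s = pull \<beta> (cobdry w) s"
proof (induction "length s" arbitrary: s w rule: less_induct)
  case less
  show ?case
  proof (cases "s = []")
    case False
    let ?b = "\<beta> s" and ?n = "length s - 1"
    have "cobdry (pull \<beta> (\<lambda>r. cobdry w (r @ [?b]))) s
         = cobdry (\<lambda>r. cobdry (pull \<beta> (\<lambda>r. w (r @ [?b]))) r + (-1)^?n * pull \<beta> w r) s"
    proof (rule cobdry_cong)
      fix s' :: "'b list" assume s': "length s = Suc (length s')"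
      have "pull \<beta> (\<lambda>r. cobdry w (r @ [?b])) s'
          = pull \<beta> (\<lambda>r. cobdry (\<lambda>r. w (r @ [?b])) r + (-1)^?n * w r) s'"
        by (rule pull_cong) (use s' in \<open>simp add: cobdry_snoc length_flags\<close>)
      also have "\<dots> = cobdry (pull \<beta> (\<lambda>r. w (r @ [?b]))) s' + (-1)^?n * pull \<beta> w s'"
        using less[of s' "\<lambda>r. w (r @ [?b])"] s' by (simp add: pull_add pull_scale)
      finally show "pull \<beta> (\<lambda>r. cobdry w (r @ [?b])) s' = \<dots>" .
    qed
    also have "\<dots> = (-1)^?n * cobdry (pull \<beta> w) s"
      by (simp add: cobdry_add cobdry_scale cobdry_cobdry)
    finally show ?thesis
      using False by (simp add: pull_nonempty mult.assoc[symmetric] power_add[symmetric])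
  qed simp
qed

section \<open>Frobenius for group ring operators modulo a prime\<close>

definition linop :: "(('z \<Rightarrow> 'r::comm_ring_1) \<Rightarrow> 'z \<Rightarrow> 'r) \<Rightarrow> bool" where
  "linop A \<longleftrightarrow> (\<forall>n c w. A (\<lambda>z. \<Sum>i\<le>(n::nat). c i * w i z) = (\<lambda>z. \<Sum>i\<le>n. c i * A (w i) z))"

lemma linop_sum: "linop A \<Longrightarrow> A (\<lambda>z. \<Sum>i\<le>(n::nat). c i * w i z) = (\<lambda>z. \<Sum>i\<le>n. c i * A (w i) z)"
  by (simp add: linop_def)

lemma linop_scale: "linop A \<Longrightarrow> A (\<lambda>z. c * w z) = (\<lambda>z. c * A w z)"
  using linop_sum[of A "\<lambda>_. c" "\<lambda>_. w" 0] by simp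

lemma linop_add: "linop A \<Longrightarrow> A (\<lambda>z. u z + w z) = (\<lambda>z. A u z + A w z)"
  using linop_sum[of A "\<lambda>_. 1" "\<lambda>i. if i = 0 then u else w" 1] by simp

lemma linop_diff: "linop A \<Longrightarrow> A (\<lambda>z. u z - w z) = (\<lambda>z. A u z - A w z)"
  using linop_add[of A u "\<lambda>z. (-1) * w z"] linop_scale[of A "-1" w] by simp

lemma linop_funpow: "linop A \<Longrightarrow> linop (A ^^ n)"
  by (induction n) (simp_all add: linop_def)

lemma funpow_commute:
  assumes "\<And>w. A (B w) = B (A w)"
  shows "(A ^^ n) (B w) = B ((A ^^ n) w)"
  by (induction n) (simp_all add: assms)

lemma linop_binomial:
  assumes A: "linop A" and B: "linop B" and comm: "\<And>w. A (B w) = B (A w)"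
  shows "((\<lambda>w z. A w z + B w z) ^^ n) w
         = (\<lambda>z. \<Sum>k\<le>n. of_nat (n choose k) * (A ^^ k) ((B ^^ (n - k)) w) z)"
proof (induction n)
  case (Suc n)
  define T where "T k z = (A ^^ k) ((B ^^ (Suc n - k)) w) z" for k z
  have BA: "B ((A ^^ k) u) = (A ^^ k) (B u)" for k u
    by (rule funpow_commute[symmetric]) (rule comm)
  have 1: "A (\<lambda>z. \<Sum>k\<le>n. of_nat (n choose k) * (A ^^ k) ((B ^^ (n - k)) w) z) z
        = (\<Sum>k\<le>n. of_nat (n choose k) * T (Suc k) z)" for z
    by (simp add: linop_sum[OF A] T_def)
  have "B (\<lambda>z. \<Sum>k\<le>n. of_nat (n choose k) * (A ^^ k) ((B ^^ (n - k)) w) z) z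
        = (\<Sum>k\<le>n. of_nat (n choose k) * (A ^^ k) ((B ^^ Suc (n - k)) w) z)" for z
    by (simp add: linop_sum[OF B] BA)
  also have "\<dots> z = (\<Sum>k\<le>n. of_nat (n choose k) * T k z)" for z
    by (intro sum.cong) (simp_all add: T_def Suc_diff_le)
  finally have 2: "B (\<lambda>z. \<Sum>k\<le>n. of_nat (n choose k) * (A ^^ k) ((B ^^ (n - k)) w) z) z
        = (\<Sum>k\<le>n. of_nat (n choose k) * T k z)" for z .
  have "(\<Sum>k\<le>n. of_nat (n choose k) * T (Suc k) z) + (\<Sum>k\<le>n. of_nat (n choose k) * T k z)
      = (\<Sum>k\<le>Suc n. of_nat (Suc n choose k) * T k z)" for z
  proof -
    have "(\<Sum>k\<le>n. of_nat (n choose k) * T k z) = (\<Sum>k\<le>Suc n. of_nat (n choose k) * T k z)"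
      by (simp add: binomial_eq_0)
    also have "\<dots> = T 0 z + (\<Sum>k\<le>n. of_nat (n choose Suc k) * T (Suc k) z)"
      by (subst sum.atMost_Suc_shift) simp
    moreover have "(\<Sum>k\<le>Suc n. of_nat (Suc n choose k) * T k z)
        = T 0 z + (\<Sum>k\<le>n. of_nat (Suc n choose Suc k) * T (Suc k) z)"
      by (subst sum.atMost_Suc_shift) simp
    ultimately show ?thesis
      by (simp add: sum.distrib algebra_simps del: sum.atMost_Suc)
  qed
  then show ?case
    using 1 2 by (simp add: Suc.IH T_def)
qed simp

text \<open>
  In the binomial expansion only the two outer coefficients are not divisible by \<open>p\<close>.
\<close>

lemma linop_frobenius_add:
  assumes "linop A" "linop B" "\<And>w. A (B w) = B (A w)" and p: "prime p"
  shows "of_nat p dvd ((\<lambda>w z. A w z + B w z) ^^ p) w z - ((A ^^ p) w z + (B ^^ p) w z)"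
proof -
  let ?T = "\<lambda>k. (A ^^ k) ((B ^^ (p - k)) w) z"
  have p1: "p > 1" using p prime_gt_1_nat by blast
  have split: "{..p} = insert 0 (insert p {0<..<p})" using p1 by auto
  have "((\<lambda>w z. A w z + B w z) ^^ p) w z = (\<Sum>k\<le>p. of_nat (p choose k) * ?T k)"
    by (simp add: linop_binomial[OF assms(1-3)])
  also have "\<dots> = (A ^^ p) w z + (B ^^ p) w z + (\<Sum>k\<in>{0<..<p}. of_nat (p choose k) * ?T k)"
    unfolding split using p1 by simp
  finally have "((\<lambda>w z. A w z + B w z) ^^ p) w z - ((A ^^ p) w z + (B ^^ p) w z)
      = (\<Sum>k\<in>{0<..<p}. of_nat (p choose k) * ?T k)" by simp
  moreover have "of_nat p dvd of_nat (p choose k) * ?T k" if "k \<in> {0<..<p}" for k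
  proof -
    have "p dvd (p choose k)" using that p p1 by (intro dvd_choose_prime) auto
    then obtain m where "p choose k = p * m" by blast
    then have "of_nat (p choose k) * ?T k = of_nat p * (of_nat m * ?T k)"
      by (simp add: algebra_simps)
    then show ?thesis by (metis dvd_triv_left)
  qed
  ultimately show ?thesis by (auto intro!: dvd_sum)
qed

text \<open>
  The operator of a group ring element whose coefficients may depend on the point.  The sum over a
  subset \<open>S\<close> of the group allows induction on the number of summands.
\<close>

definition gop :: "'g set \<Rightarrow> ('g \<Rightarrow> 'z \<Rightarrow> 'z) \<Rightarrow> ('z \<Rightarrow> 'g \<Rightarrow> 'r::comm_ring_1) \<Rightarrow> ('z \<Rightarrow> 'r) \<Rightarrow> 'z \<Rightarrow> 'r"
  where "gop S act f w z = (\<Sum>g\<in>S. f z g * w (act g z))"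

lemma linop_gop: "linop (gop S act f)"
  unfolding linop_def gop_def
  by (auto simp: sum_distrib_left algebra_simps intro: sum.swap)

locale elementary_abelian = comm_group G for G (structure) +
  fixes p :: nat
  assumes prime_p: "prime p" and finite_carrier: "finite (carrier G)"
    and exponent: "g \<in> carrier G \<Longrightarrow> g [^] p = \<one>"

locale elementary_abelian_action = elementary_abelian +
  fixes act :: "'a \<Rightarrow> 'z \<Rightarrow> 'z"
  assumes act_one: "act \<one> z = z"
    and act_mult: "g \<in> carrier G \<Longrightarrow> h \<in> carrier G \<Longrightarrow> act (g \<otimes> h) z = act g (act h z)"
begin

lemma act_commute: "g \<in> carrier G \<Longrightarrow> h \<in> carrier G \<Longrightarrow> act g (act h z) = act h (act g z)"
  by (metis act_mult m_comm)

definition invariant_weight :: "('z \<Rightarrow> 'a \<Rightarrow> 'r::comm_ring_1) \<Rightarrow> bool" where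
  "invariant_weight f \<longleftrightarrow> (\<forall>z. \<forall>g\<in>carrier G. \<forall>h\<in>carrier G. f (act h z) g = f z g)"

lemma gop_commute:
  assumes "invariant_weight f" "invariant_weight f'" "S \<subseteq> carrier G" "S' \<subseteq> carrier G"
  shows "gop S act f (gop S' act f' w) = gop S' act f' (gop S act f w)"
proof
  fix z
  have "gop S act f (gop S' act f' w) z = (\<Sum>g\<in>S. \<Sum>h\<in>S'. f z g * (f' z h * w (act h (act g z))))"
    using assms unfolding gop_def sum_distrib_left invariant_weight_def
    by (intro sum.cong refl) (metis subsetD)
  also have "\<dots> = (\<Sum>h\<in>S'. \<Sum>g\<in>S. f' z h * (f z g * w (act g (act h z))))"
    using assms by (subst sum.swap) (auto simp: act_commute mult.left_commute subset_iff intro!: sum.cong)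
  also have "\<dots> = gop S' act f' (gop S act f w) z"
    using assms unfolding gop_def sum_distrib_left invariant_weight_def
    by (intro sum.cong refl) (metis subsetD)
  finally show "gop S act f (gop S' act f' w) z = gop S' act f' (gop S act f w) z" .
qed

lemma gop_single_power:
  assumes "invariant_weight f" "h \<in> carrier G"
  shows "(gop {h} act f ^^ n) w z = f z h ^ n * w (act (h [^] n) z)"
proof (induction n arbitrary: z)
  case (Suc n)
  have "act (h [^] n) (act h z) = act (h [^] Suc n) z"
    using assms(2) act_mult[of "h [^] n" h z] by simp
  then show ?case
    using Suc assms by (simp add: gop_def invariant_weight_def)
qed (simp add: act_one)

text \<open>
  The mixed terms of the \<open>p\<close>-th power vanish modulo \<open>p\<close>, and \<open>g\<^sup>p = 1\<close> turns the pure powers into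
  scalars.
\<close>

lemma gop_frobenius:
  assumes f: "invariant_weight f"
  shows "of_nat p dvd (gop (carrier G) act f ^^ p) w z - (\<Sum>g\<in>carrier G. f z g ^ p) * w z"
proof -
  have "of_nat p dvd (gop S act f ^^ p) w z - (\<Sum>g\<in>S. f z g ^ p) * w z" if "S \<subseteq> carrier G" for S
    using finite_subset[OF that finite_carrier] that
  proof (induction S)
    case empty
    have "(gop {} act f ^^ Suc n) w z = 0" for n
      by (simp add: gop_def)
    from this[of "p - 1"] show ?case using prime_gt_0_nat[OF prime_p] by simp
  next
    case (insert h S)
    let ?A = "gop {h} act f" and ?B = "gop S act f"
    have split: "gop (insert h S) act f = (\<lambda>w z. ?A w z + ?B w z)"
      using insert by (simp add: gop_def fun_eq_iff)
    have "of_nat p dvd (gop (insert h S) act f ^^ p) w z - ((?A ^^ p) w z + (?B ^^ p) w z)"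
      unfolding split by (rule linop_frobenius_add[OF linop_gop linop_gop _ prime_p])
        (use insert.prems in \<open>auto intro: gop_commute[OF f f]\<close>)
    moreover have "(?A ^^ p) w z = f z h ^ p * w z"
      using insert.prems by (simp add: gop_single_power[OF f] exponent act_one)
    moreover have "of_nat p dvd (?B ^^ p) w z - (\<Sum>g\<in>S. f z g ^ p) * w z"
      using insert by simp
    ultimately have "of_nat p dvd ((gop (insert h S) act f ^^ p) w z - ((?A ^^ p) w z + (?B ^^ p) w z))
        + ((?B ^^ p) w z - (\<Sum>g\<in>S. f z g ^ p) * w z)"
      by (intro dvd_add)
    with \<open>(?A ^^ p) w z = f z h ^ p * w z\<close> show ?case
      using insert by (simp add: algebra_simps)
  qed
  then show ?thesis by blast
qed

end

section \<open>Kernels are images\<close>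

text \<open>
  An element of the augmentation ideal of the group ring, acting on functions.
\<close>

locale torus_operator = elementary_abelian_action +
  fixes \<tau> :: "'a \<Rightarrow> 'r::comm_ring_1"
  assumes sum_\<tau>: "(\<Sum>g\<in>carrier G. \<tau> g) = 0"
begin

definition tor :: "('c \<Rightarrow> 'r) \<Rightarrow> 'c \<Rightarrow> 'r" where
  "tor = gop (carrier G) act (\<lambda>_. \<tau>)"

lemma linop_tor: "linop tor"
  by (simp add: tor_def linop_gop)

lemma tor_const: "tor (\<lambda>_. c) = (\<lambda>_. 0)"
  by (simp add: fun_eq_iff tor_def gop_def sum_distrib_right[symmetric] sum_\<tau>)

lemma tor_dvd:
  assumes "\<And>z g. z \<in> P \<Longrightarrow> g \<in> carrier G \<Longrightarrow> act g z \<in> P"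
    and "\<And>z. z \<in> P \<Longrightarrow> d dvd w z" and "z \<in> P"
  shows "d dvd (tor ^^ k) w z"
proof -
  have "\<forall>z\<in>P. d dvd (tor ^^ k) w z"
  proof (induction k)
    case (Suc k)
    then show ?case
      using assms(1) by (auto simp: tor_def gop_def intro!: dvd_sum dvd_mult)
  qed (use assms(2) in simp)
  then show ?thesis using assms(3) by blast
qed

text \<open>
  The \<open>p\<close>-th power is multiplication by \<open>\<Sum>g. \<tau> g ^ p\<close>.  This scalar is zero modulo \<open>p\<close>, because the operator
  kills the constant function 1.
\<close>

lemma tor_power_p: "of_nat p dvd (tor ^^ p) w z"
proof -
  have f: "invariant_weight (\<lambda>_. \<tau>)"
    by (simp add: invariant_weight_def)
  have frob: "of_nat p dvd (tor ^^ p) w z - (\<Sum>g\<in>carrier G. \<tau> g ^ p) * w z" for w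
    using gop_frobenius[OF f, of w z] by (simp add: tor_def)
  have "(tor ^^ p) (\<lambda>_. 1) z = 0"
  proof -
    have "(tor ^^ n) (\<lambda>_. 0) = (\<lambda>_. 0)" for n
      by (induction n) (simp_all add: tor_const)
    then have "(tor ^^ n) (tor (\<lambda>_. 1)) z = 0" for n
      by (simp add: tor_const)
    then have "(tor ^^ Suc n) (\<lambda>_. 1) z = 0" for n
      by (simp only: funpow_Suc_right o_apply)
    from this[of "p - 1"] show ?thesis
      using prime_gt_0_nat[OF prime_p] by simp
  qed
  then have "of_nat p dvd (\<Sum>g\<in>carrier G. \<tau> g ^ p)"
    using frob[of "\<lambda>_. 1"] by simp
  then have "of_nat p dvd (\<Sum>g\<in>carrier G. \<tau> g ^ p) * w z"
    by (rule dvd_mult2)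
  from dvd_add[OF frob[of w] this] show ?thesis by simp
qed

end

text \<open>
  A coordinate modulo \<open>p\<close> that the group translates through a character is what a proper isotropy group
  leaves.  If the operator is generic for all characters \<open>\<kappa> z\<close> that occur, functions behave
  like a free module over the truncated polynomial ring in one variable of height \<open>p\<close>.  Because scalars
  prime to \<open>p\<close> need not be invertible, all statements hold up to such a scalar.
\<close>

locale torus_coordinate = torus_operator +
  fixes P :: "'c set" and crd :: "'c \<Rightarrow> int" and \<kappa> :: "'c \<Rightarrow> 'a \<Rightarrow> int"
  assumes P_act: "z \<in> P \<Longrightarrow> g \<in> carrier G \<Longrightarrow> act g z \<in> P"
    and crd_act: "z \<in> P \<Longrightarrow> g \<in> carrier G \<Longrightarrow> int p dvd crd (act g z) - (crd z + \<kappa> z g)"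
    and \<kappa>_act: "g \<in> carrier G \<Longrightarrow> \<kappa> (act g z) = \<kappa> z"
    and prime_elem_p: "prime_elem (of_nat p :: 'd)"
    and finite_norms: "finite ((\<lambda>z. \<Sum>g\<in>carrier G. (\<tau> g * of_int (\<kappa> z g)) ^ p) ` P)"
    and norm_nonzero: "z \<in> P \<Longrightarrow> \<not> of_nat p dvd (\<Sum>g\<in>carrier G. (\<tau> g * of_int (\<kappa> z g)) ^ p)"
begin

abbreviation cong_P :: "('c \<Rightarrow> 'd) \<Rightarrow> ('c \<Rightarrow> 'd) \<Rightarrow> bool" (infix "\<doteq>" 50) where
  "u \<doteq> w \<equiv> (\<forall>z\<in>P. of_nat p dvd u z - w z)"

definition slope :: "('c \<Rightarrow> 'd) \<Rightarrow> 'c \<Rightarrow> 'd" where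
  "slope = gop (carrier G) act (\<lambda>z g. \<tau> g * of_int (\<kappa> z g))"

definition mulcrd :: "('c \<Rightarrow> 'd) \<Rightarrow> 'c \<Rightarrow> 'd" where
  "mulcrd w z = of_int (crd z) * w z"

lemma invariant_slope: "invariant_weight (\<lambda>z g. \<tau> g * of_int (\<kappa> z g))"
  by (simp add: invariant_weight_def \<kappa>_act)

lemma linop_slope: "linop slope"
  by (simp add: slope_def linop_gop)

lemma cong_trans: "u \<doteq> w \<Longrightarrow> w \<doteq> y \<Longrightarrow> u \<doteq> y"
proof
  fix z assume "u \<doteq> w" "w \<doteq> y" "z \<in> P"
  then have "of_nat p dvd (u z - w z) + (w z - y z)" by (intro dvd_add) blast+
  then show "of_nat p dvd u z - y z" by simp
qed

lemma cong_sym: "u \<doteq> w \<Longrightarrow> w \<doteq> u"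
proof
  fix z assume "u \<doteq> w" "z \<in> P"
  then have "of_nat p dvd - (u z - w z)" by (simp only: dvd_minus_iff)
  then show "of_nat p dvd w z - u z" by simp
qed

lemma gop_cong_P:
  assumes "u \<doteq> w"
  shows "gop (carrier G) act f u \<doteq> gop (carrier G) act f w"
proof
  fix z assume "z \<in> P"
  then have "of_nat p dvd (\<Sum>g\<in>carrier G. f z g * (u (act g z) - w (act g z)))"
    using assms P_act by (intro dvd_sum dvd_mult) blast
  then show "of_nat p dvd gop (carrier G) act f u z - gop (carrier G) act f w z"
    by (simp add: gop_def sum_subtractf algebra_simps)
qed

lemma tor_cong: "u \<doteq> w \<Longrightarrow> tor u \<doteq> tor w"
  unfolding tor_def by (rule gop_cong_P)

lemma slope_cong: "u \<doteq> w \<Longrightarrow> slope u \<doteq> slope w"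
  unfolding slope_def by (rule gop_cong_P)

lemma funpow_cong:
  assumes "\<And>u w. u \<doteq> w \<Longrightarrow> A u \<doteq> A w" "u \<doteq> w"
  shows "(A ^^ n) u \<doteq> (A ^^ n) w"
proof (induction n)
  case (Suc n)
  show ?case using assms(1)[OF Suc.IH] by simp
qed (use assms(2) in simp)

lemma tor_slope: "tor (slope w) = slope (tor w)"
  unfolding tor_def slope_def
  by (rule gop_commute[OF _ invariant_slope]) (auto simp: invariant_weight_def)

text \<open>
  The Weyl relation: the commutator of the operator with multiplication by the coordinate is \<open>slope\<close>,
  an operator that commutes with \<open>tor\<close>.
\<close>

lemma tor_mulcrd: "tor (mulcrd w) \<doteq> (\<lambda>z. mulcrd (tor w) z + slope w z)"
proof
  fix z assume z: "z \<in> P"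
  have "tor (mulcrd w) z - (mulcrd (tor w) z + slope w z)
      = (\<Sum>g\<in>carrier G. \<tau> g * w (act g z) * of_int (crd (act g z) - (crd z + \<kappa> z g)))"
    by (simp add: tor_def slope_def gop_def mulcrd_def sum_distrib_left algebra_simps
        sum_subtractf sum.distrib)
  moreover have "of_nat p dvd (of_int (crd (act g z) - (crd z + \<kappa> z g)) :: 'd)" if g: "g \<in> carrier G" for g
  proof -
    obtain m where "crd (act g z) - (crd z + \<kappa> z g) = int p * m"
      using crd_act[OF z g] by blast
    then have "of_int (crd (act g z) - (crd z + \<kappa> z g)) = (of_nat p * of_int m :: 'd)"
      by (simp only: of_int_mult of_int_of_nat_eq)
    then show ?thesis by (simp only: dvd_triv_left)
  qed
  ultimately show "of_nat p dvd tor (mulcrd w) z - (mulcrd (tor w) z + slope w z)"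
    by (auto intro!: dvd_sum dvd_mult)
qed

lemma tor_power_mulcrd:
  "(tor ^^ Suc k) (mulcrd w)
     \<doteq> (\<lambda>z. mulcrd ((tor ^^ Suc k) w) z + of_nat (Suc k) * slope ((tor ^^ k) w) z)"
proof (induction k)
  case 0
  show ?case using tor_mulcrd[of w] by simp
next
  case (Suc k)
  let ?u = "(tor ^^ Suc k) w"
  have "(tor ^^ Suc (Suc k)) (mulcrd w)
     \<doteq> tor (\<lambda>z. mulcrd ?u z + of_nat (Suc k) * slope ((tor ^^ k) w) z)"
    using tor_cong[OF Suc.IH] by simp
  moreover have "tor (\<lambda>z. mulcrd ?u z + of_nat (Suc k) * slope ((tor ^^ k) w) z)
      = (\<lambda>z. tor (mulcrd ?u) z + of_nat (Suc k) * slope ?u z)"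
    by (simp add: linop_add[OF linop_tor] linop_scale[OF linop_tor] tor_slope del: of_nat_Suc)
  ultimately have 1: "(tor ^^ Suc (Suc k)) (mulcrd w)
      \<doteq> (\<lambda>z. tor (mulcrd ?u) z + of_nat (Suc k) * slope ?u z)" by simp
  have 2: "(\<lambda>z. tor (mulcrd ?u) z + of_nat (Suc k) * slope ?u z)
      \<doteq> (\<lambda>z. mulcrd (tor ?u) z + of_nat (Suc (Suc k)) * slope ?u z)"
    using tor_mulcrd[of ?u] by (simp add: algebra_simps)
  show ?case
    using cong_trans[OF 1 2] by simp
qed

lemma not_dvd_of_nat:
  assumes "0 < m" "m < p"
  shows "\<not> of_nat p dvd (of_nat m :: 'd)"
proof
  assume dvd: "of_nat p dvd (of_nat m :: 'd)"
  have "coprime m p"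
    using assms prime_p by (metis coprime_commute nat_dvd_not_less prime_imp_coprime)
  then obtain a b where "a * int m + b * int p = 1"
    using bezout_int[of "int m" "int p"] by (auto simp: coprime_iff_gcd_eq_1)
  then have "of_int (a * int m + b * int p) = (1 :: 'd)"
    by (simp only: of_int_1)
  then have "of_int a * of_nat m + of_int b * of_nat p = (1 :: 'd)"
    by simp
  moreover have "of_nat p dvd of_int a * of_nat m + of_int b * (of_nat p :: 'd)"
    using dvd by (intro dvd_add dvd_mult dvd_refl)
  ultimately have "of_nat p dvd (1 :: 'd)" by (simp only:)
  then show False
    using prime_elem_p by (simp add: prime_elem_def)
qed

lemma not_dvd_prod:
  assumes "finite S" "\<And>x. x \<in> S \<Longrightarrow> \<not> of_nat p dvd (x :: 'd)"
  shows "\<not> of_nat p dvd \<Prod>S"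
  using assms
proof (induction S)
  case empty
  then show ?case using prime_elem_p by (simp add: prime_elem_def)
next
  case (insert x S)
  then show ?case using prime_elem_p by (auto simp: prime_elem_dvd_mult_iff)
qed

text \<open>
  The \<open>p\<close>-th power of \<open>slope\<close> is multiplication by an invariant function with finitely many values,
  none of them divisible by \<open>p\<close>.  Multiplying by the product of the other values makes it a scalar, so
  \<open>slope\<close> is invertible up to a scalar.
\<close>

lemma slope_image:
  assumes "(\<lambda>z. c * slope w z) \<doteq> tor y" "\<not> of_nat p dvd c"
  shows "\<exists>c u. \<not> of_nat p dvd c \<and> (\<lambda>z. c * w z) \<doteq> tor u"
proof -
  define nrm where "nrm z = (\<Sum>g\<in>carrier G. (\<tau> g * of_int (\<kappa> z g)) ^ p)" for z
  \<comment> \<open>the complementary factor that turns the invariant function \<open>nrm\<close> into the scalar \<open>C\<close>\<close>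
  define d where "d z = \<Prod>(nrm ` P - {nrm z})" for z
  define C where "C = \<Prod>(nrm ` P)"
  have fin: "finite (nrm ` P)"
    using finite_norms by (simp add: nrm_def[abs_def])
  have C: "\<not> of_nat p dvd C"
    unfolding C_def using fin norm_nonzero by (intro not_dvd_prod) (auto simp: nrm_def)
  have C_eq: "C = nrm z * d z" if "z \<in> P" for z
    unfolding C_def d_def using fin that by (intro prod.remove) auto
  have d_act: "d (act g z) = d z" if "g \<in> carrier G" for g z
    by (simp add: d_def nrm_def \<kappa>_act that)
  define y' where "y' = (slope ^^ (p - 1)) y"
  have p_pos: "p = Suc (p - 1)"
    using prime_gt_0_nat[OF prime_p] by simp
  have a: "(\<lambda>z. c * (slope ^^ p) w z) = (slope ^^ (p - 1)) (\<lambda>z. c * slope w z)"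
    using linop_scale[OF linop_funpow[OF linop_slope]]
    by (subst p_pos) (simp only: funpow_Suc_right o_apply)
  have b: "(slope ^^ (p - 1)) (tor y) = tor y'"
    unfolding y'_def by (rule funpow_commute) (simp only: tor_slope)
  have c: "(slope ^^ (p - 1)) (\<lambda>z. c * slope w z) \<doteq> (slope ^^ (p - 1)) (tor y)"
    using assms(1) by (rule funpow_cong[rotated]) (rule slope_cong)
  have 1: "of_nat p dvd c * (slope ^^ p) w z - tor y' z" if "z \<in> P" for z
    using c[rule_format, OF that] fun_cong[OF a, of z] fun_cong[OF b, of z] by (simp only:)
  have "(\<lambda>z. c * C * w z) \<doteq> tor (\<lambda>z. d z * y' z)"
  proof
    fix z assume z: "z \<in> P"
    have "of_nat p dvd (slope ^^ p) w z - nrm z * w z"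
      using gop_frobenius[OF invariant_slope, of w z] by (simp add: slope_def nrm_def)
    then have "of_nat p dvd d z * (c * (slope ^^ p) w z - tor y' z)
        - c * d z * ((slope ^^ p) w z - nrm z * w z)"
      using dvd_diff[OF dvd_mult[OF 1[OF z]] dvd_mult] by blast
    moreover have "tor (\<lambda>z. d z * y' z) z = d z * tor y' z"
      by (simp add: tor_def gop_def d_act sum_distrib_left algebra_simps)
    ultimately show "of_nat p dvd c * C * w z - tor (\<lambda>z. d z * y' z) z"
      by (simp add: C_eq[OF z] algebra_simps)
  qed
  moreover have "\<not> of_nat p dvd c * C"
    using C assms(2) prime_elem_p by (simp add: prime_elem_dvd_mult_iff)
  ultimately show ?thesis by blast
qed

text \<open>
  Write \<open>t, A, v\<close> for \<open>tor\<close>, \<open>mulcrd\<close>, \<open>slope\<close>.  If \<open>t\<close> to the power \<open>e + 1\<close> kills \<open>w\<close>, then the Weyl relation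
  shows that \<open>t\<close> to the power \<open>e\<close> kills \<open>t A w - (e + 1) v w\<close>.  By induction \<open>v w\<close> is in the image of \<open>t\<close>, and
  \<open>v\<close> and \<open>e + 1 < p\<close> can be cancelled.
\<close>

lemma kernel_in_image:
  assumes "(tor ^^ e) w \<doteq> (\<lambda>_. 0)" "e < p"
  shows "\<exists>c u. \<not> of_nat p dvd c \<and> (\<lambda>z. c * w z) \<doteq> tor u"
  using assms
proof (induction e arbitrary: w)
  case 0
  have "\<not> of_nat p dvd (1 :: 'd)"
    using prime_elem_p by (simp add: prime_elem_def)
  then show ?case
    using 0 tor_const[of 0] by (intro exI[of _ 1] exI[of _ "\<lambda>_. 0"]) simp
next
  case (Suc e)
  define w1 where "w1 = (\<lambda>z. tor (mulcrd w) z - of_nat (Suc e) * slope w z)"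
  have pow: "(tor ^^ e) w1 = (\<lambda>z. (tor ^^ Suc e) (mulcrd w) z - of_nat (Suc e) * slope ((tor ^^ e) w) z)"
  proof -
    have "(tor ^^ e) (slope w) = slope ((tor ^^ e) w)"
      by (rule funpow_commute) (rule tor_slope)
    then show ?thesis
      unfolding w1_def
      by (simp only: linop_diff[OF linop_funpow[OF linop_tor]] linop_scale[OF linop_funpow[OF linop_tor]]
          funpow_Suc_right o_apply)
  qed
  have "(tor ^^ e) w1 \<doteq> mulcrd ((tor ^^ Suc e) w)"
    unfolding pow using tor_power_mulcrd[of e w] by (simp add: algebra_simps)
  moreover have "mulcrd ((tor ^^ Suc e) w) \<doteq> (\<lambda>_. 0)"
    using Suc.prems(1) by (simp add: mulcrd_def del: funpow.simps)
  ultimately have "(tor ^^ e) w1 \<doteq> (\<lambda>_. 0)"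
    by (rule cong_trans)
  then obtain c u where c: "\<not> of_nat p dvd c" and u: "(\<lambda>z. c * w1 z) \<doteq> tor u"
    using Suc.IH Suc.prems(2) by (metis Suc_lessD)
  have "(\<lambda>z. c * of_nat (Suc e) * slope w z) \<doteq> tor (\<lambda>z. c * mulcrd w z - u z)"
  proof
    fix z assume "z \<in> P"
    then have "of_nat p dvd c * w1 z - tor u z" using u by blast
    then have "of_nat p dvd - (c * w1 z - tor u z)" by (simp only: dvd_minus_iff)
    then show "of_nat p dvd c * of_nat (Suc e) * slope w z - tor (\<lambda>z. c * mulcrd w z - u z) z"
      by (simp add: w1_def linop_diff[OF linop_tor] linop_scale[OF linop_tor] algebra_simps)
  qed
  moreover have "\<not> of_nat p dvd c * of_nat (Suc e)"
    using c not_dvd_of_nat[of "Suc e"] Suc.prems(2) prime_elem_p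
    by (simp add: prime_elem_dvd_mult_iff del: of_nat_Suc)
  ultimately show ?case by (rule slope_image)
qed

lemma kernel_in_image_power:
  assumes "(tor ^^ e) w \<doteq> (\<lambda>_. 0)" "e + j \<le> p"
  shows "\<exists>c u. \<not> of_nat p dvd c \<and> (\<lambda>z. c * w z) \<doteq> (tor ^^ j) u"
  using assms(2)
proof (induction j)
  case 0
  have "\<not> of_nat p dvd (1 :: 'd)"
    using prime_elem_p by (simp add: prime_elem_def)
  then show ?case by (intro exI[of _ 1] exI[of _ w]) simp
next
  case (Suc j)
  then obtain c u where c: "\<not> of_nat p dvd c" and u: "(\<lambda>z. c * w z) \<doteq> (tor ^^ j) u"
    by auto
  have "(tor ^^ e) ((tor ^^ j) u) \<doteq> (tor ^^ e) (\<lambda>z. c * w z)"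
    using cong_sym[OF u] by (rule funpow_cong[rotated]) (rule tor_cong)
  moreover have "(tor ^^ e) (\<lambda>z. c * w z) \<doteq> (\<lambda>_. 0)"
    using assms(1) by (simp add: linop_scale[OF linop_funpow[OF linop_tor]])
  ultimately have "(tor ^^ (e + j)) u \<doteq> (\<lambda>_. 0)"
    unfolding funpow_add o_apply by (rule cong_trans)
  then obtain c' u' where c': "\<not> of_nat p dvd c'" and u': "(\<lambda>z. c' * u z) \<doteq> tor u'"
    using kernel_in_image[of "e + j" u] Suc.prems by auto
  have 1: "(\<lambda>z. c' * (c * w z)) \<doteq> (\<lambda>z. c' * (tor ^^ j) u z)"
    using u by (simp add: right_diff_distrib[symmetric] dvd_mult)
  have "(tor ^^ j) (\<lambda>z. c' * u z) \<doteq> (tor ^^ j) (tor u')"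
    using u' by (rule funpow_cong[rotated]) (rule tor_cong)
  then have 2: "(\<lambda>z. c' * (tor ^^ j) u z) \<doteq> (tor ^^ Suc j) u'"
    by (simp only: linop_scale[OF linop_funpow[OF linop_tor]] funpow_Suc_right o_apply)
  have "(\<lambda>z. c' * c * w z) \<doteq> (tor ^^ Suc j) u'"
    using cong_trans[OF 1 2] by (simp add: mult.assoc)
  moreover have "\<not> of_nat p dvd c' * c"
    using c c' prime_elem_p by (simp add: prime_elem_dvd_mult_iff)
  ultimately show ?case by blast
qed

end

section \<open>Equivariant operators on cochains\<close>

lemma gop_cobdry:
  "gop S (\<lambda>g. map (a g)) (\<lambda>_. \<tau>) (cobdry w) = cobdry (gop S (\<lambda>g. map (a g)) (\<lambda>_. \<tau>) w)"
proof
  fix s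
  have "gop S (\<lambda>g. map (a g)) (\<lambda>_. \<tau>) (cobdry w) s = (\<Sum>g\<in>S. \<tau> g * cobdry (\<lambda>s. w (map (a g) s)) s)"
    by (simp add: gop_def cobdry_map)
  also have "\<dots> = cobdry (gop S (\<lambda>g. map (a g)) (\<lambda>_. \<tau>) w) s"
    unfolding gop_def by (simp only: cobdry_sum cobdry_scale)
  finally show "gop S (\<lambda>g. map (a g)) (\<lambda>_. \<tau>) (cobdry w) s
      = cobdry (gop S (\<lambda>g. map (a g)) (\<lambda>_. \<tau>) w) s" .
qed

lemma pull_gop:
  assumes fin: "finite S" and \<beta>: "\<And>g s. g \<in> S \<Longrightarrow> s \<noteq> [] \<Longrightarrow> \<beta> (map (a g) s) = b g (\<beta> s)"
  shows "pull \<beta> (gop S (\<lambda>g. map (b g)) (\<lambda>_. \<tau>) w) = gop S (\<lambda>g. map (a g)) (\<lambda>_. \<tau>) (pull \<beta> w)"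
proof
  fix s
  have "pull \<beta> (gop S (\<lambda>g. map (b g)) (\<lambda>_. \<tau>) w) s
      = (\<Sum>g\<in>S. \<tau> g * pull \<beta> (\<lambda>s. w (map (b g) s)) s)"
    unfolding gop_def by (rule pull_sum_scale)
  also have "\<dots> = (\<Sum>g\<in>S. \<tau> g * pull \<beta> w (map (a g) s))"
    using pull_map[of \<beta> "a g" "b g" w s for g] \<beta> by (intro sum.cong refl) metis
  finally show "pull \<beta> (gop S (\<lambda>g. map (b g)) (\<lambda>_. \<tau>) w) s
      = gop S (\<lambda>g. map (a g)) (\<lambda>_. \<tau>) (pull \<beta> w) s"
    by (simp add: gop_def)
qed

text \<open>
  The exponents in the periodic resolution over the truncated polynomial ring of height \<open>p\<close>: two
  consecutive ones add up to \<open>p\<close>, so the kernel of one power is the image of the next.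
\<close>

definition alt_exp :: "nat \<Rightarrow> nat \<Rightarrow> nat" where
  "alt_exp p i = (if even i then p - 1 else 1)"

locale list_torus = elementary_abelian +
  fixes act :: "'a \<Rightarrow> 'v \<Rightarrow> 'v" and \<tau> :: "'a \<Rightarrow> 'r::comm_ring_1"
  assumes act_one': "act \<one> z = z"
    and act_mult': "g \<in> carrier G \<Longrightarrow> h \<in> carrier G \<Longrightarrow> act (g \<otimes> h) z = act g (act h z)"
    and sum_\<tau>': "(\<Sum>g\<in>carrier G. \<tau> g) = 0"
begin

sublocale torus_operator G p "\<lambda>g. map (act g)" \<tau>
proof unfold_locales
  show "map (act \<one>) z = z" for z
    using act_one' by (simp add: map_idI)
qed (use sum_\<tau>' act_mult' in auto)

lemma alt_exp_sum: "alt_exp p i + alt_exp p (Suc i) = p"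
  using prime_gt_0_nat[OF prime_p] by (simp add: alt_exp_def)

lemma tor_cobdry: "(tor ^^ k) (cobdry w) = cobdry ((tor ^^ k) w)"
  by (rule funpow_commute) (simp add: tor_def gop_cobdry)

lemma tor_Nil: "tor w [] = 0"
  by (simp add: tor_def gop_def sum_distrib_right[symmetric] sum_\<tau>)

lemma tor_diff: "(tor ^^ k) (\<lambda>z. u z - w z) = (\<lambda>z. (tor ^^ k) u z - (tor ^^ k) w z)"
  by (rule linop_diff[OF linop_funpow[OF linop_tor]])

lemma tor_add: "(tor ^^ k) (\<lambda>z. u z + w z) = (\<lambda>z. (tor ^^ k) u z + (tor ^^ k) w z)"
  by (rule linop_add[OF linop_funpow[OF linop_tor]])

lemma tor_scale: "(tor ^^ k) (\<lambda>z. c * w z) = (\<lambda>z. c * (tor ^^ k) w z)"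
  by (rule linop_scale[OF linop_funpow[OF linop_tor]])

lemma tor_eq_on:
  assumes "\<And>z g. z \<in> P \<Longrightarrow> g \<in> carrier G \<Longrightarrow> map (act g) z \<in> P"
    and "\<And>z. z \<in> P \<Longrightarrow> u z = w z" and "z \<in> P"
  shows "(tor ^^ k) u z = (tor ^^ k) w z"
  using tor_dvd[of P 0 "\<lambda>z. u z - w z" z k] assms by (simp add: tor_diff)

section \<open>The test functionals\<close>

text \<open>
  Integration over chains \<open>x\<^sub>i\<close> on an iterated join: \<open>x\<^sub>0\<close> is the point \<open>v 0\<close>, and up to sign the next chain is
  the cone with apex \<open>v (Suc i)\<close> over the transform of \<open>x\<^sub>i\<close> by the power \<open>alt_exp p i\<close> of the operator.
\<close>

primrec tst :: "(nat \<Rightarrow> 'v) \<Rightarrow> nat \<Rightarrow> ('v list \<Rightarrow> 'r) \<Rightarrow> 'r" where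
  "tst v 0 u = u [v 0]"
| "tst v (Suc i) u = (-1)^Suc i * tst v i ((tor ^^ alt_exp p i) (\<lambda>s. u (s @ [v (Suc i)])))"

definition orbit_lists :: "(nat \<Rightarrow> 'v) \<Rightarrow> nat \<Rightarrow> 'v list set" where
  "orbit_lists v i = {s. length s = Suc i \<and> (\<forall>k\<le>i. \<exists>g\<in>carrier G. s ! k = act g (v k))}"

lemma orbit_lists_act:
  assumes "s \<in> orbit_lists v i" "g \<in> carrier G"
  shows "map (act g) s \<in> orbit_lists v i"
proof -
  have "\<exists>h\<in>carrier G. act g (s ! k) = act h (v k)" if "k \<le> i" for k
  proof -
    obtain h where "h \<in> carrier G" "s ! k = act h (v k)"
      using assms(1) \<open>k \<le> i\<close> by (auto simp: orbit_lists_def)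
    then show ?thesis
      using assms(2) by (intro bexI[of _ "g \<otimes> h"]) (simp_all add: act_mult')
  qed
  then show ?thesis
    using assms(1) by (simp add: orbit_lists_def)
qed

lemma orbit_lists_snoc:
  assumes "s \<in> orbit_lists v i"
  shows "s @ [v (Suc i)] \<in> orbit_lists v (Suc i)"
  using assms act_one'[symmetric] by (fastforce simp: orbit_lists_def nth_append le_Suc_eq)

lemma tst_dvd:
  assumes "\<And>s. s \<in> orbit_lists v i \<Longrightarrow> d dvd u s"
  shows "d dvd tst v i u"
  using assms
proof (induction i arbitrary: u)
  case 0
  have "[v 0] \<in> orbit_lists v 0"
    using act_one'[symmetric] by (fastforce simp: orbit_lists_def)
  then show ?case using 0 by simp
next
  case (Suc i)
  have "d dvd tst v i ((tor ^^ alt_exp p i) (\<lambda>s. u (s @ [v (Suc i)])))"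
    using Suc.prems orbit_lists_snoc
    by (intro Suc.IH tor_dvd[of "orbit_lists v i"]) (auto intro: orbit_lists_act)
  then show ?case by simp
qed

lemma tst_add: "tst v i (\<lambda>s. u s + w s) = tst v i u + tst v i w"
  by (induction i arbitrary: u w) (simp_all add: tor_add algebra_simps)

lemma tst_scale: "tst v i (\<lambda>s. c * w s) = c * tst v i w"
  by (induction i arbitrary: w) (simp_all add: tor_scale)

lemma tst_diff: "tst v i (\<lambda>s. u s - w s) = tst v i u - tst v i w"
  using tst_add[of v i u "\<lambda>s. -1 * w s"] by (simp only: tst_scale) simp

text \<open>
  The boundary of a cone consists of its base and of the cone over the boundary of the base.  The base
  is a cycle modulo \<open>p\<close>: its boundary carries two consecutive powers of the operator, that is, its \<open>p\<close>-th
  power.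
\<close>

lemma tst_cobdry: "of_nat p dvd tst v (Suc i) (cobdry u) - tst v i ((tor ^^ alt_exp p i) u)"
proof (induction i arbitrary: u rule: less_induct)
  case (less i)
  let ?v = "v (Suc i)" and ?e = "alt_exp p i"
  have e: "?e > 0"
    using prime_gt_1_nat[OF prime_p] by (simp add: alt_exp_def)
  have cycle: "of_nat p dvd tst v i ((tor ^^ ?e) (cobdry y))" for y
  proof (cases i)
    case 0
    obtain n where n: "?e = Suc n"
      using e gr0_implies_Suc by blast
    have "tst v i ((tor ^^ ?e) (cobdry y)) = cobdry ((tor ^^ ?e) y) [v 0]"
      unfolding tor_cobdry by (simp only: 0 tst.simps)
    also have "\<dots> = (tor ^^ ?e) y []"
      by (simp add: cobdry_def del_def)
    also have "\<dots> = 0"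
      unfolding n by (simp add: tor_Nil)
    finally show ?thesis by simp
  next
    case (Suc j)
    have 1: "of_nat p dvd tst v (Suc j) (cobdry ((tor ^^ ?e) y)) - tst v j ((tor ^^ alt_exp p j) ((tor ^^ ?e) y))"
      using less Suc by simp
    have 2: "of_nat p dvd tst v j ((tor ^^ alt_exp p j) ((tor ^^ ?e) y))"
    proof (rule tst_dvd)
      fix s
      have "(tor ^^ alt_exp p j) ((tor ^^ ?e) y) = (tor ^^ (alt_exp p j + ?e)) y"
        by (simp only: funpow_add o_apply)
      also have "alt_exp p j + ?e = p"
        unfolding Suc by (rule alt_exp_sum)
      finally have "(tor ^^ alt_exp p j) ((tor ^^ ?e) y) = (tor ^^ p) y" .
      then show "of_nat p dvd (tor ^^ alt_exp p j) ((tor ^^ ?e) y) s"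
        by (simp add: tor_power_p)
    qed
    from dvd_add[OF 1 2] have "of_nat p dvd tst v (Suc j) (cobdry ((tor ^^ ?e) y))"
      by (simp only: diff_add_cancel)
    then show ?thesis
      by (simp only: Suc tor_cobdry)
  qed
  let ?w = "\<lambda>s. u (s @ [?v])"
  define sg :: 'r where "sg = (-1)^Suc i"
  have sg: "sg * sg = 1"
    by (simp add: sg_def power_mult_distrib[symmetric])
  have "tst v i ((tor ^^ ?e) (\<lambda>s. cobdry u (s @ [?v])))
      = tst v i (\<lambda>s. (tor ^^ ?e) (cobdry ?w) s + sg * (tor ^^ ?e) u s)"
  proof -
    have "(tor ^^ ?e) (\<lambda>s. cobdry u (s @ [?v])) s = (tor ^^ ?e) (\<lambda>s. cobdry ?w s + sg * u s) s"
      if "s \<in> orbit_lists v i" for s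
      by (rule tor_eq_on[of "{s. length s = Suc i}"])
         (use that in \<open>auto simp: cobdry_snoc orbit_lists_def sg_def\<close>)
    then have "0 dvd tst v i (\<lambda>s. (tor ^^ ?e) (\<lambda>s. cobdry u (s @ [?v])) s
         - ((tor ^^ ?e) (cobdry ?w) s + sg * (tor ^^ ?e) u s))"
      by (intro tst_dvd) (simp add: tor_add tor_scale)
    then show ?thesis by (simp only: tst_diff) simp
  qed
  also have "\<dots> = tst v i ((tor ^^ ?e) (cobdry ?w)) + sg * tst v i ((tor ^^ ?e) u)"
    by (simp add: tst_add tst_scale)
  finally have "tst v (Suc i) (cobdry u)
      = sg * (tst v i ((tor ^^ ?e) (cobdry ?w)) + sg * tst v i ((tor ^^ ?e) u))"
    by (simp only: tst.simps sg_def)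
  also have "\<dots> = sg * tst v i ((tor ^^ ?e) (cobdry ?w)) + sg * sg * tst v i ((tor ^^ ?e) u)"
    by (simp only: distrib_left mult.assoc)
  finally have "tst v (Suc i) (cobdry u) - tst v i ((tor ^^ ?e) u)
      = sg * tst v i ((tor ^^ ?e) (cobdry ?w))"
    by (simp add: sg)
  then show ?case using cycle[of ?w] by simp
qed

end

section \<open>No test functional on few ranks\<close>

text \<open>
  The vertices of the complex in which the argument takes place.  A simplex has at most one label of each
  rank, so \<open>M\<close> ranks bound its dimension by \<open>M - 1\<close>; the coordinate and the character of the label of
  largest rank serve for the whole simplex.
\<close>

locale labels = list_torus G p act \<tau>
  for G :: "('a, 'b) monoid_scheme" (structure) and p and act :: "'a \<Rightarrow> 'l \<Rightarrow> 'l" and \<tau> :: "'a \<Rightarrow> 'r::comm_ring_1" +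
  fixes L :: "'l set" and rank :: "'l \<Rightarrow> nat" and crd :: "'l \<Rightarrow> int" and \<kappa> :: "'l \<Rightarrow> 'a \<Rightarrow> int" and M :: nat
  assumes finite_L: "finite L"
    and L_act: "g \<in> carrier G \<Longrightarrow> act g l \<in> L \<longleftrightarrow> l \<in> L"
    and rank_act: "g \<in> carrier G \<Longrightarrow> rank (act g l) = rank l"
    and rank_less: "l \<in> L \<Longrightarrow> rank l < M"
    and crd_L: "l \<in> L \<Longrightarrow> g \<in> carrier G \<Longrightarrow> int p dvd crd (act g l) - (crd l + \<kappa> l g)"
    and \<kappa>_L: "g \<in> carrier G \<Longrightarrow> \<kappa> (act g l) = \<kappa> l"
    and prime_elem_r: "prime_elem (of_nat p :: 'r)"
    and norm_L: "l \<in> L \<Longrightarrow> \<not> of_nat p dvd (\<Sum>g\<in>carrier G. (\<tau> g * of_int (\<kappa> l g)) ^ p)"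
begin

text \<open>
  Nondegenerate simplices, ordered by decreasing rank.
\<close>

definition strict :: "nat \<Rightarrow> 'l list set" where
  "strict n = {s. length s = n \<and> set s \<subseteq> L \<and> sorted_wrt (\<lambda>x y. rank y < rank x) s}"

text \<open>
  Simplices in which vertices may be repeated, still in the order of decreasing rank.
\<close>

definition weak :: "nat \<Rightarrow> 'l list set" where
  "weak n = {s. length s = n \<and> set s \<subseteq> L \<and> sorted_wrt (\<lambda>x y. x = y \<or> rank y < rank x) s}"

lemma strict_act: "g \<in> carrier G \<Longrightarrow> map (act g) s \<in> strict n \<longleftrightarrow> s \<in> strict n"
  by (auto simp: strict_def sorted_wrt_map rank_act image_subset_iff L_act subset_iff)

lemma strict_del: "s \<in> strict (Suc n) \<Longrightarrow> k < length s \<Longrightarrow> del k s \<in> strict n"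
  using set_del[of k s] by (auto simp: strict_def length_del sorted_wrt_del)

lemma strict_hd: "s \<in> strict (Suc n) \<Longrightarrow> s \<noteq> [] \<and> hd s \<in> L"
  by (cases s) (auto simp: strict_def)

lemma strict_empty: "n > M \<Longrightarrow> strict n = {}"
proof -
  assume "n > M"
  have "length s \<le> M" if s: "set s \<subseteq> L" "sorted_wrt (\<lambda>x y. rank y < rank x) s" for s
  proof -
    have "distinct (map rank s)"
      using s(2) by (induction s) auto
    then have "length s = card (rank ` set s)"
      by (metis distinct_card length_map set_map)
    also have "\<dots> \<le> card {..<M}"
      using s(1) rank_less by (intro card_mono) auto
    finally show ?thesis by simp
  qed
  with \<open>n > M\<close> show ?thesis by (fastforce simp: strict_def)
qed

lemma weak_not_strict:
  assumes "sorted_wrt (\<lambda>x y. x = y \<or> rank y < rank x) s" "\<not> sorted_wrt (\<lambda>x y. rank y < rank x) s"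
  shows "\<exists>as b bs. s = as @ [b, b] @ bs"
  using assms
proof (induction s)
  case (Cons x s)
  show ?case
  proof (cases "sorted_wrt (\<lambda>x y. rank y < rank x) s")
    case True
    then obtain y where y: "y \<in> set s" "y = x"
      using Cons.prems by auto
    then obtain z s' where s: "s = z # s'" by (cases s) auto
    have "z = x"
    proof (rule ccontr)
      assume "z \<noteq> x"
      then have "rank z < rank x" "x \<in> set s'" using Cons.prems(1) y s by auto
      then show False using True s by auto
    qed
    then show ?thesis using s by (intro exI[of _ "[]"]) auto
  next
    case False
    then obtain as b bs where "s = as @ [b, b] @ bs"
      using Cons by auto
    then show ?thesis by (metis append_Cons)
  qed
qed simp

text \<open>
  One step of a construction of cochains \<open>w\<^sub>i\<close> with \<open>cobdry w\<^sub>i = t\<^sup>b w\<^sub>i\<^sub>+\<^sub>1\<close> up to scalars and modulo \<open>p\<close>.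
  The coboundary of \<open>w\<close> is killed by a power of the operator, hence divisible by the complementary power.
  The quotient may be restricted to nondegenerate simplices, since the coboundary of a normalized cochain
  vanishes on degenerate ones, and it satisfies the hypothesis of the next step because the square of the
  coboundary is zero.
\<close>

lemma divide_coboundary:
  assumes w: "\<And>s n. s \<notin> strict n \<Longrightarrow> length s = n \<Longrightarrow> w s = 0"
    and kernel: "\<And>s. s \<in> strict (Suc n) \<Longrightarrow> of_nat p dvd (tor ^^ a) (cobdry w) s"
    and ab: "a + b \<le> p"
  shows "\<exists>c u. \<not> of_nat p dvd c
    \<and> (\<forall>s n. s \<notin> strict n \<longrightarrow> length s = n \<longrightarrow> u s = 0)
    \<and> (\<forall>s\<in>weak (Suc n). of_nat p dvd c * cobdry w s - (tor ^^ b) u s)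
    \<and> (\<forall>s\<in>strict (Suc (Suc n)). of_nat p dvd (tor ^^ b) (cobdry u) s)"
proof -
  let ?P = "strict (Suc n)"
  interpret torus_coordinate G p "\<lambda>g. map (act g)" \<tau> ?P "\<lambda>s. crd (hd s)" "\<lambda>s. \<kappa> (hd s)"
  proof
    fix s g assume s: "s \<in> ?P" and g: "g \<in> carrier G"
    then show "map (act g) s \<in> ?P" by (simp add: strict_act)
    have "hd s \<in> L" "s \<noteq> []" using strict_hd[OF s] by auto
    then show "int p dvd crd (hd (map (act g) s)) - (crd (hd s) + \<kappa> (hd s) g)"
      using crd_L[OF _ g] by (simp add: hd_map)
  next
    fix s g assume "g \<in> carrier G"
    then show "\<kappa> (hd (map (act g) s)) = \<kappa> (hd s)" by (cases s) (simp_all add: \<kappa>_L)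
  next
    show "prime_elem (of_nat p :: 'r)" by (rule prime_elem_r)
  next
    have "hd ` ?P \<subseteq> L" using strict_hd by auto
    then have "finite (hd ` ?P)" using finite_L finite_subset by blast
    then have "finite ((\<lambda>l. \<Sum>g\<in>carrier G. (\<tau> g * of_int (\<kappa> l g)) ^ p) ` hd ` ?P)"
      by (rule finite_imageI)
    then show "finite ((\<lambda>s. \<Sum>g\<in>carrier G. (\<tau> g * of_int (\<kappa> (hd s) g)) ^ p) ` ?P)"
      by (simp add: image_image)
  next
    fix s assume "s \<in> ?P"
    then have "hd s \<in> L" using strict_hd by auto
    then show "\<not> of_nat p dvd (\<Sum>g\<in>carrier G. (\<tau> g * of_int (\<kappa> (hd s) g)) ^ p)"
      by (rule norm_L)
  qed
  obtain c y where c: "\<not> of_nat p dvd c" and y: "\<forall>s\<in>?P. of_nat p dvd c * cobdry w s - (tor ^^ b) y s"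
    using kernel_in_image_power[of a "cobdry w" b] kernel ab by auto
  define u where "u s = (if s \<in> ?P then y s else 0)" for s
  have u0: "u s = 0" if "s \<notin> strict n" "length s = n" for s n
    using that by (auto simp: u_def strict_def)
  have on_P: "(tor ^^ b) u s = (tor ^^ b) y s" if "s \<in> ?P" for s
    by (rule tor_eq_on[of ?P]) (use that in \<open>auto simp: strict_act u_def\<close>)
  have off_P: "(tor ^^ b) u s = 0" if "s \<notin> ?P" for s
    using tor_dvd[of "- ?P" 0 u s b] that by (auto simp: strict_act u_def)
  have cong: "of_nat p dvd c * cobdry w s - (tor ^^ b) u s" if s: "s \<in> weak (Suc n)" for s
  proof (cases "s \<in> ?P")
    case True
    then show ?thesis using y on_P by simp
  next
    case False
    then obtain as x bs where s_eq: "s = as @ [x, x] @ bs"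
      using s weak_not_strict[of s] by (auto simp: strict_def weak_def)
    have "cobdry w s = 0"
      unfolding s_eq by (rule cobdry_repeated) (rule w[OF _ refl], simp add: strict_def sorted_wrt_append)
    then show ?thesis using off_P[OF False] by simp
  qed
  have "of_nat p dvd (tor ^^ b) (cobdry u) s" if s: "s \<in> strict (Suc (Suc n))" for s
  proof -
    have "of_nat p dvd cobdry (\<lambda>s. c * cobdry w s - (tor ^^ b) u s) s"
      unfolding cobdry_def[of "\<lambda>s. c * cobdry w s - (tor ^^ b) u s"]
      using y on_P strict_del[OF s] by (intro dvd_sum dvd_mult) simp
    then show ?thesis
      by (simp add: cobdry_diff cobdry_scale cobdry_cobdry tor_cobdry)
  qed
  then show ?thesis using c u0 cong by blast
qed

text \<open>
  The construction of the \<open>w\<^sub>i\<close> starts from the constant 1, which the operator kills.  The functionals \<open>\<Psi>\<close>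
  transport the value 1 of \<open>\<Psi> 0\<close> along this sequence, up to factors prime to \<open>p\<close>.  There is no
  nondegenerate simplex with \<open>M + 1\<close> vertices, so the value transported to degree \<open>M\<close> is zero.
\<close>

theorem no_test_functional:
  assumes one: "\<Psi> 0 (\<lambda>_. 1) = (1 :: 'r)"
    and scale: "\<And>i c w. \<Psi> i (\<lambda>s. c * w s) = c * \<Psi> i w"
    and cong: "\<And>i u w. i \<le> M \<Longrightarrow> (\<And>s. s \<in> weak (Suc i) \<Longrightarrow> of_nat p dvd u s - w s)
                \<Longrightarrow> of_nat p dvd \<Psi> i u - \<Psi> i w"
    and bdry: "\<And>i w. i < M \<Longrightarrow> of_nat p dvd \<Psi> (Suc i) (cobdry w) - \<Psi> i ((tor ^^ alt_exp p i) w)"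
  shows False
proof -
  have p1: "p > 1" using prime_gt_1_nat[OF prime_p] .
  have ex: "\<exists>w C. \<not> of_nat p dvd C \<and> of_nat p dvd C - \<Psi> i ((tor ^^ alt_exp p i) w)
      \<and> (\<forall>s n. s \<notin> strict n \<longrightarrow> length s = n \<longrightarrow> w s = 0)
      \<and> (\<forall>s\<in>strict (Suc (Suc i)). of_nat p dvd (tor ^^ alt_exp p i) (cobdry w) s)" if "i \<le> M" for i
    using that
  proof (induction i)
    case 0
    \<comment> \<open>the augmentation: its coboundary is the constant 1 on vertices\<close>
    define w0 where "w0 s = (if s = [] then 1 else 0 :: 'r)" for s :: "'l list"
    have w0: "cobdry w0 s = 1" if "length s = 1" for s
      using that by (auto simp: w0_def cobdry_def length_Suc_conv del_def)
    have tor_w0: "tor (cobdry w0) s = 0" if "length s = 1" for s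
    proof -
      have "(tor ^^ 1) (cobdry w0) s = (tor ^^ 1) (\<lambda>_. 1) s"
        by (rule tor_eq_on[of "{s. length s = 1}"]) (use that w0 in auto)
      then show ?thesis by (simp add: tor_const)
    qed
    have "\<exists>c u. \<not> of_nat p dvd c
      \<and> (\<forall>s n. s \<notin> strict n \<longrightarrow> length s = n \<longrightarrow> u s = 0)
      \<and> (\<forall>s\<in>weak (Suc 0). of_nat p dvd c * cobdry w0 s - (tor ^^ (p - 1)) u s)
      \<and> (\<forall>s\<in>strict (Suc (Suc 0)). of_nat p dvd (tor ^^ (p - 1)) (cobdry u) s)"
    proof (rule divide_coboundary[where a = 1])
      show "w0 s = 0" if "s \<notin> strict n" "length s = n" for s n
        using that by (auto simp: w0_def strict_def)
      show "of_nat p dvd (tor ^^ 1) (cobdry w0) s" if "s \<in> strict (Suc 0)" for s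
        using that tor_w0 by (simp add: strict_def)
    qed (use p1 in simp)
    then obtain c u where c: "\<not> of_nat p dvd c"
      and u: "\<forall>s n. s \<notin> strict n \<longrightarrow> length s = n \<longrightarrow> u s = 0"
        "\<forall>s\<in>weak (Suc 0). of_nat p dvd c * cobdry w0 s - (tor ^^ (p - 1)) u s"
        "\<forall>s\<in>strict (Suc (Suc 0)). of_nat p dvd (tor ^^ (p - 1)) (cobdry u) s" by blast
    have "of_nat p dvd \<Psi> 0 (\<lambda>s. c * (\<lambda>_. 1) s) - \<Psi> 0 ((tor ^^ (p - 1)) u)"
      using u(2) w0 by (intro cong) (auto simp: weak_def)
    then have "of_nat p dvd c - \<Psi> 0 ((tor ^^ alt_exp p 0) u)"
      unfolding scale one by (simp add: alt_exp_def)
    then show ?case using c u by (intro exI[of _ u] exI[of _ c]) (simp add: alt_exp_def)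
  next
    case (Suc i)
    let ?a = "alt_exp p i" and ?b = "alt_exp p (Suc i)"
    obtain w C where C: "\<not> of_nat p dvd C" "of_nat p dvd C - \<Psi> i ((tor ^^ ?a) w)"
      and w: "\<And>s n. s \<notin> strict n \<Longrightarrow> length s = n \<Longrightarrow> w s = 0"
        "\<And>s. s \<in> strict (Suc (Suc i)) \<Longrightarrow> of_nat p dvd (tor ^^ ?a) (cobdry w) s"
      using Suc.IH Suc.prems by auto
    obtain c u where c: "\<not> of_nat p dvd c"
      and u: "\<forall>s n. s \<notin> strict n \<longrightarrow> length s = n \<longrightarrow> u s = 0"
        "\<forall>s\<in>weak (Suc (Suc i)). of_nat p dvd c * cobdry w s - (tor ^^ ?b) u s"
        "\<forall>s\<in>strict (Suc (Suc (Suc i))). of_nat p dvd (tor ^^ ?b) (cobdry u) s"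
      using divide_coboundary[where w = w and n = "Suc i" and a = ?a and b = ?b] w alt_exp_sum[of i]
      by auto
    have 1: "of_nat p dvd c * (C - \<Psi> i ((tor ^^ ?a) w))"
      using C(2) by (rule dvd_mult)
    have 2: "of_nat p dvd c * (\<Psi> (Suc i) (cobdry w) - \<Psi> i ((tor ^^ ?a) w))"
      using bdry[of i w] Suc.prems by (intro dvd_mult) simp
    have 3: "of_nat p dvd \<Psi> (Suc i) (\<lambda>s. c * cobdry w s) - \<Psi> (Suc i) ((tor ^^ ?b) u)"
      by (rule cong) (use Suc.prems u in auto)
    have "of_nat p dvd c * (C - \<Psi> i ((tor ^^ ?a) w)) - c * (\<Psi> (Suc i) (cobdry w) - \<Psi> i ((tor ^^ ?a) w))
        + (\<Psi> (Suc i) (\<lambda>s. c * cobdry w s) - \<Psi> (Suc i) ((tor ^^ ?b) u))"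
      using dvd_add[OF dvd_diff[OF 1 2] 3] .
    then have "of_nat p dvd c * C - \<Psi> (Suc i) ((tor ^^ ?b) u)"
      unfolding scale by (simp add: algebra_simps)
    moreover have "\<not> of_nat p dvd c * C"
      using c C(1) prime_elem_r by (simp add: prime_elem_dvd_mult_iff)
    ultimately show ?case using u by blast
  qed
  obtain w C where C: "\<not> of_nat p dvd C" "of_nat p dvd C - \<Psi> M ((tor ^^ alt_exp p M) w)"
    and w: "\<forall>s n. s \<notin> strict n \<longrightarrow> length s = n \<longrightarrow> w s = 0"
    using ex[of M] by blast
  have "(tor ^^ alt_exp p M) w s = 0" if "s \<in> weak (Suc M)" for s
  proof -
    have "(tor ^^ alt_exp p M) w s = (tor ^^ alt_exp p M) (\<lambda>_. 0) s"
      by (rule tor_eq_on[of "{s. length s = Suc M}"])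
         (use w strict_empty[of "Suc M"] that in \<open>auto simp: weak_def\<close>)
    also have "\<dots> = 0" using tor_scale[of "alt_exp p M" 0 "\<lambda>_. 0"] by simp
    finally show ?thesis .
  qed
  then have "of_nat p dvd \<Psi> M ((tor ^^ alt_exp p M) w) - \<Psi> M (\<lambda>s. 0 * (\<lambda>_. 0) s)"
    by (intro cong) auto
  then have "of_nat p dvd \<Psi> M ((tor ^^ alt_exp p M) w)"
    unfolding scale by simp
  then show False using C dvd_add[OF C(2)] by fastforce
qed

end

section \<open>Elementary abelian groups\<close>

lemma elementary_abelian_if_iso:
  fixes G :: "('a, 'b) monoid_scheme"
  assumes p: "prime p" and "group G" "finite (carrier G)"
    and iso: "G \<cong> product_group {1..n} (\<lambda>_. integer_mod_group p)"
  shows "elementary_abelian G p"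
proof -
  interpret group G by fact
  obtain f where f: "f \<in> iso G (product_group {1..n} (\<lambda>_. integer_mod_group p))"
    using iso by (auto simp: is_iso_def)
  then have hom: "f (x \<otimes>\<^bsub>G\<^esub> y) = (\<lambda>i\<in>{1..n}. (f x i + f y i) mod int p)"
    if "x \<in> carrier G" "y \<in> carrier G" for x y
    using that by (simp add: iso_def hom_def)
  have inj: "inj_on f (carrier G)" and img: "f ` carrier G = (\<Pi>\<^sub>E i\<in>{1..n}. carrier (integer_mod_group p))"
    using f by (auto simp: iso_def bij_betw_def)
  have ext: "f x \<in> extensional {1..n}" if "x \<in> carrier G" for x
    using img that by (force simp: PiE_def)
  show ?thesis
  proof unfold_locales
    show "x \<otimes>\<^bsub>G\<^esub> y = y \<otimes>\<^bsub>G\<^esub> x" if "x \<in> carrier G" "y \<in> carrier G" for x y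
      using that by (intro inj_onD[OF inj]) (simp_all add: hom add.commute)
    show "prime p" "finite (carrier G)" by fact+
    fix x assume x: "x \<in> carrier G"
    have pw: "f (x [^]\<^bsub>G\<^esub> Suc k) = (\<lambda>i\<in>{1..n}. (int (Suc k) * f x i) mod int p)" for k
    proof (induction k)
      case 0
      have "f x \<in> (\<Pi>\<^sub>E i\<in>{1..n}. carrier (integer_mod_group p))"
        using img x by blast
      moreover have "p > 0" using p prime_gt_0_nat by blast
      ultimately have "f x i mod int p = f x i" if "i \<in> {1..n}" for i
        using that by (auto simp: carrier_integer_mod_group PiE_iff)
      then show ?case
        using x by (intro extensionalityI[where A = "{1..n}"] ext restrict_extensional) simp_all
    next
      case (Suc k)
      have "f (x [^]\<^bsub>G\<^esub> Suc (Suc k)) = f (x [^]\<^bsub>G\<^esub> Suc k \<otimes>\<^bsub>G\<^esub> x)" by simp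
      also have "\<dots> = (\<lambda>i\<in>{1..n}. (int (Suc (Suc k)) * f x i) mod int p)"
      proof -
        have "f (x [^]\<^bsub>G\<^esub> Suc k \<otimes>\<^bsub>G\<^esub> x)
            = (\<lambda>i\<in>{1..n}. ((int (Suc k) * f x i) mod int p + f x i) mod int p)"
          unfolding hom[OF nat_pow_closed[OF x] x] Suc by (rule restrict_ext) simp
        also have "\<dots> = (\<lambda>i\<in>{1..n}. (int (Suc (Suc k)) * f x i) mod int p)"
        proof (rule restrict_ext)
          fix i
          have "(int (Suc k) * f x i mod int p + f x i) mod int p = (int (Suc k) * f x i + f x i) mod int p"
            by (rule mod_add_left_eq)
          also have "int (Suc k) * f x i + f x i = int (Suc (Suc k)) * f x i"
            by (simp add: algebra_simps)
          finally show "(int (Suc k) * f x i mod int p + f x i) mod int p = int (Suc (Suc k)) * f x i mod int p" .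
        qed
        finally show ?thesis .
      qed
      finally show ?case .
    qed
    obtain k where k: "p = Suc k" using p prime_gt_0_nat gr0_implies_Suc by blast
    have "f (x [^]\<^bsub>G\<^esub> p) = (\<lambda>i\<in>{1..n}. (int p * f x i) mod int p)"
      using pw[of k] by (simp only: k[symmetric])
    then have "f (x [^]\<^bsub>G\<^esub> p) = (\<lambda>i\<in>{1..n}. 0)"
      by simp
    moreover have "f \<one>\<^bsub>G\<^esub> i = 0" if "i \<in> {1..n}" for i
    proof -
      have "f \<one>\<^bsub>G\<^esub> i \<in> carrier (integer_mod_group p)"
        using img that by (force simp: PiE_iff)
      moreover have "f \<one>\<^bsub>G\<^esub> i = (f \<one>\<^bsub>G\<^esub> i + f \<one>\<^bsub>G\<^esub> i) mod int p"
        using fun_cong[OF hom[of "\<one>\<^bsub>G\<^esub>" "\<one>\<^bsub>G\<^esub>"], of i] that by simp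
      moreover have "p > 0" using p prime_gt_0_nat by blast
      ultimately have r: "0 \<le> f \<one>\<^bsub>G\<^esub> i" "f \<one>\<^bsub>G\<^esub> i < int p"
          "(f \<one>\<^bsub>G\<^esub> i + f \<one>\<^bsub>G\<^esub> i) mod int p = f \<one>\<^bsub>G\<^esub> i mod int p"
        by (simp_all add: carrier_integer_mod_group)
      from r(3)[unfolded mod_eq_dvd_iff] have "int p dvd f \<one>\<^bsub>G\<^esub> i"
        by simp
      then show ?thesis using r zdvd_not_zless by (metis order_le_less)
    qed
    moreover have "f \<one>\<^bsub>G\<^esub> \<in> extensional {1..n}" by (rule ext) simp
    ultimately have "f (x [^]\<^bsub>G\<^esub> p) = f \<one>\<^bsub>G\<^esub>"
      by (intro extensionalityI[where A = "{1..n}"] restrict_extensional) simp_all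
    then show "x [^]\<^bsub>G\<^esub> p = \<one>\<^bsub>G\<^esub>"
      using x by (intro inj_onD[OF inj]) simp_all
  qed
qed

lemma of_int_monom: "(of_int k :: int poly) = monom k 0"
  by (simp add: of_int_poly monom_0)

lemma monom_times_power: "(monom 1 i * of_int k :: int poly) ^ n = monom (k ^ n) (i * n)"
  unfolding of_int_monom mult_monom monom_power by simp

context elementary_abelian
begin

lemma int_pow_multiple:
  assumes "g \<in> carrier G" "int p dvd i"
  shows "g [^] (i :: int) = \<one>"
proof -
  obtain m where "i = int p * m" using assms(2) by blast
  then have "g [^] i = (g [^] int p) [^] m"
    using assms(1) by (simp add: int_pow_pow)
  then show ?thesis using assms(1) exponent by (simp add: int_pow_int)
qed

text \<open>
  A maximal proper subgroup \<open>K\<close> above \<open>H\<close> has the property that every element is a power of one fixed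
  \<open>t \<notin> K\<close> modulo \<open>K\<close>; the exponent is unique modulo \<open>p\<close> and defines the character.
\<close>

lemma exists_character:
  assumes H: "subgroup H G" "H \<noteq> carrier G"
  shows "\<exists>\<kappa>::'a \<Rightarrow> int.
    (\<forall>g\<in>carrier G. \<forall>h\<in>carrier G. int p dvd \<kappa> (g \<otimes> h) - (\<kappa> g + \<kappa> h)) \<and>
    (\<forall>h\<in>H. int p dvd \<kappa> h) \<and> (\<exists>g\<in>carrier G. \<not> int p dvd \<kappa> g)"
proof -
  let ?S = "{K. subgroup K G \<and> K \<noteq> carrier G}"
  have "?S \<subseteq> Pow (carrier G)" by (auto dest: subgroup.subset)
  then have "finite ?S" using finite_carrier by (meson finite_Pow_iff finite_subset)
  then obtain K where K: "subgroup K G" "K \<noteq> carrier G" "H \<subseteq> K"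
    and max: "\<And>K'. subgroup K' G \<Longrightarrow> K' \<noteq> carrier G \<Longrightarrow> K \<subseteq> K' \<Longrightarrow> K = K'"
    using finite_has_maximal2[of ?S H] H by auto
  interpret K: subgroup K G by fact
  obtain t where t: "t \<in> carrier G" "t \<notin> K"
    using K(1,2) subgroup.subset by blast
  have pow_K: "t [^] i \<in> K \<longleftrightarrow> int p dvd i" for i :: int
  proof
    assume "int p dvd i"
    then show "t [^] i \<in> K" using int_pow_multiple[OF t(1)] K.one_closed by simp
  next
    assume i: "t [^] i \<in> K"
    show "int p dvd i"
    proof (rule ccontr)
      assume "\<not> int p dvd i"
      then have "coprime i (int p)"
        using prime_p by (metis coprime_commute prime_imp_coprime prime_nat_int_transfer)
      then obtain a b where ab: "a * i + b * int p = 1"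
        using bezout_int[of i "int p"] by auto
      have "t = t [^] (i * a + int p * b)"
        using ab t(1) by (simp add: mult.commute)
      also have "\<dots> = (t [^] i) [^] a \<otimes> t [^] (int p * b)"
        using t(1) by (simp add: int_pow_mult int_pow_pow)
      also have "\<dots> = (t [^] i) [^] a"
        using t(1) int_pow_multiple[OF t(1), of "int p * b"] by simp
      also have "\<dots> \<in> K"
        using i K(1) by (simp add: subgroup_int_pow_closed)
      finally show False using t(2) by simp
    qed
  qed
  let ?T = "{g \<in> carrier G. \<exists>i::int. g \<otimes> t [^] i \<in> K}"
  have "subgroup ?T G"
  proof (rule subgroupI)
    show "?T \<noteq> {}"
      using K.one_closed by (auto intro!: exI[of _ \<one>] exI[of _ "0::int"])
    fix g assume "g \<in> ?T"
    then obtain i :: int where g: "g \<in> carrier G" "g \<otimes> t [^] i \<in> K" by blast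
    have "inv g \<otimes> t [^] (- i) = inv (g \<otimes> t [^] i)"
      using g(1) t(1) by (simp add: int_pow_neg inv_mult)
    then show "inv g \<in> ?T"
      using g K.m_inv_closed by (auto intro!: exI[of _ "- i"])
    fix h assume "h \<in> ?T"
    then obtain j :: int where h: "h \<in> carrier G" "h \<otimes> t [^] j \<in> K" by blast
    have "(g \<otimes> h) \<otimes> t [^] (i + j) = (g \<otimes> t [^] i) \<otimes> (h \<otimes> t [^] j)"
      using g(1) h(1) t(1) by (simp add: int_pow_mult m_ac)
    then show "g \<otimes> h \<in> ?T"
      using g h by (auto intro!: exI[of _ "i + j"])
  qed auto
  moreover have "K \<subseteq> ?T"
    using K.subset by (auto intro!: exI[of _ "0::int"])
  moreover have "t \<in> ?T"
    using t(1) K.one_closed by (auto intro!: exI[of _ "-1::int"] simp: int_pow_neg)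
  ultimately have T: "?T = carrier G"
    using max t(2) by blast
  define \<kappa> where "\<kappa> g = (SOME i::int. g \<otimes> t [^] i \<in> K)" for g
  have \<kappa>: "g \<otimes> t [^] \<kappa> g \<in> K" if "g \<in> carrier G" for g
  proof -
    have "\<exists>i::int. g \<otimes> t [^] i \<in> K" using T that by blast
    then show ?thesis unfolding \<kappa>_def by (rule someI_ex)
  qed
  show ?thesis
  proof (intro exI[of _ \<kappa>] conjI ballI)
    fix g h assume gh: "g \<in> carrier G" "h \<in> carrier G"
    let ?a = "(g \<otimes> h) \<otimes> t [^] \<kappa> (g \<otimes> h)" and ?b = "(g \<otimes> t [^] \<kappa> g) \<otimes> (h \<otimes> t [^] \<kappa> h)"
    have "?b = (g \<otimes> h) \<otimes> t [^] (\<kappa> g + \<kappa> h)"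
      using gh t(1) by (simp add: int_pow_mult m_ac)
    moreover have "inv ((g \<otimes> h) \<otimes> t [^] (\<kappa> g + \<kappa> h)) \<otimes> ?a = t [^] (\<kappa> (g \<otimes> h) - (\<kappa> g + \<kappa> h))"
    proof -
      have cancel: "inv (a \<otimes> b) \<otimes> (a \<otimes> c) = c \<otimes> inv b"
        if "a \<in> carrier G" "b \<in> carrier G" "c \<in> carrier G" for a b c
      proof -
        have "inv (a \<otimes> b) \<otimes> (a \<otimes> c) = inv b \<otimes> ((inv a \<otimes> a) \<otimes> c)"
          using that by (simp only: inv_mult_group m_assoc inv_closed m_closed)
        then show ?thesis using that by (simp add: m_comm)
      qed
      have "inv ((g \<otimes> h) \<otimes> t [^] (\<kappa> g + \<kappa> h)) \<otimes> ?a
         = t [^] (\<kappa> (g \<otimes> h)) \<otimes> inv (t [^] (\<kappa> g + \<kappa> h))"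
        using gh t(1) by (intro cancel) simp_all
      then show ?thesis using t(1) by (simp add: int_pow_diff)
    qed
    moreover have "?a \<in> K" "?b \<in> K" using \<kappa> gh by auto
    ultimately have "t [^] (\<kappa> (g \<otimes> h) - (\<kappa> g + \<kappa> h)) \<in> K"
      by (metis K.m_closed K.m_inv_closed)
    then show "int p dvd \<kappa> (g \<otimes> h) - (\<kappa> g + \<kappa> h)" by (simp only: pow_K)
  next
    fix h assume h: "h \<in> H"
    then have hK: "h \<in> K" "h \<in> carrier G" using K(3) K.subset by auto
    have "inv h \<otimes> (h \<otimes> t [^] \<kappa> h) \<in> K"
      by (rule K.m_closed[OF K.m_inv_closed[OF hK(1)] \<kappa>[OF hK(2)]])
    moreover have "inv h \<otimes> (h \<otimes> t [^] \<kappa> h) = t [^] \<kappa> h"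
      using hK t(1) by (simp add: m_assoc[symmetric])
    ultimately have "t [^] \<kappa> h \<in> K" by (simp only:)
    then show "int p dvd \<kappa> h" by (simp only: pow_K)
  next
    have "t \<otimes> t [^] \<kappa> t = t [^] (1 + \<kappa> t)"
      using t(1) by (simp add: int_pow_mult)
    then have "int p dvd 1 + \<kappa> t" using \<kappa>[OF t(1)] pow_K by simp
    moreover have "\<not> int p dvd 1" using prime_gt_1_nat[OF prime_p] by auto
    ultimately have "\<not> int p dvd \<kappa> t" by (metis dvd_add_left_iff)
    then show "\<exists>g\<in>carrier G. \<not> int p dvd \<kappa> g" using t(1) by blast
  qed
qed

definition idx :: "'a \<Rightarrow> nat" where
  "idx = (SOME f. inj_on f (carrier G))"

lemma inj_idx: "inj_on idx (carrier G)"
  unfolding idx_def using finite_imp_inj_to_nat_seg[OF finite_carrier]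
  by (metis (mono_tags) someI_ex)

text \<open>
  Distinct powers of the variable are linearly independent modulo \<open>p\<close>; the coefficient of the neutral
  element makes the sum zero.
\<close>

definition generic :: "'a \<Rightarrow> int poly" where
  "generic g = (if g = \<one> then - (\<Sum>h\<in>carrier G - {\<one>}. monom 1 (idx h)) else monom 1 (idx g))"

lemma sum_generic: "(\<Sum>g\<in>carrier G. generic g) = 0"
proof -
  have "(\<Sum>g\<in>carrier G. generic g) = generic \<one> + (\<Sum>g\<in>carrier G - {\<one>}. generic g)"
    using finite_carrier by (intro sum.remove) auto
  then show ?thesis by (simp add: generic_def)
qed

lemma prime_elem_p_poly: "prime_elem (of_nat p :: int poly)"
  using prime_p by (simp add: of_nat_poly prime_elem_const_poly_iff)

text \<open>
  The exponent \<open>idx g\<^sub>0 * p\<close> occurs in only one summand, with coefficient \<open>\<kappa> g\<^sub>0 ^ p\<close>, apart from the summand of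
  the neutral element, which is divisible by \<open>p\<close>.
\<close>

lemma norm_generic:
  assumes \<kappa>: "\<And>g h. g \<in> carrier G \<Longrightarrow> h \<in> carrier G \<Longrightarrow> int p dvd \<kappa> (g \<otimes> h) - (\<kappa> g + \<kappa> h)"
    and g0: "g0 \<in> carrier G" "\<not> int p dvd \<kappa> g0"
  shows "\<not> of_nat p dvd (\<Sum>g\<in>carrier G. (generic g * of_int (\<kappa> g)) ^ p)"
proof
  assume dvd: "of_nat p dvd (\<Sum>g\<in>carrier G. (generic g * of_int (\<kappa> g)) ^ p)"
  have p0: "p > 0" using prime_gt_0_nat[OF prime_p] .
  have "int p dvd \<kappa> \<one>" using \<kappa>[of \<one> \<one>] by simp
  then have "of_nat p dvd (of_int (\<kappa> \<one>) :: int poly)"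
    by (simp add: of_nat_poly of_int_poly)
  then have one: "of_nat p dvd (generic \<one> * of_int (\<kappa> \<one>)) ^ p"
    using p0 by (intro dvd_trans[OF dvd_mult dvd_power]) auto
  have "g0 \<noteq> \<one>" using g0 \<open>int p dvd \<kappa> \<one>\<close> by auto
  let ?R = "\<Sum>g\<in>carrier G - {\<one>}. monom (\<kappa> g ^ p) (idx g * p)"
  have monom: "(generic g * of_int (\<kappa> g)) ^ p = monom (\<kappa> g ^ p) (idx g * p)" if "g \<noteq> \<one>" for g
    unfolding generic_def if_not_P[OF that] by (rule monom_times_power)
  have "(\<Sum>g\<in>carrier G. (generic g * of_int (\<kappa> g)) ^ p)
      = (generic \<one> * of_int (\<kappa> \<one>)) ^ p + (\<Sum>g\<in>carrier G - {\<one>}. (generic g * of_int (\<kappa> g)) ^ p)"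
    using finite_carrier by (intro sum.remove) auto
  also have "(\<Sum>g\<in>carrier G - {\<one>}. (generic g * of_int (\<kappa> g)) ^ p) = ?R"
    by (intro sum.cong refl monom) simp
  finally have "of_nat p dvd ?R"
    using dvd one by (simp add: dvd_add_right_iff)
  then have "int p dvd coeff ?R (idx g0 * p)"
    by (simp add: of_nat_poly const_poly_dvd_iff)
  also have "coeff ?R (idx g0 * p) = (\<Sum>g\<in>carrier G - {\<one>}. if g = g0 then \<kappa> g ^ p else 0)"
    unfolding coeff_sum coeff_monom
    using inj_idx p0 g0(1) by (intro sum.cong) (auto dest: inj_onD)
  also have "\<dots> = \<kappa> g0 ^ p"
    using finite_carrier g0(1) \<open>g0 \<noteq> \<one>\<close> by simp
  finally have "int p dvd \<kappa> g0"
    by (rule prime_dvd_power[rotated]) (simp add: prime_p)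
  then show False using g0(2) by simp
qed

end

section \<open>Subdividing simplices in the space of maps\<close>

lemma map_action_one:
  assumes "group G" "\<phi> \<in> extensional (carrier G)"
  shows "map_action G \<one>\<^bsub>G\<^esub> \<phi> = \<phi>"
proof -
  interpret group G by fact
  show ?thesis
    using assms(2) by (intro extensionalityI[where A = "carrier G"]) (auto simp: map_action_def)
qed

lemma map_action_mult:
  assumes "group G" "g \<in> carrier G" "h \<in> carrier G"
  shows "map_action G (g \<otimes>\<^bsub>G\<^esub> h) \<phi> = map_action G g (map_action G h \<phi>)"
proof -
  interpret group G by fact
  show ?thesis
    using assms(2,3) by (auto simp: map_action_def inv_mult_group m_assoc fun_eq_iff)
qed

locale point_space = elementary_abelian +
  fixes m :: nat
begin

definition Maps :: "('a \<Rightarrow> nat \<Rightarrow> real) set" where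
  "Maps = carrier G \<rightarrow>\<^sub>E topspace (Euclidean_space m)"

lemma Maps_iff:
  "y \<in> Maps \<longleftrightarrow> y \<in> extensional (carrier G) \<and> (\<forall>h\<in>carrier G. \<forall>l\<ge>m. y h l = 0)"
  by (auto simp: Maps_def PiE_def topspace_Euclidean_space)

text \<open>
  Acting trivially outside the space makes the laws of an action unconditional.
\<close>

definition pact :: "'a \<Rightarrow> ('a \<Rightarrow> nat \<Rightarrow> real) \<Rightarrow> 'a \<Rightarrow> nat \<Rightarrow> real" where
  "pact g y = (if y \<in> Maps then map_action G g y else y)"

lemma map_action_Maps: "g \<in> carrier G \<Longrightarrow> y \<in> Maps \<Longrightarrow> map_action G g y \<in> Maps"
  unfolding Maps_def by (rule map_action_in) (rule is_group)

lemma pact_Maps_iff: "g \<in> carrier G \<Longrightarrow> pact g y \<in> Maps \<longleftrightarrow> y \<in> Maps"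
  by (simp add: pact_def map_action_Maps)

lemma pact_one: "pact \<one> y = y"
  by (simp add: pact_def map_action_one[OF is_group] Maps_iff)

lemma pact_mult: "g \<in> carrier G \<Longrightarrow> h \<in> carrier G \<Longrightarrow> pact (g \<otimes> h) y = pact g (pact h y)"
  by (simp add: pact_def map_action_mult[OF is_group] map_action_Maps)

lemma pact_apply: "y \<in> Maps \<Longrightarrow> h \<in> carrier G \<Longrightarrow> pact g y h l = y (inv g \<otimes> h) l"
  by (simp add: pact_def map_action_def)

definition avg :: "('a \<Rightarrow> nat \<Rightarrow> real) list \<Rightarrow> 'a \<Rightarrow> nat \<Rightarrow> real" where
  "avg s = (\<lambda>h\<in>carrier G. \<lambda>l. (\<Sum>x\<leftarrow>s. x h l) / length s)"

text \<open>
  The barycentre.  The default value for lists with an entry outside the space keeps the function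
  equivariant on all lists.
\<close>

definition bary :: "('a \<Rightarrow> nat \<Rightarrow> real) list \<Rightarrow> 'a \<Rightarrow> nat \<Rightarrow> real" where
  "bary s = (if set s \<subseteq> Maps then avg s else hd s)"

lemma sum_list_zero: "(\<And>x. x \<in> set s \<Longrightarrow> f x = (0::real)) \<Longrightarrow> (\<Sum>x\<leftarrow>s. f x) = 0"
  by (induction s) auto

lemma avg_Maps:
  assumes "set s \<subseteq> Maps"
  shows "avg s \<in> Maps"
proof -
  have "(\<Sum>x\<leftarrow>s. x h l) = 0" if "h \<in> carrier G" "l \<ge> m" for h l
    using assms that by (intro sum_list_zero) (auto simp: Maps_iff)
  then show ?thesis by (simp add: Maps_iff avg_def)
qed

lemma bary_pact:
  assumes g: "g \<in> carrier G" and s: "s \<noteq> []"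
  shows "bary (map (pact g) s) = pact g (bary s)"
proof (cases "set s \<subseteq> Maps")
  case True
  have "avg (map (pact g) s) = map_action G g (avg s)"
  proof (rule extensionalityI[where A = "carrier G"])
    fix h assume h: "h \<in> carrier G"
    have "(\<Sum>x\<leftarrow>s. pact g x h l) = (\<Sum>x\<leftarrow>s. x (inv g \<otimes> h) l)" for l
      using True h by (intro arg_cong[where f = sum_list] map_cong) (auto simp: pact_apply)
    then show "avg (map (pact g) s) h = map_action G g (avg s) h"
      using g h by (simp add: avg_def map_action_def o_def)
  qed (simp_all add: avg_def map_action_def)
  then show ?thesis
    using True g avg_Maps[OF True] by (auto simp: bary_def pact_def map_action_Maps)
next
  case False
  then have 1: "\<not> set (map (pact g) s) \<subseteq> Maps"
    using pact_Maps_iff[OF g] by auto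
  show ?thesis
  proof (cases "hd s \<in> Maps")
    case True
    then show ?thesis using False 1 s by (simp add: bary_def hd_map)
  next
    case F: False
    then show ?thesis using False 1 s by (simp add: bary_def hd_map)
  qed
qed

text \<open>
  In the join of \<open>m\<close> boundaries of \<open>(q-1)\<close>-simplices, a point lists its barycentric coordinates.  The face
  given by \<open>z\<close> omits the vertex \<open>z l\<close> of the \<open>l\<close>-th boundary.
\<close>

definition faces :: "(nat \<Rightarrow> 'a) \<Rightarrow> ('a \<Rightarrow> nat \<Rightarrow> real) set" where
  "faces z = {y \<in> Maps. (\<forall>h\<in>carrier G. \<forall>l. 0 \<le> y h l) \<and> (\<forall>l<m. y (z l) l = 0)
      \<and> (\<Sum>h\<in>carrier G. \<Sum>l<m. y h l) = 1}"

definition mesh :: "real \<Rightarrow> ('a \<Rightarrow> nat \<Rightarrow> real) list \<Rightarrow> bool" where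
  "mesh \<epsilon> s \<longleftrightarrow> (\<forall>x\<in>set s. \<forall>y\<in>set s. \<forall>h\<in>carrier G. \<forall>l. \<bar>x h l - y h l\<bar> \<le> \<epsilon>)"

lemma bary_Maps_apply:
  assumes "set s \<subseteq> Maps" "h \<in> carrier G"
  shows "bary s h l = (\<Sum>x\<leftarrow>s. x h l) / length s"
  using assms by (simp add: bary_def avg_def)

lemma sum_list_sum_swap:
  fixes f :: "'y \<Rightarrow> 'z \<Rightarrow> real"
  shows "(\<Sum>h\<in>A. \<Sum>x\<leftarrow>s. f h x) = (\<Sum>x\<leftarrow>s. \<Sum>h\<in>A. f h x)"
  by (induction s) (simp_all add: sum.distrib)

lemma bary_faces:
  assumes "set s \<subseteq> faces z" "s \<noteq> []" "\<And>l. l < m \<Longrightarrow> z l \<in> carrier G"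
  shows "bary s \<in> faces z"
proof -
  have M: "set s \<subseteq> Maps" using assms(1) by (auto simp: faces_def)
  have "0 \<le> (\<Sum>x\<leftarrow>s. x h l)" if "h \<in> carrier G" for h l
    using assms(1) that by (intro sum_list_nonneg) (auto simp: faces_def)
  moreover have "(\<Sum>x\<leftarrow>s. x (z l) l) = 0" if "l < m" for l
    using assms(1) that by (intro sum_list_zero) (auto simp: faces_def)
  moreover have "(\<Sum>h\<in>carrier G. \<Sum>l<m. bary s h l) = 1"
  proof -
    have "(\<Sum>h\<in>carrier G. \<Sum>l<m. bary s h l) = (\<Sum>h\<in>carrier G. \<Sum>l<m. (\<Sum>x\<leftarrow>s. x h l)) / length s"
      by (simp add: bary_Maps_apply[OF M] sum_divide_distrib)
    also have "(\<Sum>h\<in>carrier G. \<Sum>l<m. (\<Sum>x\<leftarrow>s. x h l)) = (\<Sum>x\<leftarrow>s. \<Sum>h\<in>carrier G. \<Sum>l<m. x h l)"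
      by (simp add: sum_list_sum_swap)
    also have "\<dots> = (\<Sum>x\<leftarrow>s. 1)"
      using assms(1) by (intro arg_cong[where f = sum_list] map_cong) (auto simp: faces_def)
    finally show ?thesis using assms(2) by (simp add: sum_list_triv)
  qed
  moreover have "bary s \<in> Maps"
    using avg_Maps[OF M] M by (simp add: bary_def)
  ultimately show ?thesis
    using assms(3) by (simp add: faces_def bary_Maps_apply[OF M])
qed

lemma average_close:
  fixes s :: "'z list"
  assumes "x \<in> set s" "\<And>y. y \<in> set s \<Longrightarrow> \<bar>f y - f x\<bar> \<le> \<epsilon>"
  shows "\<bar>(\<Sum>y\<leftarrow>s. f y) / length s - f x\<bar> \<le> (real (length s) - 1) / length s * \<epsilon>"
proof -
  obtain as bs where s: "s = as @ x # bs" using assms(1) by (meson split_list)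
  have "\<bar>(\<Sum>y\<leftarrow>as @ bs. f y - f x)\<bar> \<le> (\<Sum>y\<leftarrow>as @ bs. \<bar>f y - f x\<bar>)"
    using sum_list_abs[of "map (\<lambda>y. f y - f x) (as @ bs)"] by (simp add: o_def)
  also have "\<dots> \<le> (\<Sum>y\<leftarrow>as @ bs. \<epsilon>)"
    by (rule sum_list_mono) (use assms(2) s in auto)
  also have "\<dots> = (real (length s) - 1) * \<epsilon>"
    by (simp add: s sum_list_triv distrib_right)
  finally have le: "\<bar>(\<Sum>y\<leftarrow>as @ bs. f y - f x)\<bar> \<le> (real (length s) - 1) * \<epsilon>" .
  have "(\<Sum>y\<leftarrow>as @ bs. f y - f x) = (\<Sum>y\<leftarrow>s. f y) - length s * f x"
    unfolding sum_list_subtractf sum_list_triv by (simp add: s algebra_simps)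
  moreover have "length s > 0" using s by simp
  ultimately have "(\<Sum>y\<leftarrow>s. f y) / length s - f x = (\<Sum>y\<leftarrow>as @ bs. f y - f x) / length s"
    by (simp add: field_simps)
  then show ?thesis
    using le \<open>length s > 0\<close> by (simp add: abs_divide divide_right_mono)
qed

text \<open>
  The barycentre of \<open>s\<close> is within the contracted distance of every vertex of \<open>s\<close>, hence of every point between
  these vertices in each coordinate, in particular of the barycentres of the faces of \<open>s\<close>.
\<close>

lemma flags_bary:
  assumes "(s, r) \<in> flags bary" "set s \<subseteq> faces z" "\<And>l. l < m \<Longrightarrow> z l \<in> carrier G"
    "mesh \<epsilon> s" "length s \<le> n" "0 \<le> \<epsilon>"
  shows "set r \<subseteq> faces z \<and> mesh ((real n - 1) / n * \<epsilon>) r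
    \<and> (\<forall>b\<in>set r. \<forall>h\<in>carrier G. \<forall>l c. ((\<forall>x\<in>set s. c \<le> x h l) \<longrightarrow> c \<le> b h l)
                              \<and> ((\<forall>x\<in>set s. x h l \<le> c) \<longrightarrow> b h l \<le> c))"
  using assms
proof (induction rule: flags.induct)
  case flags_Nil
  then show ?case by (simp add: mesh_def)
next
  case (flags_step s k r)
  let ?\<kappa> = "(real n - 1) / n * \<epsilon>"
  have n: "n \<ge> 1" using flags_step.prems(4) flags_step.hyps(1) by (cases s) auto
  have sub: "set (del k s) \<subseteq> set s" by (rule set_del)
  have M: "set s \<subseteq> Maps" using flags_step.prems(1) by (auto simp: faces_def)
  have mesh': "mesh \<epsilon> (del k s)" using flags_step.prems(3) sub by (auto simp: mesh_def)
  have len: "length (del k s) \<le> n"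
    using flags_step.prems(4) flags_step.hyps(2) by (simp add: length_del)
  have IH: "set r \<subseteq> faces z" "mesh ?\<kappa> r"
    and hull: "\<And>b h l c. b \<in> set r \<Longrightarrow> h \<in> carrier G \<Longrightarrow> (\<forall>x\<in>set s. c \<le> x h l) \<Longrightarrow> c \<le> b h l"
      "\<And>b h l c. b \<in> set r \<Longrightarrow> h \<in> carrier G \<Longrightarrow> (\<forall>x\<in>set s. x h l \<le> c) \<Longrightarrow> b h l \<le> c"
    using flags_step.IH[OF _ flags_step.prems(2) mesh' len flags_step.prems(5)] flags_step.prems(1) sub
    by (meson subset_iff subset_trans)+
  have close: "\<bar>bary s h l - x h l\<bar> \<le> ?\<kappa>" if x: "x \<in> set s" and h: "h \<in> carrier G" for x h l
  proof -
    have "\<bar>bary s h l - x h l\<bar> \<le> (real (length s) - 1) / length s * \<epsilon>"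
      unfolding bary_Maps_apply[OF M h]
      using average_close[OF x, of "\<lambda>x. x h l" \<epsilon>] flags_step.prems(3) x h by (auto simp: mesh_def)
    also have "\<dots> \<le> ?\<kappa>"
    proof (rule mult_right_mono)
      have "0 < length s" using flags_step.hyps(1) by simp
      then show "(real (length s) - 1) / length s \<le> (real n - 1) / n"
        using n flags_step.prems(4) by (simp add: field_simps)
    qed (rule flags_step.prems(5))
    finally show ?thesis .
  qed
  have close_hull: "\<bar>bary s h l - b h l\<bar> \<le> ?\<kappa>" if b: "b \<in> set r" and h: "h \<in> carrier G" for b h l
  proof -
    have "bary s h l - ?\<kappa> \<le> x h l \<and> x h l \<le> bary s h l + ?\<kappa>" if "x \<in> set s" for x
      using close[OF that h, of l] by linarith
    then have "bary s h l - ?\<kappa> \<le> b h l" "b h l \<le> bary s h l + ?\<kappa>"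
      by (auto intro!: hull[OF b h])
    then show ?thesis by linarith
  qed
  have \<kappa>: "0 \<le> ?\<kappa>" using n flags_step.prems(5) by simp
  have "mesh ?\<kappa> (r @ [bary s])"
    unfolding mesh_def
  proof (intro ballI allI)
    fix x y h l assume xy: "x \<in> set (r @ [bary s])" "y \<in> set (r @ [bary s])" and h: "h \<in> carrier G"
    have close_hull': "\<bar>b h l - bary s h l\<bar> \<le> ?\<kappa>" if "b \<in> set r" for b
      using close_hull[OF that h, of l] by (simp only: abs_minus_commute)
    consider "x \<in> set r" "y \<in> set r" | "x = bary s" "y = bary s"
      | "x = bary s" "y \<in> set r" | "x \<in> set r" "y = bary s"
      using xy by auto
    then show "\<bar>x h l - y h l\<bar> \<le> ?\<kappa>"
    proof cases
      case 1
      then show ?thesis using IH(2) h unfolding mesh_def by blast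
    qed (use \<kappa> close_hull[OF _ h] close_hull' in simp_all)
  qed
  moreover have "set (r @ [bary s]) \<subseteq> faces z"
    using IH(1) bary_faces[OF flags_step.prems(1) flags_step.hyps(1) flags_step.prems(2)] by simp
  moreover have "c \<le> bary s h l" if "h \<in> carrier G" "\<forall>x\<in>set s. c \<le> x h l" for h l c
  proof -
    have "(\<Sum>x\<leftarrow>s. c) \<le> (\<Sum>x\<leftarrow>s. x h l)" using that by (intro sum_list_mono) auto
    then show ?thesis
      using that flags_step.hyps(1) by (simp add: bary_Maps_apply[OF M] sum_list_triv field_simps)
  qed
  moreover have "bary s h l \<le> c" if "h \<in> carrier G" "\<forall>x\<in>set s. x h l \<le> c" for h l c
  proof -
    have "(\<Sum>x\<leftarrow>s. x h l) \<le> (\<Sum>x\<leftarrow>s. c)" using that by (intro sum_list_mono) auto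
    then show ?thesis
      using that flags_step.hyps(1) by (simp add: bary_Maps_apply[OF M] sum_list_triv field_simps)
  qed
  ultimately show ?case using hull by auto
qed

lemma iterated_bary_dvd:
  assumes "set s \<subseteq> faces z" "\<And>l. l < m \<Longrightarrow> z l \<in> carrier G" "mesh \<epsilon> s" "length s \<le> n" "0 \<le> \<epsilon>"
    and "\<And>s'. length s' = length s \<Longrightarrow> set s' \<subseteq> faces z \<Longrightarrow> mesh (((real n - 1) / n) ^ k * \<epsilon>) s' \<Longrightarrow> d dvd u s'"
  shows "d dvd (pull bary ^^ k) u s"
  using assms
proof (induction k arbitrary: s \<epsilon>)
  case (Suc k)
  show ?case
    unfolding funpow.simps o_apply
  proof (rule pull_dvd)
    fix r assume r: "(s, r) \<in> flags bary"
    note fl = flags_bary[OF r Suc.prems(1-5)]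
    have len: "length r = length s" using r by (rule length_flags)
    show "d dvd (pull bary ^^ k) u r"
    proof (rule Suc.IH[where \<epsilon> = "(real n - 1) / n * \<epsilon>"])
      show "0 \<le> (real n - 1) / n * \<epsilon>"
        using Suc.prems(5) by (cases "n = 0") simp_all
    qed (use fl len Suc.prems in \<open>auto simp: mult.assoc mult.left_commute\<close>)
  qed
qed simp

end

section \<open>Labelled points\<close>

text \<open>
  The least rank does not increase when a simplex grows, so the labels selected along a flag are sorted.
  Taking the first entry of least rank makes the choice equivariant.
\<close>

definition select_label :: "('l \<Rightarrow> nat) \<Rightarrow> ('x \<Rightarrow> 'l) \<Rightarrow> 'x list \<Rightarrow> 'l" where
  "select_label rk lab s = lab (hd (filter (\<lambda>x. \<forall>y\<in>set s. rk (lab x) \<le> rk (lab y)) s))"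

lemma exists_least_rank:
  assumes "s \<noteq> []"
  shows "filter (\<lambda>x. \<forall>y\<in>set s. rk (lab x) \<le> (rk (lab y) :: nat)) s \<noteq> []"
proof -
  obtain x where "x \<in> set s" "\<forall>y\<in>set s. rk (lab x) \<le> rk (lab y)"
    using arg_min_if_finite[of "set s" "\<lambda>x. rk (lab x)"] assms
    by (metis List.finite_set not_le set_empty)
  then show ?thesis by (auto simp: filter_empty_conv)
qed

lemma select_label_least:
  assumes "s \<noteq> []"
  shows "\<exists>x\<in>set s. select_label rk lab s = lab x \<and> (\<forall>y\<in>set s. rk (lab x) \<le> rk (lab y))"
proof -
  let ?x = "hd (filter (\<lambda>x. \<forall>y\<in>set s. rk (lab x) \<le> rk (lab y)) s)"
  have "?x \<in> set (filter (\<lambda>x. \<forall>y\<in>set s. rk (lab x) \<le> rk (lab y)) s)"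
    using exists_least_rank[OF assms, of rk lab] by (rule hd_in_set)
  then show ?thesis unfolding select_label_def by (intro bexI[of _ ?x]) auto
qed

lemma select_label_map:
  assumes "s \<noteq> []" "\<And>x. lab (f x) = g (lab x)" "\<And>l. rk (g l) = rk l"
  shows "select_label rk lab (map f s) = g (select_label rk lab s)"
  unfolding select_label_def
  using assms(2,3) exists_least_rank[OF assms(1), of rk lab]
  by (simp add: filter_map o_def hd_map)

lemma flags_select_label:
  assumes "(s, r) \<in> flags (select_label rk lab)"
    and "\<And>x y. x \<in> set s \<Longrightarrow> y \<in> set s \<Longrightarrow> rk (lab x) = rk (lab y) \<Longrightarrow> lab x = lab y"
  shows "set r \<subseteq> lab ` set s \<and> sorted_wrt (\<lambda>x y. x = y \<or> rk y < rk x) r"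
  using assms
proof (induction rule: flags.induct)
  case (flags_step s k r)
  have sub: "set (del k s) \<subseteq> set s" by (rule set_del)
  then have IH: "set r \<subseteq> lab ` set s" "sorted_wrt (\<lambda>x y. x = y \<or> rk y < rk x) r"
    using flags_step.IH flags_step.prems by blast+
  obtain x where x: "x \<in> set s" "select_label rk lab s = lab x" "\<forall>y\<in>set s. rk (lab x) \<le> rk (lab y)"
    using select_label_least[OF flags_step.hyps(1)] by blast
  have "b = lab x \<or> rk (lab x) < rk b" if b: "b \<in> set r" for b
  proof -
    obtain y where "y \<in> set s" "b = lab y" using IH(1) b by auto
    then show ?thesis using x(1,3) flags_step.prems by (metis le_neq_implies_less)
  qed
  then show ?case using IH x(1,2) by (auto simp: sorted_wrt_append)
qed simp

lemma pull_diff: "pull \<beta> (\<lambda>s. u s - w s) s = pull \<beta> u s - pull \<beta> w s"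
  using pull_add[of \<beta> u "\<lambda>s. -1 * w s" s] by (simp only: pull_scale) simp

context point_space
begin

text \<open>
  The unit vectors at the neutral element; each of the \<open>m\<close> directions is used \<open>q - 1\<close> times.
\<close>

definition vtx :: "nat \<Rightarrow> 'a \<Rightarrow> nat \<Rightarrow> real" where
  "vtx k = (\<lambda>h\<in>carrier G. \<lambda>l. if h = \<one> \<and> l = k div (card (carrier G) - 1) then 1 else 0)"

lemma vtx_Maps: "k < m * (card (carrier G) - 1) \<Longrightarrow> vtx k \<in> Maps"
  using less_mult_imp_div_less[of k m "card (carrier G) - 1"] by (auto simp: Maps_iff vtx_def)

lemma pact_vtx:
  assumes "k < m * (card (carrier G) - 1)" "g \<in> carrier G" "h \<in> carrier G"
  shows "pact g (vtx k) h l = (if h = g \<and> l = k div (card (carrier G) - 1) then 1 else 0)"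
proof -
  have "inv g \<otimes> h = \<one> \<longleftrightarrow> h = g"
    using assms(2,3) by (metis inv_closed inv_equality inv_inv l_inv)
  then show ?thesis
    unfolding pact_apply[OF vtx_Maps[OF assms(1)] assms(3)] using assms(2,3) by (simp add: vtx_def)
qed

text \<open>
  Translates of \<open>q - 1\<close> unit vectors of the same direction cannot occupy all \<open>q\<close> positions.
\<close>

lemma vertices_in_faces:
  assumes len: "length s = Suc i" and i: "i < m * (card (carrier G) - 1)"
    and s: "\<And>k. k \<le> i \<Longrightarrow> \<exists>g\<in>carrier G. s ! k = pact g (vtx k)"
  shows "\<exists>z. (\<forall>l<m. z l \<in> carrier G) \<and> set s \<subseteq> faces z"
proof -
  define d where "d = card (carrier G) - 1"
  have d: "d > 0" "d < card (carrier G)"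
  proof -
    show "d > 0" using i unfolding d_def[symmetric] by (intro gr0I) simp
    then show "d < card (carrier G)" by (simp add: d_def)
  qed
  obtain \<gamma> where \<gamma>: "\<And>k. k \<le> i \<Longrightarrow> \<gamma> k \<in> carrier G" "\<And>k. k \<le> i \<Longrightarrow> s ! k = pact (\<gamma> k) (vtx k)"
    using s by metis
  have "\<exists>g\<in>carrier G. g \<notin> \<gamma> ` {k. k \<le> i \<and> k div d = l}" for l
  proof (rule ccontr)
    assume "\<not> ?thesis"
    then have "carrier G \<subseteq> \<gamma> ` {k. k \<le> i \<and> k div d = l}" by blast
    then have "card (carrier G) \<le> card {k. k \<le> i \<and> k div d = l}"
      by (rule surj_card_le[rotated]) simp
    also have "\<dots> \<le> card {l * d..<l * d + d}"
    proof (rule card_mono)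
      show "{k. k \<le> i \<and> k div d = l} \<subseteq> {l * d..<l * d + d}"
      proof
        fix k assume "k \<in> {k. k \<le> i \<and> k div d = l}"
        then have "k = l * d + k mod d" using div_mult_mod_eq[of k d] by simp
        moreover have "k mod d < d" using d(1) by simp
        ultimately have "l * d \<le> k" "k < l * d + d" by linarith+
        then show "k \<in> {l * d..<l * d + d}" by simp
      qed
    qed simp
    finally show False using d(2) by simp
  qed
  then obtain z where z: "\<And>l. z l \<in> carrier G" "\<And>l. z l \<notin> \<gamma> ` {k. k \<le> i \<and> k div d = l}"
    by metis
  have "s ! k \<in> faces z" if k: "k \<le> i" for k
  proof -
    have km: "k < m * (card (carrier G) - 1)" using k i by simp
    have coord: "(s ! k) h l = (if h = \<gamma> k \<and> l = k div d then 1 else 0)" if "h \<in> carrier G" for h l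
      using pact_vtx[OF km \<gamma>(1)[OF k] that] \<gamma>(2)[OF k] by (simp add: d_def)
    have "s ! k \<in> Maps"
      using \<gamma>[OF k] pact_Maps_iff vtx_Maps[OF km] by simp
    moreover have "(s ! k) (z l) l = 0" for l
    proof -
      have "\<not> (z l = \<gamma> k \<and> l = k div d)" using z(2)[of l] k by auto
      then show ?thesis using coord[OF z(1)] by simp
    qed
    moreover have "(\<Sum>h\<in>carrier G. \<Sum>l<m. (s ! k) h l) = 1"
    proof -
      have "(\<Sum>l<m. (s ! k) h l) = (if h = \<gamma> k then 1 else 0)" if "h \<in> carrier G" for h
        using less_mult_imp_div_less[OF km] by (simp add: coord[OF that] d_def)
      then have "(\<Sum>h\<in>carrier G. \<Sum>l<m. (s ! k) h l) = (\<Sum>h\<in>carrier G. if h = \<gamma> k then 1 else 0)"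
        by (intro sum.cong) simp_all
      then show ?thesis using finite_carrier \<gamma>(1)[OF k] by simp
    qed
    ultimately show ?thesis by (simp add: faces_def coord)
  qed
  then have "set s \<subseteq> faces z"
    using len by (auto simp: in_set_conv_nth)
  then show ?thesis using z(1) by blast
qed

lemma faces_bounds:
  assumes "y \<in> faces z" "h \<in> carrier G"
  shows "0 \<le> y h l" "y h l \<le> 1"
proof -
  have nn: "0 \<le> y h l" if "h \<in> carrier G" for h l
    using assms(1) that by (simp add: faces_def)
  show "0 \<le> y h l" by (rule nn[OF assms(2)])
  show "y h l \<le> 1"
  proof (cases "l < m")
    case True
    have "y h l \<le> (\<Sum>l<m. y h l)"
      using True nn[OF assms(2)] by (intro member_le_sum) auto
    also have "\<dots> \<le> (\<Sum>h\<in>carrier G. \<Sum>l<m. y h l)"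
      using finite_carrier assms(2) nn by (intro member_le_sum[of h "carrier G" "\<lambda>h. \<Sum>l<m. y h l"] sum_nonneg) auto
    also have "\<dots> = 1" using assms(1) by (simp add: faces_def)
    finally show ?thesis .
  next
    case False
    then show ?thesis using assms by (simp add: faces_def Maps_iff)
  qed
qed

lemma faces_mesh: "set s \<subseteq> faces z \<Longrightarrow> mesh 1 s"
  unfolding mesh_def by (smt (verit, best) faces_bounds subset_iff)

text \<open>
  The test functionals on the points \<open>vtx k\<close>, pulled back along sufficiently many barycentric subdivisions and
  the selection of labels, contradict \<open>no_test_functional\<close>: on a small simplex labels of equal rank agree.
\<close>

theorem no_small_labelling:
  assumes "labels G p lact generic L rk crd \<kappa> M"
    and lab_act: "\<And>g y. g \<in> carrier G \<Longrightarrow> lab (pact g y) = lact g (lab y)"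
    and lab_L: "\<And>z y. (\<And>l. l < m \<Longrightarrow> z l \<in> carrier G) \<Longrightarrow> y \<in> faces z \<Longrightarrow> lab y \<in> L"
    and \<epsilon>: "\<epsilon> > 0"
    and close: "\<And>z x y. (\<And>l. l < m \<Longrightarrow> z l \<in> carrier G) \<Longrightarrow> x \<in> faces z \<Longrightarrow> y \<in> faces z
        \<Longrightarrow> (\<And>h l. h \<in> carrier G \<Longrightarrow> \<bar>x h l - y h l\<bar> \<le> \<epsilon>) \<Longrightarrow> rk (lab x) = rk (lab y) \<Longrightarrow> lab x = lab y"
    and M: "M < m * (card (carrier G) - 1)"
  shows False
proof -
  interpret L: labels G p lact generic L rk crd \<kappa> M by fact
  interpret X: list_torus G p pact generic
    by unfold_locales (auto simp: pact_one pact_mult sum_generic)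
  obtain k where k: "((real (Suc M) - 1) / real (Suc M)) ^ k < \<epsilon>"
    using real_arch_pow_inv[OF \<epsilon>, of "(real (Suc M) - 1) / real (Suc M)"] by auto
  let ?sel = "select_label rk lab"
  define \<Phi> where "\<Phi> w = (pull bary ^^ k) (pull ?sel w)" for w :: "_ \<Rightarrow> int poly"
  define \<Psi> where "\<Psi> i w = X.tst vtx i (\<Phi> w)" for i w
  have sel_act: "?sel (map (pact g) s) = lact g (?sel s)" if "g \<in> carrier G" "s \<noteq> []" for g s
    using that lab_act L.rank_act by (intro select_label_map) auto
  have \<Phi>_tor: "\<Phi> ((L.tor ^^ e) w) = (X.tor ^^ e) (\<Phi> w)" for e w
  proof -
    have b: "(pull bary ^^ k) (X.tor u) = X.tor ((pull bary ^^ k) u)" for u :: "_ \<Rightarrow> int poly"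
      by (rule funpow_commute) (unfold X.tor_def, rule pull_gop[OF finite_carrier], rule bary_pact)
    have "pull ?sel (L.tor u) = X.tor (pull ?sel u)" for u :: "_ \<Rightarrow> int poly"
      unfolding X.tor_def L.tor_def by (rule pull_gop[OF finite_carrier]) (rule sel_act)
    then have "\<Phi> (L.tor u) = X.tor (\<Phi> u)" for u by (simp add: \<Phi>_def b)
    then show ?thesis by (induction e) simp_all
  qed
  have \<Phi>_cobdry: "\<Phi> (cobdry w) = cobdry (\<Phi> w)" for w
  proof -
    have c: "pull \<beta> (cobdry u) = cobdry (pull \<beta> u)" for \<beta> :: "'x list \<Rightarrow> 'y" and u :: "'y list \<Rightarrow> int poly"
      by (rule ext) (rule cobdry_pull[symmetric])
    have "(pull bary ^^ k) (cobdry u) = cobdry ((pull bary ^^ k) u)" for u :: "_ \<Rightarrow> int poly"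
      by (rule funpow_commute) (rule c)
    then show ?thesis by (simp add: \<Phi>_def c)
  qed
  have \<Phi>_scale: "\<Phi> (\<lambda>s. c * w s) = (\<lambda>s. c * \<Phi> w s)" for c w
  proof -
    have "(pull bary ^^ j) (\<lambda>s. c * u s) = (\<lambda>s. c * (pull bary ^^ j) u s)" for j and u :: "_ \<Rightarrow> int poly"
      by (induction j) (simp_all add: pull_scale)
    then show ?thesis by (simp add: \<Phi>_def pull_scale[abs_def])
  qed
  have \<Phi>_diff: "\<Phi> (\<lambda>s. u s - w s) = (\<lambda>s. \<Phi> u s - \<Phi> w s)" for u w
  proof -
    have "(pull bary ^^ j) (\<lambda>s. u s - w s) = (\<lambda>s. (pull bary ^^ j) u s - (pull bary ^^ j) w s)"
      for j and u w :: "_ \<Rightarrow> int poly"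
      by (induction j) (simp_all add: pull_diff)
    then show ?thesis by (simp add: \<Phi>_def pull_diff[abs_def])
  qed
  show False
  proof (rule L.no_test_functional[of \<Psi>])
    have "(pull bary ^^ j) u [a] = 1" if "\<And>a. u [a] = 1" for j a and u :: "_ \<Rightarrow> int poly"
      using that by (induction j arbitrary: a) simp_all
    then show "\<Psi> 0 (\<lambda>_. 1) = 1"
      by (simp add: \<Psi>_def \<Phi>_def)
  next
    show "\<Psi> i (\<lambda>s. c * w s) = c * \<Psi> i w" for i c w
      by (simp add: \<Psi>_def \<Phi>_scale X.tst_scale)
  next
    fix i and u w :: "_ \<Rightarrow> int poly"
    assume i: "i \<le> M" and uw: "\<And>s. s \<in> L.weak (Suc i) \<Longrightarrow> of_nat p dvd u s - w s"
    have "of_nat p dvd \<Phi> (\<lambda>s. u s - w s) s" if s: "s \<in> X.orbit_lists vtx i" for s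
    proof -
      have len: "length s = Suc i" using s by (simp add: X.orbit_lists_def)
      obtain z where z: "\<forall>l<m. z l \<in> carrier G" and sz: "set s \<subseteq> faces z"
        using vertices_in_faces[of s i] s i M by (auto simp: X.orbit_lists_def)
      show ?thesis
        unfolding \<Phi>_def
      proof (rule iterated_bary_dvd[OF sz _ faces_mesh[OF sz], of "Suc M"])
        fix s' assume s': "length s' = length s" "set s' \<subseteq> faces z"
          "mesh (((real (Suc M) - 1) / real (Suc M)) ^ k * 1) s'"
        show "of_nat p dvd pull ?sel (\<lambda>s. u s - w s) s'"
        proof (rule pull_dvd)
          fix r assume r: "(s', r) \<in> flags ?sel"
          have "set r \<subseteq> lab ` set s' \<and> sorted_wrt (\<lambda>x y. x = y \<or> rk y < rk x) r"
          proof (rule flags_select_label[OF r])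
            fix x y assume xy: "x \<in> set s'" "y \<in> set s'" "rk (lab x) = rk (lab y)"
            show "lab x = lab y"
            proof (rule close[of z])
              fix h l assume "h \<in> carrier G"
              then have "\<bar>x h l - y h l\<bar> \<le> ((real (Suc M) - 1) / real (Suc M)) ^ k * 1"
                using s'(3) xy unfolding mesh_def by blast
              then show "\<bar>x h l - y h l\<bar> \<le> \<epsilon>" using k by simp
            qed (use z s' xy in auto)
          qed
          moreover have "lab ` set s' \<subseteq> L"
            using s'(2) lab_L[of z] z by blast
          ultimately have "r \<in> L.weak (Suc i)"
            using length_flags[OF r] s'(1) len by (auto simp: L.weak_def)
          then show "of_nat p dvd u r - w r" by (rule uw)
        qed
      qed (use z len i in auto)
    qed
    then have "of_nat p dvd X.tst vtx i (\<Phi> (\<lambda>s. u s - w s))"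
      by (rule X.tst_dvd)
    then show "of_nat p dvd \<Psi> i u - \<Psi> i w"
      by (simp add: \<Psi>_def \<Phi>_diff X.tst_diff)
  next
    fix i w assume "i < M"
    show "of_nat p dvd \<Psi> (Suc i) (cobdry w) - \<Psi> i ((L.tor ^^ alt_exp p i) w)"
      unfolding \<Psi>_def \<Phi>_cobdry \<Phi>_tor by (rule X.tst_cobdry)
  qed
qed

end

section \<open>Topology of finite powers of Euclidean spaces\<close>

lemma openin_finite_ball:
  assumes "finite A" "\<And>a. a \<in> A \<Longrightarrow> openin X {x \<in> topspace X. Q a x}"
  shows "openin X {x \<in> topspace X. \<forall>a\<in>A. Q a x}"
  using assms
proof (induction A)
  case (insert a A)
  have "{x \<in> topspace X. \<forall>b\<in>insert a A. Q b x}
      = {x \<in> topspace X. Q a x} \<inter> {x \<in> topspace X. \<forall>b\<in>A. Q b x}" by auto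
  moreover have "openin X ({x \<in> topspace X. Q a x} \<inter> {x \<in> topspace X. \<forall>b\<in>A. Q b x})"
    using insert by (intro openin_Int) auto
  ultimately show ?case by simp
qed simp

lemma openin_bex:
  assumes "\<And>a. a \<in> A \<Longrightarrow> openin X {x \<in> topspace X. Q a x}"
  shows "openin X {x \<in> topspace X. \<exists>a\<in>A. Q a x}"
proof -
  have "{x \<in> topspace X. \<exists>a\<in>A. Q a x} = \<Union>((\<lambda>a. {x \<in> topspace X. Q a x}) ` A)" by auto
  moreover have "openin X (\<Union>((\<lambda>a. {x \<in> topspace X. Q a x}) ` A))"
    by (rule openin_Union) (use assms in blast)
  ultimately show ?thesis by simp
qed

lemma openin_less:
  assumes "continuous_map X euclideanreal f" "continuous_map X euclideanreal g"
  shows "openin X {x \<in> topspace X. f x < g x}"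
proof -
  have "openin X {x \<in> topspace X. g x - f x \<in> {0<..}}"
    by (rule openin_continuous_map_preimage[OF continuous_map_diff]) (use assms in auto)
  then show ?thesis by simp
qed

lemma openin_neq:
  assumes "continuous_map X euclideanreal f" "continuous_map X euclideanreal g"
  shows "openin X {x \<in> topspace X. f x \<noteq> g x}"
proof -
  have "{x \<in> topspace X. f x \<noteq> g x} = {x \<in> topspace X. f x < g x} \<union> {x \<in> topspace X. g x < f x}"
    by auto
  then show ?thesis using openin_Un[OF openin_less[OF assms] openin_less[OF assms(2,1)]] by simp
qed

lemma continuous_coordinate:
  assumes "h \<in> I"
  shows "continuous_map (product_topology (\<lambda>_. Euclidean_space m) I) euclideanreal (\<lambda>y. y h l)"
proof -
  have "continuous_map (Euclidean_space m) euclideanreal (\<lambda>x. x l)"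
    unfolding Euclidean_space_def
    by (intro continuous_map_from_subtopology continuous_map_product_projection) simp
  from continuous_map_compose[OF continuous_map_product_projection[OF assms] this]
  show ?thesis by (simp add: o_def)
qed

lemma Euclidean_space_box:
  assumes "openin (Euclidean_space m) W" "x \<in> W"
  shows "\<exists>e>0. \<forall>y\<in>topspace (Euclidean_space m). (\<forall>l. \<bar>y l - x l\<bar> < e) \<longrightarrow> y \<in> W"
proof -
  obtain T where T: "openin (powertop_real UNIV) T" "W = T \<inter> {x. \<forall>i\<ge>m. x i = 0}"
    using assms(1) by (auto simp: Euclidean_space_def openin_subtopology)
  obtain U where U: "\<And>i. open (U i)" "x \<in> Pi\<^sub>E UNIV U" "Pi\<^sub>E UNIV U \<subseteq> T"
    using T(1)[unfolded openin_product_topology_alt, rule_format, of x] assms(2) T(2) by auto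
  have "\<exists>e>0. \<forall>t. \<bar>t - x i\<bar> < e \<longrightarrow> t \<in> U i" for i
    using U(1,2) by (metis PiE_mem UNIV_I dist_real_def open_dist)
  then obtain e where e: "\<And>i. e i > 0" "\<And>i t. \<bar>t - x i\<bar> < e i \<Longrightarrow> t \<in> U i" by metis
  let ?e = "Min (insert 1 (e ` {..<m}))"
  have "?e > 0" using e(1) by simp
  moreover have "y \<in> W" if y: "y \<in> topspace (Euclidean_space m)" "\<forall>l. \<bar>y l - x l\<bar> < ?e" for y
  proof -
    have "y l \<in> U l" for l
    proof (cases "l < m")
      case True
      then have "?e \<le> e l" by (intro Min_le) auto
      then show ?thesis using y(2) e(2) by (meson less_le_trans)
    next
      case False
      then have "y l = x l" using y(1) assms(2) T(2) by (simp add: topspace_Euclidean_space)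
      then show ?thesis using e by simp
    qed
    then show ?thesis
      using U(3) T(2) y(1) by (auto simp: topspace_Euclidean_space)
  qed
  ultimately show ?thesis by blast
qed

lemma power_box:
  assumes "finite I" "openin (product_topology (\<lambda>_. Euclidean_space m) I) W" "x \<in> W"
  shows "\<exists>e>0. \<forall>y\<in>I \<rightarrow>\<^sub>E topspace (Euclidean_space m). (\<forall>h\<in>I. \<forall>l. \<bar>y h l - x h l\<bar> < e) \<longrightarrow> y \<in> W"
proof -
  obtain U where U: "\<And>i. i \<in> I \<Longrightarrow> openin (Euclidean_space m) (U i)" "x \<in> Pi\<^sub>E I U" "Pi\<^sub>E I U \<subseteq> W"
    using assms(2)[unfolded openin_product_topology_alt, rule_format, OF assms(3)] by auto
  have "\<exists>e>0. \<forall>y\<in>topspace (Euclidean_space m). (\<forall>l. \<bar>y l - x i l\<bar> < e) \<longrightarrow> y \<in> U i" if "i \<in> I" for i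
    using that U(2) by (intro Euclidean_space_box U(1)) auto
  then obtain e where e: "\<And>i. i \<in> I \<Longrightarrow> e i > 0"
      "\<And>i y. i \<in> I \<Longrightarrow> y \<in> topspace (Euclidean_space m) \<Longrightarrow> \<forall>l. \<bar>y l - x i l\<bar> < e i \<Longrightarrow> y \<in> U i"
    by metis
  let ?e = "Min (insert 1 (e ` I))"
  have "?e > 0" using e(1) assms(1) by simp
  moreover have "y \<in> W" if y: "y \<in> I \<rightarrow>\<^sub>E topspace (Euclidean_space m)"
    "\<forall>h\<in>I. \<forall>l. \<bar>y h l - x h l\<bar> < ?e" for y
  proof -
    have "y i \<in> U i" if i: "i \<in> I" for i
    proof (rule e(2)[OF i])
      have "?e \<le> e i" using i assms(1) by (intro Min_le) auto
      then show "\<forall>l. \<bar>y i l - x i l\<bar> < e i" using y(2) i by (meson less_le_trans)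
    qed (use y i in auto)
    then have "y \<in> Pi\<^sub>E I U" using y(1) by (simp add: PiE_iff)
    then show ?thesis using U(3) by blast
  qed
  ultimately show ?thesis by blast
qed

lemma openin_power_box:
  assumes "finite I"
  shows "openin (product_topology (\<lambda>_. Euclidean_space m) I)
    {y \<in> topspace (product_topology (\<lambda>_. Euclidean_space m) I). \<forall>h\<in>I. \<forall>l\<in>{..<m}. \<bar>y h l - x h l\<bar> < e}"
proof (rule openin_finite_ball[OF assms], rule openin_finite_ball)
  fix h l assume "h \<in> I"
  have c: "continuous_map (product_topology (\<lambda>_. Euclidean_space m) I) euclideanreal (\<lambda>y. \<bar>y h l - x h l\<bar>)"
    by (rule continuous_map_real_abs, rule continuous_map_diff[OF continuous_coordinate[OF \<open>h \<in> I\<close>]]) simp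
  show "openin (product_topology (\<lambda>_. Euclidean_space m) I)
      {y \<in> topspace (product_topology (\<lambda>_. Euclidean_space m) I). \<bar>y h l - x h l\<bar> < e}"
    by (rule openin_less[OF c]) simp
qed simp

section \<open>The sphere of nonconstant maps\<close>

context point_space
begin

abbreviation map_top :: "('a \<Rightarrow> nat \<Rightarrow> real) topology" where
  "map_top \<equiv> product_topology (\<lambda>_. Euclidean_space m) (carrier G)"

lemma topspace_map_top: "topspace map_top = Maps"
  by (simp add: Maps_def)

lemma compactin_faces:
  assumes z: "\<And>l. l < m \<Longrightarrow> z l \<in> carrier G"
  shows "compactin map_top (faces z)"
proof -
  define C where "C = Pi\<^sub>E (UNIV :: nat set) (\<lambda>l. if l < m then {0..1::real} else {0})"
  have C_sub: "C \<subseteq> topspace (Euclidean_space m)"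
  proof
    fix x assume x: "x \<in> C"
    have "x l \<in> (if l < m then {0..1::real} else {0})" for l
      using x by (simp add: C_def PiE_iff)
    then have "x l = 0" if "l \<ge> m" for l
      using that by (metis not_le singletonD)
    then show "x \<in> topspace (Euclidean_space m)" by (simp add: topspace_Euclidean_space)
  qed
  have "compactin (powertop_real UNIV) C"
    unfolding C_def compactin_PiE by auto
  then have "compactin (Euclidean_space m) C"
    using C_sub by (simp add: Euclidean_space_def compactin_subtopology)
  then have B: "compactin map_top (carrier G \<rightarrow>\<^sub>E C)"
    by (simp add: compactin_PiE)
  let ?F = "{y \<in> topspace map_top. (\<Sum>l<m. y (z l) l) \<in> {0}}"
  let ?N = "{y \<in> topspace map_top. (\<Sum>h\<in>carrier G. \<Sum>l<m. y h l) \<in> {1}}"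
  have "continuous_map map_top euclideanreal (\<lambda>y. \<Sum>l<m. y (z l) l)"
    by (intro continuous_map_sum continuous_coordinate) (use z in auto)
  then have "closedin map_top ?F"
    by (rule closedin_continuous_map_preimage) simp
  moreover have "continuous_map map_top euclideanreal (\<lambda>y. \<Sum>h\<in>carrier G. \<Sum>l<m. y h l)"
    by (intro continuous_map_sum continuous_coordinate) (use finite_carrier in auto)
  then have "closedin map_top ?N"
    by (rule closedin_continuous_map_preimage) simp
  ultimately have "compactin map_top ((?F \<inter> ?N) \<inter> (carrier G \<rightarrow>\<^sub>E C))"
    using B by (intro closed_Int_compactin closedin_Int)
  moreover have "faces z = (?F \<inter> ?N) \<inter> (carrier G \<rightarrow>\<^sub>E C)"
  proof
    show "faces z \<subseteq> (?F \<inter> ?N) \<inter> (carrier G \<rightarrow>\<^sub>E C)"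
    proof
      fix y assume y: "y \<in> faces z"
      have "y h \<in> C" if "h \<in> carrier G" for h
        using faces_bounds[OF y that] y that by (auto simp: C_def faces_def Maps_iff PiE_iff)
      then show "y \<in> (?F \<inter> ?N) \<inter> (carrier G \<rightarrow>\<^sub>E C)"
        using y unfolding topspace_map_top by (auto simp: faces_def Maps_def PiE_iff)
    qed
    show "(?F \<inter> ?N) \<inter> (carrier G \<rightarrow>\<^sub>E C) \<subseteq> faces z"
    proof
      fix y assume y: "y \<in> (?F \<inter> ?N) \<inter> (carrier G \<rightarrow>\<^sub>E C)"
      then have M: "y \<in> Maps" unfolding topspace_map_top by simp
      have nn: "0 \<le> y h l" if "h \<in> carrier G" for h l
      proof -
        have "y h l \<in> (if l < m then {0..1} else {0})" using y that by (auto simp: C_def PiE_iff)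
        then show ?thesis by (auto split: if_splits)
      qed
      have "(\<Sum>l<m. y (z l) l) = 0" using y by simp
      then have "y (z l) l = 0" if "l < m" for l
        using sum_nonneg_eq_0_iff[of "{..<m}" "\<lambda>l. y (z l) l"] that nn z by auto
      then show "y \<in> faces z" using y M nn by (simp add: faces_def)
    qed
  qed
  ultimately show ?thesis by simp
qed

text \<open>
  The compact invariant set that contains all simplices of the argument.
\<close>

definition kset :: "('a \<Rightarrow> nat \<Rightarrow> real) set" where
  "kset = (\<Union>z\<in>{..<m} \<rightarrow>\<^sub>E carrier G. faces z)"

lemma mem_kset: "y \<in> kset \<longleftrightarrow> (\<exists>z. (\<forall>l<m. z l \<in> carrier G) \<and> y \<in> faces z)"
proof
  assume "\<exists>z. (\<forall>l<m. z l \<in> carrier G) \<and> y \<in> faces z"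
  then obtain z where "\<forall>l<m. z l \<in> carrier G" "y \<in> faces z" by blast
  then have "restrict z {..<m} \<in> {..<m} \<rightarrow>\<^sub>E carrier G" "y \<in> faces (restrict z {..<m})"
    by (auto simp: faces_def)
  then show "y \<in> kset" unfolding kset_def by blast
qed (auto simp: kset_def PiE_iff)

lemma compactin_kset: "compactin map_top kset"
  unfolding kset_def
  by (rule compactin_Union) (use finite_carrier in \<open>auto intro!: finite_PiE compactin_faces simp: PiE_iff\<close>)

lemma kset_Maps: "kset \<subseteq> Maps"
  by (auto simp: kset_def faces_def)

lemma kset_not_constant:
  assumes "y \<in> kset"
  shows "\<not> y constant_on carrier G"
proof
  assume "y constant_on carrier G"
  obtain z where z: "\<forall>l<m. z l \<in> carrier G" "y \<in> faces z"
    using assms mem_kset by blast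
  have "y h l = 0" if "h \<in> carrier G" "l < m" for h l
  proof -
    have "y h = y (z l)"
      using \<open>y constant_on carrier G\<close> that z(1) by (auto simp: constant_on_def)
    then show ?thesis using z(2) that by (simp add: faces_def)
  qed
  then have "(\<Sum>h\<in>carrier G. \<Sum>l<m. y h l) = 0" by simp
  then show False using z(2) by (simp add: faces_def)
qed

lemma pact_faces:
  assumes g: "g \<in> carrier G" and y: "y \<in> faces z" and z: "\<forall>l<m. z l \<in> carrier G"
  shows "pact g y \<in> faces (\<lambda>l. g \<otimes> z l)"
proof -
  have M: "y \<in> Maps" using y by (simp add: faces_def)
  have 1: "pact g y \<in> Maps" using M g by (simp add: pact_Maps_iff)
  have 2: "pact g y (g \<otimes> z l) l = 0" if "l < m" for l
    using that y z g by (simp add: pact_apply[OF M] m_assoc[symmetric] faces_def)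
  have "(\<Sum>h\<in>carrier G. \<Sum>l<m. pact g y h l) = (\<Sum>h\<in>carrier G. \<Sum>l<m. y (inv g \<otimes> h) l)"
    by (simp add: pact_apply[OF M])
  also have "\<dots> = (\<Sum>h\<in>carrier G. \<Sum>l<m. y h l)"
    by (rule sum.reindex_bij_witness[of _ "\<lambda>h. g \<otimes> h" "\<lambda>h. inv g \<otimes> h"])
       (use g in \<open>auto simp: m_assoc[symmetric]\<close>)
  finally have 3: "(\<Sum>h\<in>carrier G. \<Sum>l<m. pact g y h l) = 1"
    using y by (simp add: faces_def)
  show ?thesis
    using 1 2 3 y g by (simp add: faces_def pact_apply[OF M])
qed

lemma pact_kset_iff:
  assumes g: "g \<in> carrier G"
  shows "pact g y \<in> kset \<longleftrightarrow> y \<in> kset"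
proof -
  have imp: "pact h x \<in> kset" if "h \<in> carrier G" "x \<in> kset" for h x
    using that pact_faces[OF that(1)] unfolding mem_kset by (meson m_closed)
  have "pact (inv g) (pact g y) = y"
    using g pact_mult[of "inv g" g y] pact_one by simp
  then show ?thesis using imp g by (metis inv_closed)
qed

end

section \<open>Labels in the universal fixed point free orbit space\<close>

definition piece :: "('g, 'b) monoid_scheme \<Rightarrow> 'x topology \<Rightarrow> ('g \<Rightarrow> 'x \<Rightarrow> 'x) \<Rightarrow> 'x set \<Rightarrow> bool" where
  "piece G X act V \<longleftrightarrow> openin X V \<and> (\<forall>g\<in>carrier G. \<forall>x\<in>V. act g x \<in> V) \<and>
     maps_to_D G (subtopology X V) act"

definition covered :: "('g, 'b) monoid_scheme \<Rightarrow> 'x topology \<Rightarrow> ('g \<Rightarrow> 'x \<Rightarrow> 'x) \<Rightarrow> nat \<Rightarrow> bool" where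
  "covered G X act n \<longleftrightarrow> (\<exists>U :: nat \<Rightarrow> 'x set.
     (\<forall>i\<in>{1..n}. piece G X act (U i)) \<and> (\<Union>i\<in>{1..n}. U i) = topspace X)"

lemma topspace_D: "topspace (D_space G) = {(H, C). subgroup H G \<and> H \<noteq> carrier G \<and> C \<in> lcosets\<^bsub>G\<^esub> H}"
  by (auto simp: D_space_def)

lemma openin_D: "openin (D_space G) W \<longleftrightarrow> W \<subseteq> topspace (D_space G)"
  by (auto simp: D_space_def openin_sum_topology)

lemma (in group) D_action_closed:
  assumes "g \<in> carrier G" "d \<in> topspace (D_space G)"
  shows "D_action G g d \<in> topspace (D_space G)"
proof -
  obtain H C where d: "d = (H, C)" "subgroup H G" "H \<noteq> carrier G" "C \<in> lcosets H"
    using assms(2) by (auto simp: topspace_D)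
  obtain a where a: "a \<in> carrier G" "C = a <# H"
    using d(4) by (auto simp: LCOSETS_def)
  have "g <# C = (g \<otimes> a) <# H"
    using lcos_m_assoc[OF subgroup.subset[OF d(2)] assms(1) a(1)] a(2) by simp
  then have "g <# C \<in> lcosets H"
    using assms(1) a(1) by (auto simp: LCOSETS_def)
  then show ?thesis using d by (simp add: topspace_D D_action_def)
qed

lemma (in group) D_action_laws:
  assumes "d \<in> topspace (D_space G)"
  shows "D_action G \<one> d = d"
    and "g \<in> carrier G \<Longrightarrow> h \<in> carrier G \<Longrightarrow> D_action G (g \<otimes> h) d = D_action G g (D_action G h d)"
proof -
  obtain H C where d: "d = (H, C)" "subgroup H G" "C \<in> lcosets H"
    using assms by (auto simp: topspace_D)
  then have C: "C \<subseteq> carrier G"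
    using subgroup.lcosets_carrier[OF d(2) is_group] by simp
  show "D_action G \<one> d = d"
    using lcos_mult_one[OF C] d(1) by (simp add: D_action_def)
  show "D_action G (g \<otimes> h) d = D_action G g (D_action G h d)" if "g \<in> carrier G" "h \<in> carrier G"
    using lcos_m_assoc[OF C that] d(1) by (simp add: D_action_def)
qed

context elementary_abelian
begin

definition char_of :: "'a set \<Rightarrow> 'a \<Rightarrow> int" where
  "char_of H = (SOME \<kappa>. (\<forall>g\<in>carrier G. \<forall>h\<in>carrier G. int p dvd \<kappa> (g \<otimes> h) - (\<kappa> g + \<kappa> h)) \<and>
    (\<forall>h\<in>H. int p dvd \<kappa> h) \<and> (\<exists>g\<in>carrier G. \<not> int p dvd \<kappa> g))"

lemma char_of:
  assumes "subgroup H G" "H \<noteq> carrier G"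
  shows "\<And>g h. g \<in> carrier G \<Longrightarrow> h \<in> carrier G \<Longrightarrow> int p dvd char_of H (g \<otimes> h) - (char_of H g + char_of H h)"
    and "\<And>h. h \<in> H \<Longrightarrow> int p dvd char_of H h"
    and "\<exists>g\<in>carrier G. \<not> int p dvd char_of H g"
  using someI_ex[OF exists_character[OF assms], folded char_of_def] by blast+

definition D_labels :: "nat \<Rightarrow> (nat \<times> 'a set \<times> 'a set) set" where
  "D_labels M = {1..M} \<times> topspace (D_space G)"

text \<open>
  The identity on triples that are not labels, so that the laws of an action hold for all triples.
\<close>

definition label_action :: "nat \<Rightarrow> 'a \<Rightarrow> nat \<times> 'a set \<times> 'a set \<Rightarrow> nat \<times> 'a set \<times> 'a set" where
  "label_action M g l = (if l \<in> D_labels M then (fst l, D_action G g (snd l)) else l)"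

lemma label_action_closed: "g \<in> carrier G \<Longrightarrow> label_action M g l \<in> D_labels M \<longleftrightarrow> l \<in> D_labels M"
  using D_action_closed by (auto simp: label_action_def D_labels_def)

lemma char_of_coset:
  assumes H: "subgroup H G" "H \<noteq> carrier G" and a: "a \<in> carrier G" and c: "c \<in> a <# H"
  shows "int p dvd char_of H c - char_of H a"
proof -
  obtain h where h: "h \<in> H" "c = a \<otimes> h" using c by (auto simp: l_coset_def)
  then have "h \<in> carrier G" using H(1) subgroup.subset by blast
  then have "int p dvd (char_of H c - (char_of H a + char_of H h)) + char_of H h"
    using char_of(1)[OF H a, of h] char_of(2)[OF H h(1)] h(2) by (intro dvd_add) auto
  then show ?thesis by simp
qed

text \<open>
  A coset of \<open>H\<close> gets as coordinate the value of a character that vanishes on \<open>H\<close> at any representative;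
  modulo \<open>p\<close> the choice of the representative does not matter.
\<close>

lemma labels_D:
  "labels G p (label_action M) generic (D_labels M) (\<lambda>l. fst l - 1)
     (\<lambda>l. char_of (fst (snd l)) (SOME c. c \<in> snd (snd l))) (\<lambda>l. char_of (fst (snd l))) M"
proof unfold_locales
  fix l
  show "label_action M \<one> l = l"
    by (auto simp: label_action_def D_labels_def D_action_laws(1))
  fix g assume g: "g \<in> carrier G"
  show "label_action M g l \<in> D_labels M \<longleftrightarrow> l \<in> D_labels M"
    by (rule label_action_closed[OF g])
  show "fst (label_action M g l) - 1 = fst l - 1"
    by (simp add: label_action_def)
  show "char_of (fst (snd (label_action M g l))) = char_of (fst (snd l))"
    by (simp add: label_action_def D_action_def split_beta)
  fix h assume h: "h \<in> carrier G"
  show "label_action M (g \<otimes> h) l = label_action M g (label_action M h l)"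
  proof (cases "l \<in> D_labels M")
    case True
    then have "(fst l, D_action G h (snd l)) \<in> D_labels M"
      using label_action_closed[OF h, of M l] by (simp add: label_action_def)
    then show ?thesis
      using True g h D_action_laws(2)[of "snd l" g h] by (auto simp: label_action_def D_labels_def)
  qed (simp add: label_action_def)
next
  show "(\<Sum>g\<in>carrier G. generic g) = 0" by (rule sum_generic)
next
  have "topspace (D_space G) \<subseteq> Pow (carrier G) \<times> Pow (carrier G)"
    using subgroup.subset subgroup.lcosets_carrier[OF _ is_group] by (fastforce simp: topspace_D)
  then have "finite (topspace (D_space G))"
    by (rule finite_subset) (simp add: finite_carrier)
  then show "finite (D_labels M)" by (simp add: D_labels_def)
next
  fix l assume l: "l \<in> D_labels M"
  then show "fst l - 1 < M" by (auto simp: D_labels_def)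
  obtain i H C where lHC: "l = (i, H, C)" by (metis prod.collapse)
  have H: "subgroup H G" "H \<noteq> carrier G" "C \<in> lcosets H"
    using l by (auto simp: lHC D_labels_def topspace_D)
  obtain a where a: "a \<in> carrier G" "C = a <# H" using H(3) by (auto simp: LCOSETS_def)
  obtain g where g: "g \<in> carrier G" "\<not> int p dvd char_of H g" using char_of(3)[OF H(1,2)] by blast
  show "\<not> of_nat p dvd (\<Sum>g\<in>carrier G. (generic g * of_int (char_of (fst (snd l)) g)) ^ p)"
    unfolding lHC fst_conv snd_conv by (rule norm_generic[OF char_of(1)[OF H(1,2)] g])
  fix g assume g: "g \<in> carrier G"
  have some: "int p dvd char_of H (SOME c. c \<in> b <# H) - char_of H b" if "b \<in> carrier G" for b
  proof (rule char_of_coset[OF H(1,2) that])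
    have "b \<otimes> \<one> \<in> b <# H" using subgroup.one_closed[OF H(1)] by (auto simp: l_coset_def)
    then show "(SOME c. c \<in> b <# H) \<in> b <# H" by (rule someI)
  qed
  have gC: "g <# C = (g \<otimes> a) <# H"
    using lcos_m_assoc[OF subgroup.subset[OF H(1)] g a(1)] a(2) by simp
  have "int p dvd (char_of H (SOME c. c \<in> g <# C) - char_of H (g \<otimes> a))
      + (char_of H (g \<otimes> a) - (char_of H g + char_of H a))
      - (char_of H (SOME c. c \<in> C) - char_of H a)"
    unfolding gC
    by (rule dvd_diff[OF dvd_add[OF some[OF m_closed[OF g a(1)]] char_of(1)[OF H(1,2) g a(1)]]
          some[OF a(1), folded a(2)]])
  then show "int p dvd char_of (fst (snd (label_action M g l))) (SOME c. c \<in> snd (snd (label_action M g l)))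
      - (char_of (fst (snd l)) (SOME c. c \<in> snd (snd l)) + char_of (fst (snd l)) g)"
    using l by (simp add: lHC label_action_def D_action_def algebra_simps)
next
  show "prime_elem (of_nat p :: int poly)" by (rule prime_elem_p_poly)
qed

end

section \<open>Lower bound for the sphere\<close>

context point_space
begin

abbreviation sphere_top :: "('a \<Rightarrow> nat \<Rightarrow> real) topology" where
  "sphere_top \<equiv> V_space (carrier G) m (card (carrier G))"

lemma topspace_sphere: "topspace sphere_top = {y \<in> Maps. \<not> y constant_on carrier G}"
proof -
  have "y \<in> diagonal (carrier G) (card (carrier G)) (Euclidean_space m) \<longleftrightarrow> y constant_on carrier G"
    if "y \<in> Maps" for y
  proof
    assume "y \<in> diagonal (carrier G) (card (carrier G)) (Euclidean_space m)"
    then obtain J where "J \<subseteq> carrier G" "card J = card (carrier G)" "y constant_on J"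
      by (auto simp: diagonal_def)
    then show "y constant_on carrier G"
      using card_subset_eq[OF finite_carrier] by blast
  next
    assume "y constant_on carrier G"
    then show "y \<in> diagonal (carrier G) (card (carrier G)) (Euclidean_space m)"
      using that by (auto simp: diagonal_def Maps_def)
  qed
  then show ?thesis
    by (auto simp: V_space_def Maps_def)
qed

lemma kset_sphere: "kset \<subseteq> topspace sphere_top"
  using kset_Maps kset_not_constant by (auto simp: topspace_sphere)

lemma sphere_openin_box:
  assumes "openin sphere_top W" "y \<in> W"
  shows "\<exists>e>0. \<forall>x\<in>topspace sphere_top. (\<forall>h\<in>carrier G. \<forall>l. \<bar>x h l - y h l\<bar> < e) \<longrightarrow> x \<in> W"
proof -
  obtain T where T: "openin map_top T" "W = T \<inter> ((carrier G \<rightarrow>\<^sub>E topspace (Euclidean_space m))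
        - diagonal (carrier G) (card (carrier G)) (Euclidean_space m))"
    using assms(1) by (auto simp: V_space_def openin_subtopology)
  obtain e where "e > 0" "\<forall>x\<in>Maps. (\<forall>h\<in>carrier G. \<forall>l. \<bar>x h l - y h l\<bar> < e) \<longrightarrow> x \<in> T"
    using power_box[OF finite_carrier T(1), of y] assms(2) T(2) by (auto simp: Maps_def)
  moreover have "topspace sphere_top = Maps - diagonal (carrier G) (card (carrier G)) (Euclidean_space m)"
    by (auto simp: V_space_def Maps_def)
  ultimately show ?thesis using T(2) by (auto simp: Maps_def)
qed

lemma lebesgue_number:
  assumes cover: "\<And>y. y \<in> kset \<Longrightarrow> \<exists>W\<in>\<W>. openin sphere_top W \<and> y \<in> W"
  shows "\<exists>e>0. \<forall>y\<in>kset. \<exists>W\<in>\<W>. \<forall>x\<in>topspace sphere_top.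
    (\<forall>h\<in>carrier G. \<forall>l. \<bar>x h l - y h l\<bar> \<le> e) \<longrightarrow> x \<in> W"
proof -
  define inside where "inside y e \<longleftrightarrow> e > 0 \<and> (\<exists>W\<in>\<W>. \<forall>x\<in>topspace sphere_top.
      (\<forall>h\<in>carrier G. \<forall>l. \<bar>x h l - y h l\<bar> < e) \<longrightarrow> x \<in> W)" for y e
  have "\<exists>e. inside y e" if y: "y \<in> kset" for y
  proof -
    obtain W where W: "W \<in> \<W>" "openin sphere_top W" "y \<in> W" using cover[OF y] by blast
    show ?thesis using sphere_openin_box[OF W(2,3)] W(1) unfolding inside_def by blast
  qed
  then have "\<forall>y\<in>kset. \<exists>e. inside y e" by blast
  from bchoice[OF this] obtain e where in_e: "\<And>y. y \<in> kset \<Longrightarrow> inside y (e y)" by blast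
  then have e: "\<And>y. y \<in> kset \<Longrightarrow> e y > 0" by (simp add: inside_def)
  define B where "B y = {x \<in> topspace map_top. \<forall>h\<in>carrier G. \<forall>l\<in>{..<m}. \<bar>x h l - y h l\<bar> < e y / 2}" for y
  have "kset \<subseteq> \<Union>(B ` kset)"
  proof
    fix y assume y: "y \<in> kset"
    then have "y \<in> B y" using e[OF y] kset_Maps unfolding B_def topspace_map_top by auto
    then show "y \<in> \<Union>(B ` kset)" using y by blast
  qed
  moreover have "\<forall>U\<in>B ` kset. openin map_top U"
    unfolding B_def using openin_power_box[OF finite_carrier] by blast
  ultimately obtain F where F: "finite F" "F \<subseteq> B ` kset" "kset \<subseteq> \<Union>F"
    using compactin_kset[unfolded compactin_def, THEN conjunct2, rule_format, of "B ` kset"] by blast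
  obtain Y where Y: "finite Y" "Y \<subseteq> kset" "F = B ` Y"
    using finite_subset_image[OF F(1,2)] by blast
  \<comment> \<open>half of the box size is used for the covering, a quarter as the Lebesgue number\<close>
  let ?e = "Min (insert 1 ((\<lambda>y. e y / 4) ` Y))"
  have "?e > 0" using Y(1,2) e by (auto simp: subset_iff)
  moreover have "\<exists>W\<in>\<W>. \<forall>x\<in>topspace sphere_top. (\<forall>h\<in>carrier G. \<forall>l. \<bar>x h l - y h l\<bar> \<le> ?e) \<longrightarrow> x \<in> W"
    if y: "y \<in> kset" for y
  proof -
    obtain c where c: "c \<in> Y" "y \<in> B c" using F(3) Y(3) y by auto
    obtain W where W: "W \<in> \<W>" "\<forall>x\<in>topspace sphere_top.
         (\<forall>h\<in>carrier G. \<forall>l. \<bar>x h l - c h l\<bar> < e c) \<longrightarrow> x \<in> W"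
      using in_e[of c] c(1) Y(2) unfolding inside_def by blast
    have ec: "e c > 0" using e c(1) Y(2) by blast
    have le: "?e \<le> e c / 4" using c(1) Y(1) by (intro Min_le) auto
    have "x \<in> W" if x: "x \<in> topspace sphere_top" "\<forall>h\<in>carrier G. \<forall>l. \<bar>x h l - y h l\<bar> \<le> ?e" for x
    proof (rule W(2)[rule_format, OF x(1)])
      fix h l assume h: "h \<in> carrier G"
      have cy: "\<bar>y h l - c h l\<bar> < e c / 2"
      proof (cases "l < m")
        case True
        then show ?thesis using c(2) h by (simp add: B_def)
      next
        case False
        then have "y h l = 0" "c h l = 0"
          using y c(1) Y(2) kset_Maps h by (auto simp: Maps_iff subset_iff)
        then show ?thesis using ec by simp
      qed
      have "\<bar>x h l - y h l\<bar> \<le> e c / 4" using x(2) h le by (meson order_trans)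
      then show "\<bar>x h l - c h l\<bar> < e c" using cy ec by linarith
    qed
    then show ?thesis using W(1) by blast
  qed
  ultimately show ?thesis by blast
qed

text \<open>
  A Borsuk-Ulam theorem for \<open>p\<close>-tori.  By the Lebesgue number lemma there is a box size such that every point of
  \<open>kset\<close> has an index \<open>i\<close> for which the box around the point lies in the \<open>i\<close>-th set and is mapped to one point of
  \<open>D\<close>.  The least such index, together with this point of \<open>D\<close>, is an equivariant label, and labels of equal rank
  at distance less than the box size agree.
\<close>

theorem sphere_not_covered:
  assumes cov: "covered G sphere_top (map_action G) M"
  shows "m * (card (carrier G) - 1) \<le> M"
proof (rule ccontr)
  assume "\<not> m * (card (carrier G) - 1) \<le> M"
  then have M: "M < m * (card (carrier G) - 1)" by simp
  obtain U where U: "\<And>i. i \<in> {1..M} \<Longrightarrow> openin sphere_top (U i)"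
      "\<And>i g x. i \<in> {1..M} \<Longrightarrow> g \<in> carrier G \<Longrightarrow> x \<in> U i \<Longrightarrow> map_action G g x \<in> U i"
      "\<And>i. i \<in> {1..M} \<Longrightarrow> maps_to_D G (subtopology sphere_top (U i)) (map_action G)"
      "(\<Union>i\<in>{1..M}. U i) = topspace sphere_top"
    using cov unfolding covered_def piece_def by blast
  have top_U: "topspace (subtopology sphere_top (U i)) = U i" if "i \<in> {1..M}" for i
    using openin_subset[OF U(1)[OF that]] by auto
  define eqv where "eqv i f \<longleftrightarrow> continuous_map (subtopology sphere_top (U i)) (D_space G) f \<and>
      (\<forall>g\<in>carrier G. \<forall>x\<in>U i. f (map_action G g x) = D_action G g (f x))" for i f
  have "\<forall>i\<in>{1..M}. \<exists>f. eqv i f"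
  proof
    fix i assume i: "i \<in> {1..M}"
    show "\<exists>f. eqv i f" using U(3)[OF i] unfolding maps_to_D_def top_U[OF i] eqv_def .
  qed
  from bchoice[OF this] obtain f where eqv: "\<And>i. i \<in> {1..M} \<Longrightarrow> eqv i (f i)" by blast
  have f: "\<And>i. i \<in> {1..M} \<Longrightarrow> continuous_map (subtopology sphere_top (U i)) (D_space G) (f i)"
      "\<And>i g x. i \<in> {1..M} \<Longrightarrow> g \<in> carrier G \<Longrightarrow> x \<in> U i \<Longrightarrow> f i (map_action G g x) = D_action G g (f i x)"
    using eqv by (auto simp: eqv_def)
  have f_D: "f i x \<in> topspace (D_space G)" if "i \<in> {1..M}" "x \<in> U i" for i x
    using continuous_map_funspace[OF f(1)[OF that(1)]] top_U[OF that(1)] that(2) by auto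
  define W where "W i d = {x \<in> U i. f i x = d}" for i d
  have open_W: "openin sphere_top (W i d)" if i: "i \<in> {1..M}" for i d
  proof -
    have "openin (D_space G) ({d} \<inter> topspace (D_space G))" by (simp add: openin_D)
    from openin_continuous_map_preimage[OF f(1)[OF i] this]
    have "openin (subtopology sphere_top (U i)) {x \<in> U i. f i x \<in> {d} \<inter> topspace (D_space G)}"
      by (simp only: top_U[OF i])
    moreover have "{x \<in> U i. f i x \<in> {d} \<inter> topspace (D_space G)} = W i d"
      using f_D[OF i] by (auto simp: W_def)
    ultimately show ?thesis
      using openin_open_subtopology[OF U(1)[OF i]] by simp
  qed
  let ?\<W> = "(\<lambda>(i, d). W i d) ` ({1..M} \<times> UNIV)"
  have "\<exists>W\<in>?\<W>. openin sphere_top W \<and> y \<in> W" if "y \<in> kset" for y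
  proof -
    have "y \<in> (\<Union>i\<in>{1..M}. U i)" unfolding U(4) using that kset_sphere by (rule subsetD[rotated])
    then obtain i where i: "i \<in> {1..M}" "y \<in> U i" by (rule UN_E)
    then have "y \<in> W i (f i y)" by (simp add: W_def)
    with open_W[OF i(1)] have "openin sphere_top (W i (f i y)) \<and> y \<in> W i (f i y)" by (rule conjI)
    then show ?thesis
      by (rule bexI) (use i(1) in \<open>simp add: image_eqI[of _ _ "(i, f i y)"]\<close>)
  qed
  then have "\<exists>e>0. \<forall>y\<in>kset. \<exists>W\<in>?\<W>. \<forall>x\<in>topspace sphere_top.
      (\<forall>h\<in>carrier G. \<forall>l. \<bar>x h l - y h l\<bar> \<le> e) \<longrightarrow> x \<in> W"
    by (rule lebesgue_number)
  then obtain e where e: "e > 0" and near_W: "\<forall>y\<in>kset. \<exists>W\<in>?\<W>. \<forall>x\<in>topspace sphere_top.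
      (\<forall>h\<in>carrier G. \<forall>l. \<bar>x h l - y h l\<bar> \<le> e) \<longrightarrow> x \<in> W"
    by (elim exE conjE)
  define good where "good i y \<longleftrightarrow> i \<in> {1..M} \<and> (\<exists>d. \<forall>x\<in>topspace sphere_top.
      (\<forall>h\<in>carrier G. \<forall>l. \<bar>x h l - y h l\<bar> \<le> e) \<longrightarrow> x \<in> W i d)" for i y
  have ex_good: "\<exists>i. good i y" if "y \<in> kset" for y
  proof -
    from bspec[OF near_W that] obtain W' where "W' \<in> ?\<W>"
      and W': "\<forall>x\<in>topspace sphere_top. (\<forall>h\<in>carrier G. \<forall>l. \<bar>x h l - y h l\<bar> \<le> e) \<longrightarrow> x \<in> W'"
      by (rule bexE)
    then obtain i d where "i \<in> {1..M}" "W' = W i d" by auto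
    then have "good i y" using W' unfolding good_def by blast
    then show ?thesis by (rule exI)
  qed
  have good_self: "y \<in> U i" if "good i y" "y \<in> kset" for i y
    using that e kset_sphere by (auto simp: good_def W_def subset_iff)
  have good_act: "good i (map_action G g y)" if gd: "good i y" and y: "y \<in> kset" and g: "g \<in> carrier G" for i g y
  proof -
    obtain d where d: "i \<in> {1..M}" "\<forall>x\<in>topspace sphere_top.
        (\<forall>h\<in>carrier G. \<forall>l. \<bar>x h l - y h l\<bar> \<le> e) \<longrightarrow> x \<in> W i d"
      using gd by (auto simp: good_def)
    have "x \<in> W i (D_action G g d)"
      if x: "x \<in> topspace sphere_top" "\<forall>h\<in>carrier G. \<forall>l. \<bar>x h l - map_action G g y h l\<bar> \<le> e" for x
    proof -
      let ?x = "map_action G (inv g) x"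
      have xM: "x \<in> Maps" using x(1) by (simp add: topspace_sphere)
      have return: "map_action G g ?x = x"
        using g map_action_mult[OF is_group g, of "inv g" x] map_action_one[OF is_group, of x] xM
        by (simp add: Maps_iff)
      have "\<not> ?x constant_on carrier G"
      proof
        assume "?x constant_on carrier G"
        then have "map_action G g ?x constant_on carrier G"
          using g by (auto simp: constant_on_def map_action_def)
        then show False using return x(1) by (simp add: topspace_sphere)
      qed
      then have "?x \<in> topspace sphere_top"
        using xM g by (simp add: topspace_sphere map_action_Maps)
      moreover have "\<bar>?x h l - y h l\<bar> \<le> e" if h: "h \<in> carrier G" for h l
        using x(2)[rule_format, of "g \<otimes> h" l] g h by (simp add: map_action_def m_assoc[symmetric])
      ultimately have "?x \<in> W i d" using d(2) by blast
      then have "?x \<in> U i" "f i ?x = d" by (auto simp: W_def)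
      then show ?thesis
        using U(2)[OF d(1) g, of ?x] f(2)[OF d(1) g, of ?x] return by (simp add: W_def)
    qed
    then show ?thesis using d(1) unfolding good_def by blast
  qed
  have pact_eq: "pact g y = map_action G g y" if "y \<in> kset" for g y
    using that kset_Maps by (auto simp: pact_def)
  define num where "num y = (LEAST i. good i y)" for y
  have good_num: "good (num y) y" if "y \<in> kset" for y
    unfolding num_def using ex_good[OF that] by (rule LeastI_ex)
  have num_act: "num (map_action G g y) = num y" if y: "y \<in> kset" and g: "g \<in> carrier G" for g y
  proof -
    have "good i (map_action G g y) \<longleftrightarrow> good i y" for i
    proof
      have ky: "map_action G g y \<in> kset"
        using pact_kset_iff[OF g, of y] pact_eq[OF y] y by simp
      have "map_action G (inv g) (map_action G g y) = y"
        using g map_action_mult[OF is_group _ g, of "inv g" y] map_action_one[OF is_group, of y] y kset_Maps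
        by (auto simp: Maps_iff)
      then show "good i y" if "good i (map_action G g y)"
        using good_act[OF that ky, of "inv g"] g by simp
    qed (rule good_act[OF _ y g])
    then show ?thesis by (simp add: num_def)
  qed
  define lab where "lab y = (if y \<in> kset then (num y, f (num y) y) else (0, {}, {}))" for y
  show False
  proof (rule no_small_labelling[OF labels_D[of M], of lab])
    fix g y assume g: "g \<in> carrier G"
    show "lab (pact g y) = label_action M g (lab y)"
    proof (cases "y \<in> kset")
      case True
      have i: "num y \<in> {1..M}" using good_num[OF True] by (simp add: good_def)
      have yU: "y \<in> U (num y)" using good_self[OF good_num[OF True] True] .
      have "(num y, f (num y) y) \<in> D_labels M"
        using i f_D[OF i yU] by (simp add: D_labels_def)
      then show ?thesis
        using True pact_kset_iff[OF g, of y] num_act[OF True g] f(2)[OF i g yU]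
        by (simp add: lab_def pact_eq[OF True] label_action_def)
    next
      case False
      then show ?thesis
        using pact_kset_iff[OF g, of y] by (simp add: lab_def label_action_def D_labels_def)
    qed
  next
    fix z y assume "\<And>l. l < m \<Longrightarrow> z l \<in> carrier G" "y \<in> faces z"
    then have y: "y \<in> kset" by (auto simp: mem_kset)
    then show "lab y \<in> D_labels M"
      using good_num[OF y] good_self[OF good_num[OF y] y] f_D[of "num y" y]
      by (simp add: lab_def D_labels_def good_def)
  next
    fix z x y assume z: "\<And>l. l < m \<Longrightarrow> z l \<in> carrier G" and xy: "x \<in> faces z" "y \<in> faces z"
      and near: "\<And>h l. h \<in> carrier G \<Longrightarrow> \<bar>x h l - y h l\<bar> \<le> e"
      and rank: "fst (lab x) - 1 = fst (lab y) - 1"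
    have k: "x \<in> kset" "y \<in> kset" using z xy by (auto simp: mem_kset)
    have "num x \<in> {1..M}" "num y \<in> {1..M}" using good_num k by (auto simp: good_def)
    then have eq: "num x = num y" using rank k by (auto simp: lab_def)
    obtain d where d: "\<forall>x\<in>topspace sphere_top.
        (\<forall>h\<in>carrier G. \<forall>l. \<bar>x h l - y h l\<bar> \<le> e) \<longrightarrow> x \<in> W (num y) d"
      using good_num[OF k(2)] by (auto simp: good_def)
    have "x \<in> W (num y) d" "y \<in> W (num y) d"
      using d near kset_sphere k e by (auto simp: subset_iff)
    then show "lab x = lab y" using k eq by (simp add: lab_def W_def)
  qed (use e M in auto)
qed

end


section \<open>Calculus of covers\<close>

lemma genus_eqI:
  assumes "covered G X act n" "\<And>n'. covered G X act n' \<Longrightarrow> n \<le> n'"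
  shows "genus G X act = enat n"
proof -
  have "genus G X act = Inf {enat n | n. covered G X act n}"
    by (simp add: genus_def covered_def piece_def)
  also have "\<dots> = enat n"
    by (rule antisym; (rule Inf_lower | rule Inf_greatest)) (use assms in auto)
  finally show ?thesis .
qed

lemma covered_family:
  assumes "finite I" "\<And>i. i \<in> I \<Longrightarrow> piece G X act (V i)" "topspace X \<subseteq> (\<Union>i\<in>I. V i)"
  shows "covered G X act (card I)"
proof -
  obtain b where b: "bij_betw b {1..card I} I"
    using ex_bij_betw_nat_finite_1[OF assms(1)] by blast
  have sub: "(\<Union>i\<in>I. V i) \<subseteq> topspace X"
    by (rule UN_least, rule openin_subset) (use assms(2) in \<open>simp add: piece_def\<close>)
  show ?thesis
    unfolding covered_def
  proof (intro exI[of _ "\<lambda>i. V (b i)"] conjI ballI)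
    show "piece G X act (V (b i))" if "i \<in> {1..card I}" for i
      using bij_betw_apply[OF b that] by (rule assms(2))
    have "(\<lambda>i. V (b i)) ` {1..card I} = V ` I"
      by (simp only: image_image[symmetric] bij_betw_imp_surj_on[OF b])
    then have "(\<Union>i\<in>{1..card I}. V (b i)) = (\<Union>i\<in>I. V i)" by (simp only:)
    then show "(\<Union>i\<in>{1..card I}. V (b i)) = topspace X"
      using subset_antisym[OF sub assms(3)] by (simp only:)
  qed
qed

lemma covered_pullback:
  assumes cont: "continuous_map X Y \<phi>"
    and act: "\<And>g x. g \<in> carrier G \<Longrightarrow> x \<in> topspace X \<Longrightarrow> act g x \<in> topspace X"
    and equiv: "\<And>g x. g \<in> carrier G \<Longrightarrow> x \<in> topspace X \<Longrightarrow> \<phi> (act g x) = act' g (\<phi> x)"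
    and cov: "covered G Y act' n"
  shows "covered G X act n"
proof -
  obtain U where U: "\<And>i. i \<in> {1..n} \<Longrightarrow> piece G Y act' (U i)" "(\<Union>i\<in>{1..n}. U i) = topspace Y"
    using cov unfolding covered_def by blast
  define V where "V i = {x \<in> topspace X. \<phi> x \<in> U i}" for i
  have "piece G X act (V i)" if i: "i \<in> {1..n}" for i
  proof -
    have o: "openin Y (U i)" and inv: "\<And>g y. g \<in> carrier G \<Longrightarrow> y \<in> U i \<Longrightarrow> act' g y \<in> U i"
      and D: "maps_to_D G (subtopology Y (U i)) act'"
      using U(1)[OF i] by (auto simp: piece_def)
    have topU: "topspace (subtopology Y (U i)) = U i" using openin_subset[OF o] by (simp add: inf.absorb2)
    have topV: "topspace (subtopology X (V i)) = V i" by (auto simp: V_def)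
    obtain f where f: "continuous_map (subtopology Y (U i)) (D_space G) f"
      "\<And>g y. g \<in> carrier G \<Longrightarrow> y \<in> U i \<Longrightarrow> f (act' g y) = D_action G g (f y)"
      using D unfolding maps_to_D_def topU by blast
    have "continuous_map (subtopology X (V i)) (subtopology Y (U i)) \<phi>"
      unfolding continuous_map_in_subtopology
      using continuous_map_from_subtopology[OF cont] by (auto simp: V_def)
    then have "continuous_map (subtopology X (V i)) (D_space G) (f \<circ> \<phi>)"
      using f(1) by (rule continuous_map_compose)
    moreover have "(f \<circ> \<phi>) (act g x) = D_action G g ((f \<circ> \<phi>) x)" if "g \<in> carrier G" "x \<in> V i" for g x
      using that f(2)[OF that(1), of "\<phi> x"] equiv[OF that(1), of x] by (simp add: V_def)
    ultimately have "maps_to_D G (subtopology X (V i)) act"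
      unfolding maps_to_D_def topV by blast
    moreover have "openin X (V i)"
      unfolding V_def by (rule openin_continuous_map_preimage[OF cont o])
    moreover have "act g x \<in> V i" if "g \<in> carrier G" "x \<in> V i" for g x
      using that act inv equiv by (simp add: V_def)
    ultimately show ?thesis by (simp add: piece_def)
  qed
  moreover have "(\<Union>i\<in>{1..n}. V i) = topspace X"
  proof (rule subset_antisym)
    show "topspace X \<subseteq> (\<Union>i\<in>{1..n}. V i)"
    proof
      fix x assume x: "x \<in> topspace X"
      then have "\<phi> x \<in> (\<Union>i\<in>{1..n}. U i)"
        unfolding U(2) using continuous_map_funspace[OF cont] by (simp add: Pi_iff)
      then show "x \<in> (\<Union>i\<in>{1..n}. V i)" using x by (simp add: V_def)
    qed
  qed (auto simp: V_def)
  ultimately show ?thesis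
    unfolding covered_def by (intro exI[of _ V] conjI ballI)
qed

lemma covered_union:
  assumes X': "openin S X'" and cov: "covered G (subtopology S X') act n"
    and fin: "finite I" and V: "\<And>i. i \<in> I \<Longrightarrow> piece G S act (V i)"
    and all: "topspace S \<subseteq> X' \<union> (\<Union>i\<in>I. V i)"
  shows "covered G S act (n + card I)"
proof -
  obtain U where U: "\<And>i. i \<in> {1..n} \<Longrightarrow> piece G (subtopology S X') act (U i)"
      "(\<Union>i\<in>{1..n}. U i) = topspace (subtopology S X')"
    using cov unfolding covered_def by blast
  have pU: "piece G S act (U i)" if i: "i \<in> {1..n}" for i
  proof -
    have o: "openin S (U i)" "U i \<subseteq> X'"
      using U(1)[OF i] unfolding piece_def openin_open_subtopology[OF X'] by simp_all
    then have "subtopology (subtopology S X') (U i) = subtopology S (U i)"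
      by (simp add: subtopology_subtopology inf.absorb2)
    then show ?thesis using U(1)[OF i] o(1) by (simp add: piece_def)
  qed
  have "covered G S act (card ({1..n} <+> I))"
  proof (rule covered_family[where V = "\<lambda>i. case i of Inl j \<Rightarrow> U j | Inr j \<Rightarrow> V j"])
    show "finite ({1..n} <+> I)" using fin by simp
    show "piece G S act (case i of Inl j \<Rightarrow> U j | Inr j \<Rightarrow> V j)" if "i \<in> {1..n} <+> I" for i
      using that by (rule PlusE) (simp_all add: pU V)
    show "topspace S \<subseteq> (\<Union>i\<in>{1..n} <+> I. case i of Inl j \<Rightarrow> U j | Inr j \<Rightarrow> V j)"
    proof
      fix x assume "x \<in> topspace S"
      then consider "x \<in> X'" | "x \<in> (\<Union>i\<in>I. V i)" using all by blast
      then show "x \<in> (\<Union>i\<in>{1..n} <+> I. case i of Inl j \<Rightarrow> U j | Inr j \<Rightarrow> V j)"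
      proof cases
        case 1
        then have "x \<in> (\<Union>i\<in>{1..n}. U i)" using U(2) openin_subset[OF X'] by simp blast
        then obtain i where "i \<in> {1..n}" "x \<in> U i" by (rule UN_E)
        then show ?thesis by (intro UN_I[of "Inl i"] InlI) simp_all
      next
        case 2
        then obtain i where "i \<in> I" "x \<in> V i" by (rule UN_E)
        then show ?thesis by (intro UN_I[of "Inr i"] InrI) simp_all
      qed
    qed
  qed
  then show ?thesis using fin by (simp add: card_Plus)
qed

section \<open>Equivariant maps to proper nonempty subsets\<close>

lemma (in group) l_coset_mem:
  assumes "g \<in> carrier G" "B \<subseteq> carrier G" "h \<in> carrier G"
  shows "h \<in> g <# B \<longleftrightarrow> inv g \<otimes> h \<in> B"
proof
  assume "h \<in> g <# B"
  then obtain b where "b \<in> B" "h = g \<otimes> b" by (auto simp: l_coset_def)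
  then show "inv g \<otimes> h \<in> B" using assms by (auto simp: m_assoc[symmetric] subset_iff)
next
  assume b: "inv g \<otimes> h \<in> B"
  have "h = g \<otimes> (inv g \<otimes> h)" using assms by (simp add: m_assoc[symmetric])
  then show "h \<in> g <# B" using b unfolding l_coset_def by blast
qed

text \<open>
  No proper nonempty subset is fixed by all translations.  After the choice of a representative \<open>R\<close> in each
  orbit of subsets, a subset \<open>B\<close> corresponds to the coset of all \<open>g\<close> with \<open>g R = B\<close> of the stabilizer of \<open>R\<close>.
\<close>

lemma (in group) maps_to_D_if_subsets:
  assumes sub: "\<And>x. x \<in> topspace X \<Longrightarrow> A x \<subseteq> carrier G \<and> A x \<noteq> {} \<and> A x \<noteq> carrier G"
    and equiv: "\<And>g x. g \<in> carrier G \<Longrightarrow> x \<in> topspace X \<Longrightarrow> A (act g x) = g <# A x"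
    and loc: "\<And>B. openin X {x \<in> topspace X. A x = B}"
  shows "maps_to_D G X act"
proof -
  define orb where "orb B = (\<lambda>g. g <# B) ` carrier G" for B
  define rep where "rep B = (SOME R. R \<in> orb B)" for B
  define stb where "stb R = {g \<in> carrier G. g <# R = R}" for R
  define mov where "mov B = {g \<in> carrier G. g <# rep B = B}" for B
  have orb_eq: "orb (g <# B) = orb B" if g: "g \<in> carrier G" and B: "B \<subseteq> carrier G" for g B
  proof
    show "orb (g <# B) \<subseteq> orb B"
      using g by (auto simp: orb_def lcos_m_assoc[OF B])
    show "orb B \<subseteq> orb (g <# B)"
    proof
      fix R assume "R \<in> orb B"
      then obtain h where h: "h \<in> carrier G" "R = h <# B" by (auto simp: orb_def)
      then have "R = (h \<otimes> inv g) <# (g <# B)"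
        using g by (simp add: lcos_m_assoc[OF B] m_assoc)
      then show "R \<in> orb (g <# B)" using h(1) g by (auto simp: orb_def)
    qed
  qed
  have rep_act: "rep (g <# B) = rep B" if "g \<in> carrier G" "B \<subseteq> carrier G" for g B
    using orb_eq[OF that] by (simp add: rep_def)
  have rep: "\<exists>h\<in>carrier G. rep B = h <# B" for B
  proof -
    have "\<one> <# B \<in> orb B" by (auto simp: orb_def)
    then have "rep B \<in> orb B" unfolding rep_def by (rule someI)
    then show ?thesis by (auto simp: orb_def)
  qed
  have in_D: "(stb (rep B), mov B) \<in> topspace (D_space G)"
    if B: "B \<subseteq> carrier G" "B \<noteq> {}" "B \<noteq> carrier G" for B
  proof -
    obtain h where h: "h \<in> carrier G" "rep B = h <# B" using rep by blast
    have R: "rep B \<subseteq> carrier G" using h B(1) by (simp add: l_coset_subset_G)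
    have rep_back: "inv h <# rep B = B"
      using h B(1) by (simp add: lcos_m_assoc lcos_mult_one)
    have sg: "subgroup (stb (rep B)) G"
    proof (rule subgroupI)
      show "stb (rep B) \<noteq> {}" using lcos_mult_one[OF R] by (auto simp: stb_def)
      show "inv a \<in> stb (rep B)" if "a \<in> stb (rep B)" for a
      proof -
        have a: "a \<in> carrier G" "a <# rep B = rep B" using that by (auto simp: stb_def)
        have "inv a <# (a <# rep B) = rep B"
          using a(1) R by (simp add: lcos_m_assoc lcos_mult_one)
        then show ?thesis using a by (simp add: stb_def)
      qed
      show "a \<otimes> b \<in> stb (rep B)" if "a \<in> stb (rep B)" "b \<in> stb (rep B)" for a b
        using that lcos_m_assoc[OF R, of a b] by (simp add: stb_def)
    qed (auto simp: stb_def)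
    moreover have "stb (rep B) \<noteq> carrier G"
    proof
      assume all: "stb (rep B) = carrier G"
      obtain b where b: "b \<in> B" "b \<in> carrier G" using B(1,2) by blast
      have hb: "h \<otimes> b \<in> rep B" using h b by (auto simp: l_coset_def)
      have "c \<in> B" if c: "c \<in> carrier G" for c
      proof -
        let ?g = "h \<otimes> c \<otimes> inv (h \<otimes> b)"
        have "?g \<otimes> (h \<otimes> b) \<in> ?g <# rep B" using hb unfolding l_coset_def by blast
        moreover have "?g <# rep B = rep B" using all h c b by (auto simp: stb_def)
        moreover have "?g \<otimes> (h \<otimes> b) = h \<otimes> c" using h c b by (simp add: m_assoc)
        ultimately have "h \<otimes> c \<in> h <# B" using h(2) by simp
        then show ?thesis using l_coset_mem[OF h(1) B(1), of "h \<otimes> c"] h(1) c by (simp add: m_assoc[symmetric])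
      qed
      then show False using B by blast
    qed
    moreover have "mov B = inv h <# stb (rep B)"
    proof -
      have "a \<in> mov B \<longleftrightarrow> a \<in> inv h <# stb (rep B)" if a: "a \<in> carrier G" for a
      proof -
        have "a <# rep B = B \<longleftrightarrow> (h \<otimes> a) <# rep B = rep B"
        proof
          assume "a <# rep B = B"
          then show "(h \<otimes> a) <# rep B = rep B"
            using lcos_m_assoc[OF R h(1) a] h(2) by simp
        next
          assume "(h \<otimes> a) <# rep B = rep B"
          then have "inv h <# ((h \<otimes> a) <# rep B) = B" using rep_back by simp
          then show "a <# rep B = B"
            using h(1) a R by (simp add: lcos_m_assoc m_assoc[symmetric])
        qed
        moreover have "a \<in> inv h <# stb (rep B) \<longleftrightarrow> h \<otimes> a \<in> stb (rep B)"
          using l_coset_mem[of "inv h" "stb (rep B)" a] h(1) a by (simp add: stb_def subset_iff)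
        ultimately show ?thesis using h(1) a by (simp add: mov_def stb_def)
      qed
      moreover have "inv h <# stb (rep B) \<subseteq> carrier G"
        using h(1) by (intro l_coset_subset_G) (auto simp: stb_def)
      ultimately show ?thesis by (auto simp: mov_def)
    qed
    then have "mov B \<in> lcosets (stb (rep B))" using h(1) by (auto simp: LCOSETS_def)
    ultimately show ?thesis by (simp add: topspace_D)
  qed
  let ?f = "\<lambda>x. (stb (rep (A x)), mov (A x))"
  have "continuous_map X (D_space G) ?f"
    unfolding continuous_map_def
  proof (intro conjI allI impI)
    show "?f \<in> topspace X \<rightarrow> topspace (D_space G)" using in_D sub by auto
    fix W
    have "{x \<in> topspace X. ?f x \<in> W} = \<Union>((\<lambda>B. {x \<in> topspace X. A x = B}) ` {B. (stb (rep B), mov B) \<in> W})"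
      by auto
    then show "openin X {x \<in> topspace X. ?f x \<in> W}"
      using loc by (simp only:) (rule openin_Union, blast)
  qed
  moreover have "?f (act g x) = D_action G g (?f x)" if g: "g \<in> carrier G" and x: "x \<in> topspace X" for g x
  proof -
    let ?B = "A x"
    have B: "?B \<subseteq> carrier G" using sub[OF x] by blast
    obtain h where h: "h \<in> carrier G" "rep ?B = h <# ?B" using rep by blast
    have R: "rep ?B \<subseteq> carrier G" using h B by (simp add: l_coset_subset_G)
    have "a \<in> mov (g <# ?B) \<longleftrightarrow> a \<in> g <# mov ?B" if a: "a \<in> carrier G" for a
    proof -
      have "a <# rep ?B = g <# ?B \<longleftrightarrow> (inv g \<otimes> a) <# rep ?B = ?B"
      proof
        assume "a <# rep ?B = g <# ?B"
        then have "inv g <# (a <# rep ?B) = inv g <# (g <# ?B)" by simp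
        then show "(inv g \<otimes> a) <# rep ?B = ?B"
          using g a R B by (simp add: lcos_m_assoc lcos_mult_one)
      next
        assume "(inv g \<otimes> a) <# rep ?B = ?B"
        then have "g <# ((inv g \<otimes> a) <# rep ?B) = g <# ?B" by simp
        then show "a <# rep ?B = g <# ?B"
          using g a R by (simp add: lcos_m_assoc m_assoc[symmetric])
      qed
      then show ?thesis
        using l_coset_mem[OF g, of "mov ?B" a] g a B by (simp add: mov_def rep_act subset_iff)
    qed
    moreover have "g <# mov ?B \<subseteq> carrier G"
      using g by (intro l_coset_subset_G) (auto simp: mov_def)
    ultimately have "mov (g <# ?B) = g <# mov ?B" by (auto simp: mov_def)
    then show ?thesis
      using equiv[OF g x] rep_act[OF g B] by (simp add: D_action_def)
  qed
  ultimately show ?thesis unfolding maps_to_D_def by blast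
qed


section \<open>Top sets and gaps of real functions\<close>

text \<open>
  Data \<open>\<sigma>\<close> that are unique where they exist, chosen by an open condition, are locally constant.  If they
  determine a proper nonempty subset equivariantly, the set where they exist is a piece.
\<close>

lemma (in group) piece_select:
  fixes P :: "'s \<Rightarrow> 'x \<Rightarrow> bool"
  assumes act: "\<And>g x. g \<in> carrier G \<Longrightarrow> x \<in> topspace X \<Longrightarrow> act g x \<in> topspace X"
    and opn: "\<And>\<sigma>. \<sigma> \<in> S \<Longrightarrow> openin X {x \<in> topspace X. P \<sigma> x}"
    and uniq: "\<And>x \<sigma> \<sigma>'. x \<in> topspace X \<Longrightarrow> \<sigma> \<in> S \<Longrightarrow> \<sigma>' \<in> S \<Longrightarrow> P \<sigma> x \<Longrightarrow> P \<sigma>' x \<Longrightarrow> \<sigma> = \<sigma>'"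
    and eqv: "\<And>g x \<sigma>. g \<in> carrier G \<Longrightarrow> x \<in> topspace X \<Longrightarrow> \<sigma> \<in> S \<Longrightarrow> P \<sigma> x
        \<Longrightarrow> sm g \<sigma> \<in> S \<and> P (sm g \<sigma>) (act g x)"
    and val: "\<And>g \<sigma>. g \<in> carrier G \<Longrightarrow> \<sigma> \<in> S \<Longrightarrow> val (sm g \<sigma>) = g <# val \<sigma>"
    and proper: "\<And>x \<sigma>. x \<in> topspace X \<Longrightarrow> \<sigma> \<in> S \<Longrightarrow> P \<sigma> x
        \<Longrightarrow> val \<sigma> \<subseteq> carrier G \<and> val \<sigma> \<noteq> {} \<and> val \<sigma> \<noteq> carrier G"
  shows "piece G X act {x \<in> topspace X. \<exists>\<sigma>\<in>S. P \<sigma> x}"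
proof -
  let ?V = "{x \<in> topspace X. \<exists>\<sigma>\<in>S. P \<sigma> x}"
  define sel where "sel x = (THE \<sigma>. \<sigma> \<in> S \<and> P \<sigma> x)" for x
  have sel_eq: "sel x = \<sigma>" if "x \<in> topspace X" "\<sigma> \<in> S" "P \<sigma> x" for x \<sigma>
    unfolding sel_def by (rule the_equality) (use that uniq in auto)
  have V_open: "openin X ?V"
    by (rule openin_bex) (rule opn)
  have V_act: "act g x \<in> ?V" if "g \<in> carrier G" "x \<in> ?V" for g x
  proof -
    obtain \<sigma> where s: "x \<in> topspace X" "\<sigma> \<in> S" "P \<sigma> x" using \<open>x \<in> ?V\<close> by blast
    have "sm g \<sigma> \<in> S" "P (sm g \<sigma>) (act g x)" using eqv[OF that(1) s] by simp_all
    then show ?thesis using act[OF that(1) s(1)] by (intro CollectI conjI bexI)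
  qed
  have topV: "topspace (subtopology X ?V) = ?V" by auto
  have "maps_to_D G (subtopology X ?V) act"
  proof (rule maps_to_D_if_subsets[where A = "\<lambda>x. val (sel x)"], unfold topV)
    fix x assume x: "x \<in> ?V"
    then obtain \<sigma> where s: "x \<in> topspace X" "\<sigma> \<in> S" "P \<sigma> x" by blast
    show "val (sel x) \<subseteq> carrier G \<and> val (sel x) \<noteq> {} \<and> val (sel x) \<noteq> carrier G"
      unfolding sel_eq[OF s] by (rule proper[OF s])
    fix g assume g: "g \<in> carrier G"
    have s': "sm g \<sigma> \<in> S" "P (sm g \<sigma>) (act g x)" using eqv[OF g s] by auto
    show "val (sel (act g x)) = g <# val (sel x)"
      unfolding sel_eq[OF s] sel_eq[OF act[OF g s(1)] s'] by (rule val[OF g s(2)])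
  next
    fix B
    let ?U = "\<Union>((\<lambda>\<sigma>. {x \<in> topspace X. P \<sigma> x}) ` {\<sigma> \<in> S. val \<sigma> = B})"
    have "{x \<in> ?V. val (sel x) = B} = ?U"
    proof (intro subset_antisym subsetI)
      fix x assume "x \<in> {x \<in> ?V. val (sel x) = B}"
      then obtain \<sigma> where s: "x \<in> topspace X" "\<sigma> \<in> S" "P \<sigma> x" and v: "val (sel x) = B" by blast
      have "\<sigma> \<in> {\<sigma> \<in> S. val \<sigma> = B}" using s(2) v sel_eq[OF s] by simp
      then show "x \<in> ?U" by (rule UN_I) (use s in simp)
    next
      fix x assume "x \<in> ?U"
      then obtain \<sigma> where s: "\<sigma> \<in> {\<sigma> \<in> S. val \<sigma> = B}" "x \<in> {x \<in> topspace X. P \<sigma> x}" by (rule UN_E)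
      then have s': "x \<in> topspace X" "\<sigma> \<in> S" "P \<sigma> x" "val \<sigma> = B" by simp_all
      then show "x \<in> {x \<in> ?V. val (sel x) = B}" using sel_eq[OF s'(1-3)] by blast
    qed
    moreover have "openin X ?U"
      by (rule openin_Union) (use opn in blast)
    ultimately have "openin X {x \<in> ?V. val (sel x) = B}" by (simp only:)
    then show "openin (subtopology X ?V) {x \<in> ?V. val (sel x) = B}"
      unfolding openin_open_subtopology[OF V_open] by (rule conjI) (rule Collect_restrict)
  qed
  then show ?thesis
    unfolding piece_def using V_open V_act by (intro conjI ballI)
qed

context elementary_abelian
begin

definition top_set :: "('a \<Rightarrow> real) \<Rightarrow> 'a set \<Rightarrow> bool" where
  "top_set y A \<longleftrightarrow> (\<forall>a\<in>A. \<forall>b\<in>carrier G - A. y b < y a)"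

definition proper_sets :: "'a set set" where
  "proper_sets = {A. A \<subseteq> carrier G \<and> A \<noteq> {} \<and> A \<noteq> carrier G}"

text \<open>
  The gap of \<open>A\<close> is the minimum of \<open>y a - y d\<close> over \<open>a \<in> A\<close> and \<open>d \<notin> A\<close>.  If \<open>A\<close> consists of the points
  above a level between two consecutive values of \<open>y\<close>, the gap is the difference of these values; all other proper
  nonempty sets have a gap that is not positive.  The formula compares the minima of \<open>B\<close> and \<open>A\<close>.
\<close>

definition gap_less :: "('a \<Rightarrow> real) \<Rightarrow> 'a set \<Rightarrow> 'a set \<Rightarrow> bool" where
  "gap_less y B A \<longleftrightarrow> (\<exists>b\<in>B. \<exists>c\<in>carrier G - B. \<forall>a\<in>A. \<forall>d\<in>carrier G - A. y b - y c < y a - y d)"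

definition largest_gaps :: "('a \<Rightarrow> real) \<Rightarrow> 'a set set \<Rightarrow> bool" where
  "largest_gaps y T \<longleftrightarrow> (\<forall>A\<in>T. top_set y A) \<and> (\<forall>A\<in>T. \<forall>B\<in>proper_sets - T. gap_less y B A)"

lemma finite_proper_sets: "finite proper_sets"
  by (rule finite_subset[of _ "Pow (carrier G)"]) (auto simp: proper_sets_def finite_carrier)

lemma l_coset_back: "g \<in> carrier G \<Longrightarrow> A \<subseteq> carrier G \<Longrightarrow> inv g <# (g <# A) = A"
  by (simp add: lcos_m_assoc lcos_mult_one)

lemma l_coset_forth: "g \<in> carrier G \<Longrightarrow> A \<subseteq> carrier G \<Longrightarrow> g <# (inv g <# A) = A"
  by (simp add: lcos_m_assoc lcos_mult_one)

lemma card_l_coset: "g \<in> carrier G \<Longrightarrow> A \<subseteq> carrier G \<Longrightarrow> card (g <# A) = card A"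
proof -
  assume gA: "g \<in> carrier G" "A \<subseteq> carrier G"
  have "g <# A = (\<lambda>a. g \<otimes> a) ` A" by (auto simp: l_coset_def)
  moreover have "inj_on (\<lambda>a. g \<otimes> a) A"
    using gA by (intro inj_onI) (metis Units_eq Units_l_cancel subsetD)
  ultimately show ?thesis by (simp add: card_image)
qed

lemma proper_l_coset:
  assumes "g \<in> carrier G" "A \<in> proper_sets"
  shows "g <# A \<in> proper_sets"
proof -
  have A: "A \<subseteq> carrier G" "A \<noteq> {}" "A \<noteq> carrier G" using assms(2) by (auto simp: proper_sets_def)
  have "g <# A \<noteq> carrier G"
    using card_l_coset[OF assms(1) A(1)] A(1,3) card_subset_eq[OF finite_carrier] by metis
  moreover have "g <# A \<noteq> {}" using A(2) by (auto simp: l_coset_def)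
  ultimately show ?thesis
    using l_coset_subset_G[OF A(1) assms(1)] by (simp add: proper_sets_def)
qed

lemma top_set_unique:
  assumes "A \<subseteq> carrier G" "B \<subseteq> carrier G" "card A = card B" "top_set y A" "top_set y B"
  shows "A = B"
proof (rule ccontr)
  assume ne: "A \<noteq> B"
  have fin: "finite A" "finite B" using assms(1,2) finite_carrier finite_subset by auto
  have "\<not> A \<subseteq> B" using ne assms(3) fin card_subset_eq by blast
  moreover have "\<not> B \<subseteq> A" using ne assms(3) fin card_subset_eq by metis
  ultimately obtain a b where "a \<in> A" "a \<notin> B" "b \<in> B" "b \<notin> A" by blast
  then have "y b < y a" "y a < y b"
    using assms unfolding top_set_def by blast+
  then show False by simp
qed

lemma largest_gaps_unique:
  assumes "S \<subseteq> proper_sets" "T \<subseteq> proper_sets" "card S = card T" "largest_gaps y S" "largest_gaps y T"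
  shows "S = T"
proof (rule ccontr)
  assume ne: "S \<noteq> T"
  have fin: "finite S" "finite T" using assms(1,2) finite_proper_sets finite_subset by auto
  have "\<not> S \<subseteq> T" using ne assms(3) fin card_subset_eq by blast
  moreover have "\<not> T \<subseteq> S" using ne assms(3) fin card_subset_eq by metis
  ultimately obtain A B where AB: "A \<in> S" "A \<notin> T" "B \<in> T" "B \<notin> S" by blast
  then have "gap_less y B A" "gap_less y A B"
    using assms unfolding largest_gaps_def by blast+
  then show False unfolding gap_less_def by (meson less_asym)
qed

lemma exists_maximizer: "\<exists>a\<in>carrier G. \<forall>b\<in>carrier G. y b \<le> (y a :: real)"
proof -
  have "Max (y ` carrier G) \<in> y ` carrier G"
    using finite_carrier by (intro Max_in) auto
  then obtain a where "a \<in> carrier G" "y a = Max (y ` carrier G)" by auto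
  then show ?thesis using finite_carrier by (intro bexI[of _ a]) auto
qed

lemma maximizer_in_top_set:
  assumes "a \<in> carrier G" "\<forall>b\<in>carrier G. y b \<le> y a" "A \<in> proper_sets" "top_set y A"
  shows "a \<in> A"
proof (rule ccontr)
  assume "a \<notin> A"
  obtain c where c: "c \<in> A" "c \<in> carrier G" using assms(3) by (auto simp: proper_sets_def)
  have "y a < y c" using assms(1,4) c(1) \<open>a \<notin> A\<close> unfolding top_set_def by blast
  then show False using assms(2) c(2) by force
qed

definition argmax :: "('a \<Rightarrow> real) \<Rightarrow> 'a set" where
  "argmax y = {a \<in> carrier G. \<forall>b\<in>carrier G. y b \<le> y a}"

lemma top_set_argmax: "top_set y (argmax y)"
  unfolding top_set_def argmax_def
proof (intro ballI)
  fix a b assume a: "a \<in> {a \<in> carrier G. \<forall>b\<in>carrier G. y b \<le> y a}"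
    and b: "b \<in> carrier G - {a \<in> carrier G. \<forall>b\<in>carrier G. y b \<le> y a}"
  then obtain c where "c \<in> carrier G" "y b < y c" by force
  then show "y b < y a" using a by force
qed

lemma argmax_proper:
  assumes "\<not> y constant_on carrier G"
  shows "argmax y \<in> proper_sets"
proof -
  have "argmax y \<noteq> carrier G"
  proof
    assume "argmax y = carrier G"
    then have "y a = y b" if "a \<in> carrier G" "b \<in> carrier G" for a b
      using that unfolding argmax_def by (metis (mono_tags, lifting) antisym mem_Collect_eq)
    then show False using assms unfolding constant_on_def by blast
  qed
  then show ?thesis
    using exists_maximizer[of y] by (auto simp: proper_sets_def argmax_def)
qed

lemma card_proper: "A \<in> proper_sets \<Longrightarrow> 1 \<le> card A \<and> card A \<le> card (carrier G) - 1"
  using finite_carrier psubset_card_mono[of "carrier G" A] finite_subset[of A "carrier G"]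
  by (fastforce simp: proper_sets_def card_gt_0_iff Suc_le_eq)

text \<open>
  All top sets together do.  A top set is determined by its least value, which is not the least value
  of \<open>y\<close>; and \<open>y\<close> has at most \<open>q - |J| + 1\<close> values.
\<close>

lemma exists_largest_gaps:
  assumes J: "J \<subseteq> carrier G" "y constant_on J" "J \<noteq> {}" and nc: "\<not> y constant_on carrier G"
  shows "\<exists>T\<subseteq>proper_sets. card T \<in> {1..card (carrier G) - card J} \<and> largest_gaps y T"
proof -
  let ?T = "{A \<in> proper_sets. top_set y A}"
  have finT: "finite ?T" using finite_proper_sets by simp
  have "argmax y \<in> ?T" using argmax_proper[OF nc] top_set_argmax by simp
  then have pos: "1 \<le> card ?T" using finT by (metis One_nat_def Suc_leI card_gt_0_iff empty_iff)
  have finJ: "finite J" using J(1) finite_carrier finite_subset by blast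
  let ?Y = "y ` carrier G" and ?low = "\<lambda>A. Min (y ` A)"
  have low_in: "?low A \<in> y ` A" "\<And>a. a \<in> A \<Longrightarrow> ?low A \<le> y a" if "A \<in> proper_sets" for A
  proof -
    have "finite A" "A \<noteq> {}" using that finite_carrier finite_subset by (auto simp: proper_sets_def)
    then show "?low A \<in> y ` A" "\<And>a. a \<in> A \<Longrightarrow> ?low A \<le> y a" by auto
  qed
  have char_top: "A = {a \<in> carrier G. ?low A \<le> y a}" if A: "A \<in> ?T" for A
  proof -
    have AP: "A \<in> proper_sets" "top_set y A" using A by auto
    have sub: "A \<subseteq> carrier G" using AP(1) by (simp add: proper_sets_def)
    obtain a0 where a0: "a0 \<in> A" "?low A = y a0" using low_in(1)[OF AP(1)] by auto
    have "a \<in> A" if "a \<in> carrier G" "?low A \<le> y a" for a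
    proof (rule ccontr)
      assume "a \<notin> A"
      then have "y a < y a0" using AP(2) a0(1) that(1) unfolding top_set_def by blast
      then show False using that(2) a0(2) by simp
    qed
    then show ?thesis using sub low_in(2)[OF AP(1)] by blast
  qed
  have inj: "inj_on ?low ?T"
  proof (rule inj_onI)
    fix A B assume "A \<in> ?T" "B \<in> ?T" "?low A = ?low B"
    then show "A = B" using char_top[of A] char_top[of B] by simp
  qed
  have "?low ` ?T \<subseteq> ?Y - {Min ?Y}"
  proof
    fix r assume "r \<in> ?low ` ?T"
    then obtain A where A: "A \<in> ?T" "r = ?low A" by blast
    then have AP: "A \<in> proper_sets" "top_set y A" by auto
    obtain b where b: "b \<in> carrier G" "b \<notin> A" using AP(1) by (auto simp: proper_sets_def)
    obtain a0 where a0: "a0 \<in> A" "?low A = y a0" using low_in(1)[OF AP(1)] by auto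
    have "y b < y a0" using AP(2) a0(1) b unfolding top_set_def by blast
    moreover have "Min ?Y \<le> y b" using b(1) finite_carrier by simp
    moreover have "a0 \<in> carrier G" using a0(1) AP(1) by (auto simp: proper_sets_def)
    ultimately show "r \<in> ?Y - {Min ?Y}" using A(2) a0(2) by auto
  qed
  then have "card ?T \<le> card (?Y - {Min ?Y})"
    using card_mono[of "?Y - {Min ?Y}" "?low ` ?T"] card_image[OF inj] finite_carrier by simp
  also have "\<dots> = card ?Y - 1"
  proof -
    have "Min ?Y \<in> ?Y" using finite_carrier by (intro Min_in) auto
    then show ?thesis using finite_carrier by (simp add: card_Diff_singleton)
  qed
  also have "\<dots> \<le> card (carrier G) - card J"
  proof -
    have "?Y \<subseteq> y ` J \<union> y ` (carrier G - J)" by auto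
    then have "card ?Y \<le> card (y ` J \<union> y ` (carrier G - J))"
      using finite_carrier finJ by (intro card_mono) auto
    also have "\<dots> \<le> card (y ` J) + card (y ` (carrier G - J))" by (rule card_Un_le)
    also have "card (y ` J) \<le> 1"
    proof -
      obtain c where "\<forall>a\<in>J. y a = c" using J(2) by (auto simp: constant_on_def)
      then have "y ` J \<subseteq> {c}" by auto
      then show ?thesis using card_mono[of "{c}" "y ` J"] by simp
    qed
    also have "card (y ` (carrier G - J)) \<le> card (carrier G - J)"
      using finite_carrier by (intro card_image_le) simp
    also have "\<dots> = card (carrier G) - card J" using J(1) finJ by (intro card_Diff_subset)
    finally show ?thesis by simp
  qed
  finally have upper: "card ?T \<le> card (carrier G) - card J" .
  have "gap_less y B A" if A: "A \<in> ?T" and B: "B \<in> proper_sets - ?T" for A B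
  proof -
    have "\<not> top_set y B" using B by blast
    then obtain b c where bc: "b \<in> B" "c \<in> carrier G - B" "y b \<le> y c"
      unfolding top_set_def by (meson not_less)
    have "y b - y c < y a - y d" if "a \<in> A" "d \<in> carrier G - A" for a d
    proof -
      have "y d < y a" using A that unfolding top_set_def by blast
      then show ?thesis using bc(3) by simp
    qed
    then show ?thesis unfolding gap_less_def using bc(1,2) by blast
  qed
  then have "largest_gaps y ?T" unfolding largest_gaps_def by blast
  then show ?thesis using pos upper by (intro exI[of _ ?T]) auto
qed

end

text \<open>
  An equivariant map from \<open>X\<close> to the real functions on the group.
\<close>

locale real_family = elementary_abelian +
  fixes X :: "'x topology" and act :: "'a \<Rightarrow> 'x \<Rightarrow> 'x" and F :: "'x \<Rightarrow> 'a \<Rightarrow> real"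
  assumes act_top: "g \<in> carrier G \<Longrightarrow> x \<in> topspace X \<Longrightarrow> act g x \<in> topspace X"
    and F_cont: "h \<in> carrier G \<Longrightarrow> continuous_map X euclideanreal (\<lambda>x. F x h)"
    and F_act: "g \<in> carrier G \<Longrightarrow> h \<in> carrier G \<Longrightarrow> x \<in> topspace X \<Longrightarrow> F (act g x) h = F x (inv g \<otimes> h)"
begin

definition size_piece :: "nat \<Rightarrow> 'x set" where
  "size_piece t = {x \<in> topspace X. \<exists>A\<in>{A. A \<subseteq> carrier G \<and> card A = t}. top_set (F x) A}"

definition gap_piece :: "nat \<Rightarrow> 'x set" where
  "gap_piece t = {x \<in> topspace X. \<exists>T\<in>{T. T \<subseteq> proper_sets \<and> card T = t}. largest_gaps (F x) T}"

lemma openin_top_set: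
  assumes "A \<subseteq> carrier G"
  shows "openin X {x \<in> topspace X. top_set (F x) A}"
  unfolding top_set_def
proof (rule openin_finite_ball[OF finite_subset[OF assms finite_carrier]], rule openin_finite_ball)
  show "finite (carrier G - A)" using finite_carrier by simp
  show "openin X {x \<in> topspace X. F x b < F x a}" if "a \<in> A" "b \<in> carrier G - A" for a b
    using that assms by (intro openin_less F_cont) auto
qed

lemma openin_gap_less:
  assumes "A \<subseteq> carrier G" "B \<subseteq> carrier G"
  shows "openin X {x \<in> topspace X. gap_less (F x) B A}"
  unfolding gap_less_def
proof (rule openin_bex, rule openin_bex, rule openin_finite_ball[OF finite_subset[OF assms(1) finite_carrier]],
    rule openin_finite_ball)
  show "finite (carrier G - A)" using finite_carrier by simp
  show "openin X {x \<in> topspace X. F x b - F x c < F x a - F x d}"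
    if "b \<in> B" "c \<in> carrier G - B" "a \<in> A" "d \<in> carrier G - A" for b c a d
    using that assms by (intro openin_less continuous_map_diff F_cont) auto
qed

lemma top_set_act:
  assumes g: "g \<in> carrier G" and x: "x \<in> topspace X" and A: "A \<subseteq> carrier G" and top: "top_set (F x) A"
  shows "top_set (F (act g x)) (g <# A)"
  unfolding top_set_def
proof (intro ballI)
  fix a b assume a: "a \<in> g <# A" and b: "b \<in> carrier G - (g <# A)"
  have ac: "a \<in> carrier G" using a l_coset_subset_G[OF A g] by blast
  have "inv g \<otimes> a \<in> A" "inv g \<otimes> b \<in> carrier G - A"
    using a b l_coset_mem[OF g A] ac g by auto
  then show "F (act g x) b < F (act g x) a"
    using top ac b F_act[OF g _ x] by (simp add: top_set_def)
qed

lemma gap_less_act: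
  assumes g: "g \<in> carrier G" and x: "x \<in> topspace X" and A: "A \<subseteq> carrier G" and B: "B \<subseteq> carrier G"
    and gap: "gap_less (F x) B A"
  shows "gap_less (F (act g x)) (g <# B) (g <# A)"
proof -
  obtain b c where bc: "b \<in> B" "c \<in> carrier G - B"
    and less: "\<And>a d. a \<in> A \<Longrightarrow> d \<in> carrier G - A \<Longrightarrow> F x b - F x c < F x a - F x d"
    using gap unfolding gap_less_def by blast
  have bcar: "b \<in> carrier G" using bc(1) B by blast
  have shift: "inv g \<otimes> (g \<otimes> h) = h" if "h \<in> carrier G" for h
    using g that by (simp add: m_assoc[symmetric])
  have Fb: "F (act g x) (g \<otimes> h) = F x h" if "h \<in> carrier G" for h
    using F_act[OF g _ x, of "g \<otimes> h"] shift[OF that] g that by simp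
  have "F (act g x) (g \<otimes> b) - F (act g x) (g \<otimes> c) < F (act g x) a - F (act g x) d"
    if a: "a \<in> g <# A" and d: "d \<in> carrier G - (g <# A)" for a d
  proof -
    have ac: "a \<in> carrier G" using a l_coset_subset_G[OF A g] by blast
    have "inv g \<otimes> a \<in> A" "inv g \<otimes> d \<in> carrier G - A"
      using a d l_coset_mem[OF g A] ac g by auto
    from less[OF this] show ?thesis
      using Fb[OF bcar] Fb[of c] bc(2) F_act[OF g ac x] F_act[OF g _ x, of d] d by simp
  qed
  moreover have "g \<otimes> b \<in> g <# B" using bc(1) unfolding l_coset_def by blast
  moreover have "g \<otimes> c \<in> carrier G - (g <# B)"
    using bc(2) g l_coset_mem[OF g B, of "g \<otimes> c"] shift[of c] by auto
  ultimately show ?thesis unfolding gap_less_def by blast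
qed

text \<open>
  Of two different sets of the same size, neither contains the other, so at most one is a top set.
\<close>

lemma piece_size:
  assumes t: "1 \<le> t" "t < card (carrier G)"
  shows "piece G X act (size_piece t)"
  unfolding size_piece_def
proof (rule piece_select[where val = "\<lambda>A. A" and sm = "\<lambda>g A. g <# A"])
  show "act g x \<in> topspace X" if "g \<in> carrier G" "x \<in> topspace X" for g x
    using that by (rule act_top)
  show "openin X {x \<in> topspace X. top_set (F x) A}" if "A \<in> {A. A \<subseteq> carrier G \<and> card A = t}" for A
    using that by (intro openin_top_set) simp
  show "A = B" if "x \<in> topspace X" "A \<in> {A. A \<subseteq> carrier G \<and> card A = t}" "B \<in> {A. A \<subseteq> carrier G \<and> card A = t}"
      "top_set (F x) A" "top_set (F x) B" for x A B
    using that top_set_unique[of A B "F x"] by simp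
  show "g <# A \<in> {A. A \<subseteq> carrier G \<and> card A = t} \<and> top_set (F (act g x)) (g <# A)"
    if "g \<in> carrier G" "x \<in> topspace X" "A \<in> {A. A \<subseteq> carrier G \<and> card A = t}" "top_set (F x) A" for g x A
    using that top_set_act card_l_coset l_coset_subset_G by simp
  show "A \<subseteq> carrier G \<and> A \<noteq> {} \<and> A \<noteq> carrier G"
    if "x \<in> topspace X" "A \<in> {A. A \<subseteq> carrier G \<and> card A = t}" "top_set (F x) A" for x A
    using that(2) t by auto
qed simp

text \<open>
  The \<open>t\<close> largest gaps belong to top sets, all of which contain the maximizers of the function; their
  intersection is therefore a proper nonempty subset.
\<close>

lemma piece_gap:
  assumes t: "1 \<le> t"
  shows "piece G X act (gap_piece t)"
  unfolding gap_piece_def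
proof (rule piece_select[where val = "\<lambda>T. {a \<in> carrier G. \<forall>A\<in>T. a \<in> A}" and sm = "\<lambda>g T. (\<lambda>A. g <# A) ` T"])
  let ?S = "{T. T \<subseteq> proper_sets \<and> card T = t}"
  have sub: "A \<subseteq> carrier G" if "T \<in> ?S" "A \<in> T" for A T
    using that by (auto simp: proper_sets_def)
  have finT: "finite T" if "T \<in> ?S" for T
    using that finite_proper_sets finite_subset by auto
  show "act g x \<in> topspace X" if "g \<in> carrier G" "x \<in> topspace X" for g x
    using that by (rule act_top)
  show "openin X {x \<in> topspace X. largest_gaps (F x) T}" if T: "T \<in> ?S" for T
  proof -
    have "openin X {x \<in> topspace X. \<forall>A\<in>T. top_set (F x) A}"
      by (rule openin_finite_ball[OF finT[OF T]]) (rule openin_top_set[OF sub[OF T]])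
    moreover have "openin X {x \<in> topspace X. \<forall>A\<in>T. \<forall>B\<in>proper_sets - T. gap_less (F x) B A}"
    proof (rule openin_finite_ball[OF finT[OF T]], rule openin_finite_ball)
      show "finite (proper_sets - T)" using finite_proper_sets by simp
      show "openin X {x \<in> topspace X. gap_less (F x) B A}" if "A \<in> T" "B \<in> proper_sets - T" for A B
        using that sub[OF T] by (intro openin_gap_less) (auto simp: proper_sets_def)
    qed
    ultimately have "openin X ({x \<in> topspace X. \<forall>A\<in>T. top_set (F x) A}
        \<inter> {x \<in> topspace X. \<forall>A\<in>T. \<forall>B\<in>proper_sets - T. gap_less (F x) B A})"
      by (rule openin_Int)
    moreover have "{x \<in> topspace X. largest_gaps (F x) T} = {x \<in> topspace X. \<forall>A\<in>T. top_set (F x) A}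
        \<inter> {x \<in> topspace X. \<forall>A\<in>T. \<forall>B\<in>proper_sets - T. gap_less (F x) B A}"
      by (auto simp: largest_gaps_def)
    ultimately show ?thesis by simp
  qed
  show "T = T'" if "x \<in> topspace X" "T \<in> ?S" "T' \<in> ?S" "largest_gaps (F x) T" "largest_gaps (F x) T'" for x T T'
    using that largest_gaps_unique[of T T' "F x"] by simp
  show "(\<lambda>A. g <# A) ` T \<in> ?S \<and> largest_gaps (F (act g x)) ((\<lambda>A. g <# A) ` T)"
    if g: "g \<in> carrier G" and x: "x \<in> topspace X" and T: "T \<in> ?S" and gaps: "largest_gaps (F x) T" for g x T
  proof
    have "inj_on (\<lambda>A. g <# A) T"
      by (rule inj_on_inverseI[where g = "\<lambda>A. inv g <# A"]) (rule l_coset_back[OF g sub[OF T]])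
    then show "(\<lambda>A. g <# A) ` T \<in> ?S"
      using T proper_l_coset[OF g] by (auto simp: card_image)
    show "largest_gaps (F (act g x)) ((\<lambda>A. g <# A) ` T)"
      unfolding largest_gaps_def
    proof (intro conjI ballI)
      fix A' assume "A' \<in> (\<lambda>A. g <# A) ` T"
      then obtain A where A: "A \<in> T" "A' = g <# A" by blast
      show "top_set (F (act g x)) A'"
        unfolding A(2) using gaps A(1) by (intro top_set_act[OF g x sub[OF T A(1)]]) (simp add: largest_gaps_def)
      fix B' assume B': "B' \<in> proper_sets - (\<lambda>A. g <# A) ` T"
      have B'c: "B' \<subseteq> carrier G" using B' by (auto simp: proper_sets_def)
      let ?B = "inv g <# B'"
      have B_eq: "B' = g <# ?B" using l_coset_forth[OF g B'c] by simp
      have "?B \<in> proper_sets - T"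
        using B' B_eq proper_l_coset[of "inv g" B'] g by auto
      moreover from this have "?B \<subseteq> carrier G" by (auto simp: proper_sets_def)
      ultimately have "gap_less (F (act g x)) (g <# ?B) (g <# A)"
        using gaps A(1) unfolding largest_gaps_def by (intro gap_less_act[OF g x sub[OF T A(1)]]) auto
      then show "gap_less (F (act g x)) B' A'" using A(2) B_eq by simp
    qed
  qed
  show "{a \<in> carrier G. \<forall>A\<in>(\<lambda>A. g <# A) ` T. a \<in> A} = g <# {a \<in> carrier G. \<forall>A\<in>T. a \<in> A}"
    if g: "g \<in> carrier G" and T: "T \<in> ?S" for g T
  proof -
    let ?I = "{a \<in> carrier G. \<forall>A\<in>T. a \<in> A}"
    have I: "?I \<subseteq> carrier G" by auto
    have "a \<in> {a \<in> carrier G. \<forall>A\<in>(\<lambda>A. g <# A) ` T. a \<in> A} \<longleftrightarrow> a \<in> g <# ?I" if a: "a \<in> carrier G" for a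
      using l_coset_mem[OF g I a] l_coset_mem[OF g sub[OF T] a] a g by auto
    then show ?thesis using l_coset_subset_G[OF I g] by blast
  qed
  show "{a \<in> carrier G. \<forall>A\<in>T. a \<in> A} \<subseteq> carrier G \<and> {a \<in> carrier G. \<forall>A\<in>T. a \<in> A} \<noteq> {}
      \<and> {a \<in> carrier G. \<forall>A\<in>T. a \<in> A} \<noteq> carrier G"
    if x: "x \<in> topspace X" and T: "T \<in> ?S" and gaps: "largest_gaps (F x) T" for x T
  proof -
    obtain a where a: "a \<in> carrier G" "\<forall>b\<in>carrier G. F x b \<le> F x a"
      using exists_maximizer by blast
    have "a \<in> A" if "A \<in> T" for A
      using gaps T that by (intro maximizer_in_top_set[OF a]) (auto simp: largest_gaps_def)
    moreover have "T \<noteq> {}" using T t by auto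
    then obtain A where A: "A \<in> T" by blast
    then have "A \<noteq> carrier G" "A \<subseteq> carrier G" using T by (auto simp: proper_sets_def)
    then obtain b where "b \<in> carrier G" "b \<notin> A" by blast
    ultimately show ?thesis using a(1) A by blast
  qed
qed

end

section \<open>Bounds for the complements of diagonals\<close>

lemma subtopology_absorb: "B \<subseteq> A \<Longrightarrow> subtopology (subtopology X A) B = subtopology X B"
  by (simp add: subtopology_subtopology inf.absorb2)

context elementary_abelian
begin

lemma size_cover_nonconstant:
  assumes "\<not> y constant_on carrier G"
  shows "\<exists>t\<in>{1..card (carrier G) - 1}. \<exists>A\<in>{A. A \<subseteq> carrier G \<and> card A = t}. top_set y A"
proof -
  have "argmax y \<in> proper_sets" by (rule argmax_proper[OF assms])
  then have "card (argmax y) \<in> {1..card (carrier G) - 1}" "argmax y \<subseteq> carrier G"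
    using card_proper by (auto simp: proper_sets_def)
  then show ?thesis using top_set_argmax by (intro bexI[of _ "card (argmax y)"] bexI[of _ "argmax y"]) auto
qed

lemma size_cover_max:
  assumes "\<And>J c. J \<subseteq> carrier G \<Longrightarrow> card J = k \<Longrightarrow> \<forall>i\<in>J. y i = c \<Longrightarrow> \<forall>j\<in>carrier G. y j \<le> c \<Longrightarrow> False"
  shows "\<exists>t\<in>{1..k - 1}. \<exists>A\<in>{A. A \<subseteq> carrier G \<and> card A = t}. top_set y A"
proof -
  obtain a where a: "a \<in> carrier G" "\<forall>b\<in>carrier G. y b \<le> y a"
    using exists_maximizer by blast
  have sub: "argmax y \<subseteq> carrier G" by (auto simp: argmax_def)
  have fin: "finite (argmax y)" using sub finite_carrier finite_subset by blast
  have "a \<in> argmax y" using a by (simp add: argmax_def)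
  then have pos: "1 \<le> card (argmax y)"
    using fin card_gt_0_iff[of "argmax y"] by (auto simp: Suc_le_eq)
  have "card (argmax y) < k"
  proof (rule ccontr)
    assume "\<not> card (argmax y) < k"
    then obtain J where J: "J \<subseteq> argmax y" "card J = k"
      using obtain_subset_with_card_n[of k "argmax y"] by (auto simp: not_less)
    have "y i = y a" if "i \<in> J" for i
    proof -
      have "i \<in> argmax y" using J(1) that by (rule subsetD)
      then have "i \<in> carrier G" "y a \<le> y i" using a(1) by (simp_all add: argmax_def)
      then show ?thesis using a(2) by (simp add: antisym)
    qed
    then have "\<forall>i\<in>J. y i = y a" by (rule ballI)
    from assms[OF subset_trans[OF J(1) sub] J(2) this a(2)] show False .
  qed
  then show ?thesis
    using pos sub top_set_argmax by (intro bexI[of _ "card (argmax y)"] bexI[of _ "argmax y"]) auto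
qed

lemma W_family:
  assumes "k \<le> card (carrier G)"
  shows "real_family G p (W_space (carrier G) k) (map_action G) (\<lambda>y. y)"
proof unfold_locales
  fix g x assume g: "g \<in> carrier G" and x: "x \<in> topspace (W_space (carrier G) k)"
  have "continuous_map (W_space (carrier G) k) (W_space (carrier G) k) (map_action G g)"
    using fixed_point_free_W[OF is_group finite_carrier, of k] assms g
    by (simp add: fixed_point_free_G_space_def order_def)
  from funcset_mem[OF continuous_map_funspace[OF this] x]
  show "map_action G g x \<in> topspace (W_space (carrier G) k)" .
next
  fix h assume "h \<in> carrier G"
  then show "continuous_map (W_space (carrier G) k) euclideanreal (\<lambda>x. x h)"
    unfolding W_space_def by (intro continuous_map_from_subtopology continuous_map_product_projection)
qed (simp add: map_action_def)

lemma covered_W: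
  assumes k: "k \<le> card (carrier G)"
  shows "covered G (W_space (carrier G) k) (map_action G) (k - 1)"
proof -
  interpret F: real_family G p "W_space (carrier G) k" "map_action G" "\<lambda>y. y"
    by (rule W_family[OF k])
  have "covered G (W_space (carrier G) k) (map_action G) (card {1..k - 1})"
  proof (rule covered_family[where V = F.size_piece])
    show "piece G (W_space (carrier G) k) (map_action G) (F.size_piece t)" if "t \<in> {1..k - 1}" for t
      using that k by (intro F.piece_size) auto
    show "topspace (W_space (carrier G) k) \<subseteq> \<Union>(F.size_piece ` {1..k - 1})"
    proof
      fix y assume y: "y \<in> topspace (W_space (carrier G) k)"
      then have "y \<in> (carrier G \<rightarrow>\<^sub>E UNIV) - max_diagonal (carrier G) k" by (simp add: W_space_def)
      then have "\<exists>t\<in>{1..k - 1}. \<exists>A\<in>{A. A \<subseteq> carrier G \<and> card A = t}. top_set y A"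
        unfolding max_diagonal_def by (intro size_cover_max) blast
      then show "y \<in> \<Union>(F.size_piece ` {1..k - 1})"
        using y unfolding F.size_piece_def by blast
    qed
  qed simp
  then show ?thesis by simp
qed

end

context point_space
begin

lemma topspace_sub:
  assumes "S \<subseteq> Maps"
  shows "topspace (subtopology map_top S) = S"
  unfolding topspace_subtopology topspace_map_top using assms by blast

lemma coord_family:
  assumes "S \<subseteq> Maps" "\<And>g y. g \<in> carrier G \<Longrightarrow> y \<in> S \<Longrightarrow> map_action G g y \<in> S"
  shows "real_family G p (subtopology map_top S) (map_action G) (\<lambda>y h. y h l)"
proof -
  note top = topspace_sub[OF assms(1)]
  show ?thesis
  proof unfold_locales
    show "map_action G g y \<in> topspace (subtopology map_top S)"
      if "g \<in> carrier G" "y \<in> topspace (subtopology map_top S)" for g y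
      using that assms(2) unfolding top by blast
    show "continuous_map (subtopology map_top S) euclideanreal (\<lambda>y. y h l)" if "h \<in> carrier G" for h
      by (rule continuous_map_from_subtopology[OF continuous_coordinate[OF that]])
  qed (simp add: map_action_def)
qed

lemma V_space_eq: "V_space (carrier G) m k = subtopology map_top (Maps - diagonal (carrier G) k (Euclidean_space m))"
  by (simp add: V_space_def Maps_def)

definition V1_set :: "nat \<Rightarrow> ('a \<Rightarrow> nat \<Rightarrow> real) set" where
  "V1_set k = {y \<in> Maps. split_power (carrier G) y \<notin>
     diagonal (carrier G) k euclideanreal \<times> diagonal (carrier G) (card (carrier G)) (Euclidean_space (m - 1))}"

lemma V1_space_eq: "V1_space (carrier G) m k = subtopology map_top (V1_set k)"
  by (simp add: V1_space_def V1_set_def Maps_def)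

lemma diagonal_iff:
  assumes "y \<in> Maps"
  shows "y \<in> diagonal (carrier G) k (Euclidean_space m) \<longleftrightarrow> (\<exists>J\<subseteq>carrier G. card J = k \<and> y constant_on J)"
  using assms by (simp add: diagonal_def Maps_def)

lemma V_act:
  assumes "k \<le> card (carrier G)" "g \<in> carrier G" "y \<in> Maps - diagonal (carrier G) k (Euclidean_space m)"
  shows "map_action G g y \<in> Maps - diagonal (carrier G) k (Euclidean_space m)"
proof -
  have "continuous_map (V_space (carrier G) m k) (V_space (carrier G) m k) (map_action G g)"
    using fixed_point_free_V[OF is_group finite_carrier, of k m] assms(1,2)
    by (simp add: fixed_point_free_G_space_def order_def)
  from funcset_mem[OF continuous_map_funspace[OF this], unfolded V_space_eq topspace_sub[OF Diff_subset], OF assms(3)]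
  show ?thesis .
qed

lemma V1_act:
  assumes "k \<le> card (carrier G)" "m \<ge> 1" "g \<in> carrier G" "y \<in> V1_set k"
  shows "map_action G g y \<in> V1_set k"
proof -
  have sub: "V1_set k \<subseteq> Maps" by (auto simp: V1_set_def)
  have "continuous_map (V1_space (carrier G) m k) (V1_space (carrier G) m k) (map_action G g)"
    using fixed_point_free_V1[OF is_group finite_carrier, of k m] assms(1-3)
    by (simp add: fixed_point_free_G_space_def order_def)
  from funcset_mem[OF continuous_map_funspace[OF this], unfolded V1_space_eq topspace_sub[OF sub], OF assms(4)]
  show ?thesis .
qed

lemma first_diagonal_iff:
  "fst (split_power (carrier G) y) \<in> diagonal (carrier G) k euclideanreal
    \<longleftrightarrow> (\<exists>J\<subseteq>carrier G. card J = k \<and> (\<lambda>h. y h 0) constant_on J)"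
proof -
  have "(\<lambda>h\<in>carrier G. y h 0) constant_on J \<longleftrightarrow> (\<lambda>h. y h 0) constant_on J" if "J \<subseteq> carrier G" for J
    using that by (auto simp: constant_on_def subset_iff)
  then show ?thesis by (auto simp: diagonal_def split_power_def)
qed

lemma rest_diagonal_iff:
  assumes "y \<in> Maps"
  shows "snd (split_power (carrier G) y) \<in> diagonal (carrier G) (card (carrier G)) (Euclidean_space (m - 1))
    \<longleftrightarrow> (\<forall>l\<in>{1..m - 1}. (\<lambda>h. y h l) constant_on carrier G)" (is "?L \<longleftrightarrow> ?R")
proof
  assume ?L
  then obtain J where "J \<subseteq> carrier G" "card J = card (carrier G)" "snd (split_power (carrier G) y) constant_on J"
    by (auto simp: diagonal_def)
  then have "snd (split_power (carrier G) y) constant_on carrier G"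
    using card_subset_eq[OF finite_carrier] by blast
  then obtain c where c: "\<And>h. h \<in> carrier G \<Longrightarrow> (\<lambda>l. y h (Suc l)) = c"
    by (auto simp: constant_on_def split_power_def)
  have "y h l = c (l - 1)" if "h \<in> carrier G" "l \<in> {1..m - 1}" for h l
    using fun_cong[OF c[OF that(1)], of "l - 1"] that(2) by simp
  then show ?R by (auto simp: constant_on_def)
next
  assume R: ?R
  define c where "c l = y \<one> (Suc l)" for l
  have eq: "y h (Suc l) = c l" if h: "h \<in> carrier G" for h l
  proof (cases "Suc l \<in> {1..m - 1}")
    case True
    from bspec[OF R this] obtain d where "\<forall>h\<in>carrier G. y h (Suc l) = d" unfolding constant_on_def by blast
    then show ?thesis using h by (simp add: c_def)
  next
    case False
    then have "Suc l \<ge> m" by auto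
    then show ?thesis using assms h by (simp add: c_def Maps_iff)
  qed
  have "snd (split_power (carrier G) y) \<in> carrier G \<rightarrow>\<^sub>E topspace (Euclidean_space (m - 1))"
    using assms by (auto simp: split_power_def topspace_Euclidean_space Maps_iff)
  moreover have "snd (split_power (carrier G) y) constant_on carrier G"
    unfolding constant_on_def by (rule exI[of _ c]) (simp add: split_power_def eq fun_eq_iff)
  ultimately show ?L by (auto simp: diagonal_def)
qed

lemma mem_V1_iff:
  assumes "y \<in> Maps"
  shows "y \<in> V1_set k \<longleftrightarrow> (\<forall>J. J \<subseteq> carrier G \<and> card J = k \<longrightarrow> \<not> (\<lambda>h. y h 0) constant_on J)
      \<or> (\<exists>l\<in>{1..m - 1}. \<not> (\<lambda>h. y h l) constant_on carrier G)"
  using assms first_diagonal_iff[of y k] rest_diagonal_iff[OF assms]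
  by (auto simp: V1_set_def mem_Times_iff)

lemma constant_iff_coordinates:
  assumes "y \<in> Maps" "J \<subseteq> carrier G"
  shows "y constant_on J \<longleftrightarrow> (\<forall>l<m. (\<lambda>h. y h l) constant_on J)"
proof
  assume "\<forall>l<m. (\<lambda>h. y h l) constant_on J"
  then have "\<forall>l. \<exists>c. l < m \<longrightarrow> (\<forall>h\<in>J. y h l = c)" by (auto simp: constant_on_def)
  then obtain c where c: "\<And>l h. l < m \<Longrightarrow> h \<in> J \<Longrightarrow> y h l = c l" by metis
  have "y h = (\<lambda>l. if l < m then c l else 0)" if h: "h \<in> J" for h
    using c[OF _ h] assms h by (auto simp: fun_eq_iff Maps_iff subset_iff)
  then show "y constant_on J" unfolding constant_on_def by blast
qed (auto simp: constant_on_def)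

lemma V_subset_V1:
  assumes "m \<ge> 1" "k \<le> card (carrier G)"
  shows "Maps - diagonal (carrier G) k (Euclidean_space m) \<subseteq> V1_set k"
proof
  fix y assume y: "y \<in> Maps - diagonal (carrier G) k (Euclidean_space m)"
  then have M: "y \<in> Maps" by simp
  show "y \<in> V1_set k"
  proof (rule ccontr)
    assume "y \<notin> V1_set k"
    then obtain J where J: "J \<subseteq> carrier G" "card J = k" "(\<lambda>h. y h 0) constant_on J"
      and rest: "\<forall>l\<in>{1..m - 1}. (\<lambda>h. y h l) constant_on carrier G"
      unfolding mem_V1_iff[OF M] by blast
    have "(\<lambda>h. y h l) constant_on J" if "l < m" for l
    proof (cases "l = 0")
      case False
      then have "l \<in> {1..m - 1}" using that by auto
      then show ?thesis using rest constant_on_subset J(1) by blast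
    qed (simp add: J(3))
    then have "y constant_on J" using constant_iff_coordinates[OF M J(1)] by blast
    then show False using y J diagonal_iff[OF M] by blast
  qed
qed

text \<open>
  Either the first coordinate attains its maximum fewer than \<open>k\<close> times, or one of the other coordinates is
  not constant.
\<close>

lemma covered_V1:
  assumes m: "m \<ge> 1" and k: "1 \<le> k" "k \<le> card (carrier G)"
  shows "covered G (V1_space (carrier G) m k) (map_action G) ((m - 1) * (card (carrier G) - 1) + k - 1)"
proof -
  let ?X = "V1_space (carrier G) m k" and ?q = "card (carrier G)"
  have sub: "V1_set k \<subseteq> Maps" by (auto simp: V1_set_def)
  have fam: "real_family G p ?X (map_action G) (\<lambda>y h. y h l)" for l
    unfolding V1_space_eq by (rule coord_family[OF sub V1_act[OF k(2) m]])
  let ?I = "{0} \<times> {1..k - 1} \<union> {1..m - 1} \<times> {1..?q - 1}"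
  let ?V = "\<lambda>(l, t). real_family.size_piece G ?X (\<lambda>y h. y h l) t"
  have "covered G ?X (map_action G) (card ?I)"
  proof (rule covered_family[where V = ?V])
    show "piece G ?X (map_action G) (?V i)" if i: "i \<in> ?I" for i
    proof -
      obtain l t where lt: "i = (l, t)" by (cases i)
      then have "1 \<le> t" "t < ?q" using i k by auto
      then show ?thesis unfolding lt by (simp add: real_family.piece_size[OF fam])
    qed
    show "topspace ?X \<subseteq> \<Union>(?V ` ?I)"
    proof
      fix y assume y: "y \<in> topspace ?X"
      then have yV: "y \<in> V1_set k" unfolding V1_space_eq topspace_sub[OF sub] .
      have M: "y \<in> Maps" using sub yV by blast
      have "\<exists>l t. (l, t) \<in> ?I \<and> (\<exists>A\<in>{A. A \<subseteq> carrier G \<and> card A = t}. top_set (\<lambda>h. y h l) A)"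
      proof (cases "\<exists>l\<in>{1..m - 1}. \<not> (\<lambda>h. y h l) constant_on carrier G")
        case True
        then obtain l where l: "l \<in> {1..m - 1}" "\<not> (\<lambda>h. y h l) constant_on carrier G" by blast
        obtain t where "t \<in> {1..?q - 1}" "\<exists>A\<in>{A. A \<subseteq> carrier G \<and> card A = t}. top_set (\<lambda>h. y h l) A"
          using size_cover_nonconstant[OF l(2)] by blast
        then show ?thesis using l(1) by (intro exI[of _ l] exI[of _ t]) simp
      next
        case False
        then have nc: "\<forall>J. J \<subseteq> carrier G \<and> card J = k \<longrightarrow> \<not> (\<lambda>h. y h 0) constant_on J"
          using yV unfolding mem_V1_iff[OF M] by blast
        have "\<exists>t\<in>{1..k - 1}. \<exists>A\<in>{A. A \<subseteq> carrier G \<and> card A = t}. top_set (\<lambda>h. y h 0) A"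
        proof (rule size_cover_max)
          fix J c assume "J \<subseteq> carrier G" "card J = k" "\<forall>i\<in>J. y i 0 = c"
          then show False using nc unfolding constant_on_def by blast
        qed
        then obtain t where "t \<in> {1..k - 1}" "\<exists>A\<in>{A. A \<subseteq> carrier G \<and> card A = t}. top_set (\<lambda>h. y h 0) A"
          by blast
        then show ?thesis by (intro exI[of _ 0] exI[of _ t]) simp
      qed
      then obtain l t where lt: "(l, t) \<in> ?I"
        "\<exists>A\<in>{A. A \<subseteq> carrier G \<and> card A = t}. top_set (\<lambda>h. y h l) A" by blast
      have "y \<in> ?V (l, t)"
        using y lt(2) by (simp add: real_family.size_piece_def[OF fam])
      then show "y \<in> \<Union>(?V ` ?I)" using lt(1) by (rule UN_I[rotated])
    qed
  qed simp
  moreover have "card ?I = (m - 1) * (?q - 1) + k - 1"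
  proof -
    have "card ?I = card ({0::nat} \<times> {1..k - 1}) + card ({1..m - 1} \<times> {1..?q - 1})"
      by (rule card_Un_disjoint) auto
    also have "\<dots> = (k - 1) + (m - 1) * (?q - 1)" by (simp add: card_cartesian_product)
    finally show ?thesis using k(1) by linarith
  qed
  ultimately show ?thesis by simp
qed

lemma covered_V:
  assumes "m \<ge> 1" "1 \<le> k" "k \<le> card (carrier G)"
  shows "covered G (V_space (carrier G) m k) (map_action G) ((m - 1) * (card (carrier G) - 1) + k - 1)"
proof (rule covered_pullback[OF _ _ _ covered_V1[OF assms], where \<phi> = "\<lambda>y. y"])
  have sub: "V1_set k \<subseteq> Maps" by (auto simp: V1_set_def)
  show "continuous_map (V_space (carrier G) m k) (V1_space (carrier G) m k) (\<lambda>y. y)"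
    unfolding V_space_eq V1_space_eq continuous_map_in_subtopology topspace_sub[OF Diff_subset]
    using V_subset_V1[OF assms(1,3)] by (auto intro!: continuous_map_from_subtopology)
  show "map_action G g y \<in> topspace (V_space (carrier G) m k)"
    if "g \<in> carrier G" "y \<in> topspace (V_space (carrier G) m k)" for g y
    using that V_act[OF assms(3)] unfolding V_space_eq topspace_sub[OF Diff_subset] by blast
qed simp

text \<open>
  Off \<open>X'\<close> the function \<open>F y\<close> is not constant but repeats a value \<open>k\<close> times, so it has at least one and at most
  \<open>q - k\<close> positive gaps.  Hence \<open>q - k\<close> more pieces complete a cover of \<open>X'\<close> to one of the whole sphere.
\<close>

lemma lower_bound:
  assumes X': "openin sphere_top X'" and cov: "covered G (subtopology sphere_top X') (map_action G) n"
    and fam: "real_family G p sphere_top (map_action G) F"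
    and k: "1 \<le> k" "k \<le> card (carrier G)" and m: "m \<ge> 1"
    and diag: "\<And>y. y \<in> topspace sphere_top \<Longrightarrow> y \<notin> X' \<Longrightarrow>
       (\<exists>J\<subseteq>carrier G. card J = k \<and> F y constant_on J) \<and> \<not> F y constant_on carrier G"
  shows "(m - 1) * (card (carrier G) - 1) + k - 1 \<le> n"
proof -
  let ?q = "card (carrier G)"
  interpret F: real_family G p sphere_top "map_action G" F by (rule fam)
  have "covered G sphere_top (map_action G) (n + card {1..?q - k})"
  proof (rule covered_union[OF X' cov, where V = F.gap_piece])
    show "piece G sphere_top (map_action G) (F.gap_piece t)" if "t \<in> {1..?q - k}" for t
      using that by (intro F.piece_gap) simp
    show "topspace sphere_top \<subseteq> X' \<union> \<Union>(F.gap_piece ` {1..?q - k})"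
    proof
      fix y assume y: "y \<in> topspace sphere_top"
      show "y \<in> X' \<union> \<Union>(F.gap_piece ` {1..?q - k})"
      proof (cases "y \<in> X'")
        case False
        obtain J where J: "J \<subseteq> carrier G" "card J = k" "F y constant_on J"
          and nc: "\<not> F y constant_on carrier G" using diag[OF y False] by blast
        have "J \<noteq> {}" using J(2) k(1) by auto
        from exists_largest_gaps[OF J(1,3) this nc] obtain T
          where T: "T \<subseteq> proper_sets" "card T \<in> {1..?q - k}" "largest_gaps (F y) T"
          unfolding J(2) by blast
        then have "y \<in> F.gap_piece (card T)" using y unfolding F.gap_piece_def by blast
        then show ?thesis using T(2) by blast
      qed simp
    qed
  qed simp
  then have "m * (?q - 1) \<le> n + (?q - k)"
    using sphere_not_covered by simp
  moreover have "m * (?q - 1) = (m - 1) * (?q - 1) + (?q - 1)"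
    using m by (cases m) simp_all
  ultimately show ?thesis using k by linarith
qed

lemma openin_sphere:
  assumes "openin map_top T" "T \<subseteq> topspace sphere_top"
  shows "openin sphere_top T"
proof -
  have "T = T \<inter> (Maps - diagonal (carrier G) (card (carrier G)) (Euclidean_space m))"
    using assms(2) unfolding V_space_eq topspace_sub[OF Diff_subset] by blast
  then show ?thesis unfolding V_space_eq openin_subtopology using assms(1) by blast
qed

lemma sphere_top_eq: "sphere_top = subtopology map_top {y \<in> Maps. \<not> y constant_on carrier G}"
proof -
  have "Maps - diagonal (carrier G) (card (carrier G)) (Euclidean_space m) = {y \<in> Maps. \<not> y constant_on carrier G}"
    using topspace_sphere unfolding V_space_eq topspace_sub[OF Diff_subset] .
  then show ?thesis by (simp only: V_space_eq)
qed

lemma sphere_act: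
  "g \<in> carrier G \<Longrightarrow> y \<in> topspace sphere_top \<Longrightarrow> map_action G g y \<in> topspace sphere_top"
  using V_act[of "card (carrier G)" g y] unfolding V_space_eq topspace_sub[OF Diff_subset] by simp

lemma sphere_coord_family: "real_family G p sphere_top (map_action G) (\<lambda>y h. y h l)"
  unfolding V_space_eq by (rule coord_family[OF Diff_subset V_act]) simp_all

lemma not_constant_iff: "\<not> f constant_on J \<longleftrightarrow> (\<exists>a\<in>J. \<exists>b\<in>J. f a \<noteq> f b)" if "J \<noteq> {}"
  using that unfolding constant_on_def by (metis all_not_in_conv)

lemma openin_not_constant:
  assumes "J \<subseteq> carrier G" "J \<noteq> {}"
  shows "openin map_top {y \<in> topspace map_top. \<not> (\<lambda>h. y h l) constant_on J}"
  unfolding not_constant_iff[OF assms(2)]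
proof (rule openin_bex, rule openin_bex)
  fix a b assume "a \<in> J" "b \<in> J"
  then show "openin map_top {y \<in> topspace map_top. y a l \<noteq> y b l}"
    using assms(1) by (intro openin_neq continuous_coordinate) auto
qed

lemma finite_card_subsets: "finite {J. J \<subseteq> carrier G \<and> card J = k}"
  by (rule finite_subset[of _ "Pow (carrier G)"]) (auto simp: finite_carrier)

lemma lower_V1:
  assumes m: "m \<ge> 1" and k: "1 \<le> k" "k \<le> card (carrier G)"
    and cov: "covered G (V1_space (carrier G) m k) (map_action G) n"
  shows "(m - 1) * (card (carrier G) - 1) + k - 1 \<le> n"
proof (rule lower_bound[OF _ _ sphere_coord_family[of 0] k m])
  let ?Js = "{J. J \<subseteq> carrier G \<and> card J = k}"
  have sub: "V1_set k \<subseteq> Maps" by (auto simp: V1_set_def)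
  have sub_sphere: "V1_set k \<subseteq> topspace sphere_top"
  proof
    fix y assume y: "y \<in> V1_set k"
    then have M: "y \<in> Maps" using sub by blast
    obtain J where J: "J \<subseteq> carrier G" "card J = k"
      using obtain_subset_with_card_n[OF k(2)] by blast
    have "\<not> y constant_on carrier G"
    proof
      assume c: "y constant_on carrier G"
      have "(\<lambda>h. y h l) constant_on carrier G" for l
        using c unfolding constant_on_def by metis
      moreover from this have "(\<lambda>h. y h 0) constant_on J"
        using constant_on_subset J(1) by blast
      ultimately show False using y J unfolding mem_V1_iff[OF M] by blast
    qed
    then show "y \<in> topspace sphere_top" using M by (simp add: topspace_sphere)
  qed
  have V1_eq: "V1_set k = {y \<in> topspace map_top. \<forall>J\<in>?Js. \<not> (\<lambda>h. y h 0) constant_on J}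
      \<union> {y \<in> topspace map_top. \<exists>l\<in>{1..m - 1}. \<not> (\<lambda>h. y h l) constant_on carrier G}"
    unfolding topspace_map_top using mem_V1_iff[of _ k] sub by blast
  have "openin map_top {y \<in> topspace map_top. \<forall>J\<in>?Js. \<not> (\<lambda>h. y h 0) constant_on J}"
    by (rule openin_finite_ball[OF finite_card_subsets], rule openin_not_constant) (use k in auto)
  moreover have "openin map_top {y \<in> topspace map_top. \<exists>l\<in>{1..m - 1}. \<not> (\<lambda>h. y h l) constant_on carrier G}"
    by (rule openin_bex, rule openin_not_constant) auto
  ultimately have "openin map_top (V1_set k)" unfolding V1_eq by (rule openin_Un)
  then show "openin sphere_top (V1_set k)" using sub_sphere by (rule openin_sphere)
  have "subtopology sphere_top (V1_set k) = V1_space (carrier G) m k"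
    unfolding V1_space_eq sphere_top_eq
    by (rule subtopology_absorb) (use sub_sphere topspace_sphere in simp)
  then show "covered G (subtopology sphere_top (V1_set k)) (map_action G) n" using cov by simp
  fix y assume y: "y \<in> topspace sphere_top" "y \<notin> V1_set k"
  then have M: "y \<in> Maps" and nc: "\<not> y constant_on carrier G" by (simp_all add: topspace_sphere)
  obtain J where J: "J \<subseteq> carrier G" "card J = k" "(\<lambda>h. y h 0) constant_on J"
    and rest: "\<forall>l\<in>{1..m - 1}. (\<lambda>h. y h l) constant_on carrier G"
    using y(2) unfolding mem_V1_iff[OF M] by blast
  have "\<not> (\<lambda>h. y h 0) constant_on carrier G"
  proof
    assume c0: "(\<lambda>h. y h 0) constant_on carrier G"
    have "(\<lambda>h. y h l) constant_on carrier G" if "l < m" for l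
      using c0 rest that by (cases "l = 0") auto
    then show False using nc constant_iff_coordinates[OF M subset_refl] by blast
  qed
  then show "(\<exists>J\<subseteq>carrier G. card J = k \<and> (\<lambda>h. y h 0) constant_on J) \<and> \<not> (\<lambda>h. y h 0) constant_on carrier G"
    using J by blast
qed

lemma lower_V:
  assumes m: "m \<ge> 1" and k: "1 \<le> k" "k \<le> card (carrier G)"
    and cov: "covered G (V_space (carrier G) m k) (map_action G) n"
    and fam: "real_family G p sphere_top (map_action G) F"
    and F: "\<And>y J. y \<in> Maps \<Longrightarrow> \<not> y constant_on carrier G \<Longrightarrow> J \<subseteq> carrier G \<Longrightarrow> card J = k \<Longrightarrow> y constant_on J
       \<Longrightarrow> F y constant_on J \<and> \<not> F y constant_on carrier G"
  shows "(m - 1) * (card (carrier G) - 1) + k - 1 \<le> n"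
proof (rule lower_bound[OF _ _ fam k m])
  let ?Js = "{J. J \<subseteq> carrier G \<and> card J = k}"
  let ?V = "Maps - diagonal (carrier G) k (Euclidean_space m)"
  have V_eq: "?V = {y \<in> topspace map_top. \<forall>J\<in>?Js. \<exists>l\<in>{..<m}. \<not> (\<lambda>h. y h l) constant_on J}"
  proof (rule Set.set_eqI)
    fix y
    show "y \<in> ?V \<longleftrightarrow> y \<in> {y \<in> topspace map_top. \<forall>J\<in>?Js. \<exists>l\<in>{..<m}. \<not> (\<lambda>h. y h l) constant_on J}"
    proof (cases "y \<in> Maps")
      case True
      have "y \<in> diagonal (carrier G) k (Euclidean_space m) \<longleftrightarrow>
          (\<exists>J\<in>?Js. \<forall>l\<in>{..<m}. (\<lambda>h. y h l) constant_on J)"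
      proof -
        have "y \<in> diagonal (carrier G) k (Euclidean_space m) \<longleftrightarrow> (\<exists>J\<in>?Js. y constant_on J)"
          unfolding diagonal_iff[OF True] by blast
        also have "\<dots> \<longleftrightarrow> (\<exists>J\<in>?Js. \<forall>l\<in>{..<m}. (\<lambda>h. y h l) constant_on J)"
          by (rule bex_cong[OF refl]) (simp add: constant_iff_coordinates[OF True] Ball_def)
        finally show ?thesis .
      qed
      then show ?thesis
        using True by (simp add: topspace_map_top del: topspace_product_topology) blast
    qed (simp add: topspace_map_top del: topspace_product_topology)
  qed
  have "openin map_top ?V"
    unfolding V_eq
    by (rule openin_finite_ball[OF finite_card_subsets], rule openin_bex, rule openin_not_constant)
       (use k in auto)
  moreover have sub_sphere: "?V \<subseteq> topspace sphere_top"
  proof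
    fix y assume y: "y \<in> ?V"
    obtain J where J: "J \<subseteq> carrier G" "card J = k"
      using obtain_subset_with_card_n[OF k(2)] by blast
    have M: "y \<in> Maps" using y by simp
    have "\<not> y constant_on carrier G"
    proof
      assume "y constant_on carrier G"
      then have "y constant_on J" using J(1) by (rule constant_on_subset)
      then show False using y J unfolding diagonal_iff[OF M, of k] Diff_iff by blast
    qed
    then show "y \<in> topspace sphere_top" using y by (simp add: topspace_sphere)
  qed
  ultimately show "openin sphere_top ?V" by (rule openin_sphere)
  have "subtopology sphere_top ?V = V_space (carrier G) m k"
    unfolding V_space_eq[of k] sphere_top_eq
    by (rule subtopology_absorb) (use sub_sphere topspace_sphere in simp)
  then show "covered G (subtopology sphere_top ?V) (map_action G) n" using cov by simp
  fix y assume y: "y \<in> topspace sphere_top" "y \<notin> ?V"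
  then have M: "y \<in> Maps" and nc: "\<not> y constant_on carrier G" by (simp_all add: topspace_sphere)
  have "y \<in> diagonal (carrier G) k (Euclidean_space m)" using y(2) M by simp
  then obtain J where J: "J \<subseteq> carrier G" "card J = k" "y constant_on J"
    unfolding diagonal_iff[OF M] by (elim exE conjE)
  from F[OF M nc J] J(1,2)
  show "(\<exists>J\<subseteq>carrier G. card J = k \<and> F y constant_on J) \<and> \<not> F y constant_on carrier G"
    by (intro conjI exI[of _ J]) simp_all
qed

definition remoteness :: "('a \<Rightarrow> nat \<Rightarrow> real) \<Rightarrow> 'a \<Rightarrow> real" where
  "remoteness y h = (\<Sum>h'\<in>carrier G. \<Sum>l<m. \<bar>y h l - y h' l\<bar>)"

lemma remoteness_family: "real_family G p sphere_top (map_action G) remoteness"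
proof unfold_locales
  show "map_action G g y \<in> topspace sphere_top" if "g \<in> carrier G" "y \<in> topspace sphere_top" for g y
    using that by (rule sphere_act)
  fix h assume h: "h \<in> carrier G"
  have "continuous_map map_top euclideanreal (\<lambda>y. remoteness y h)"
    unfolding remoteness_def
    by (intro continuous_map_sum continuous_map_real_abs continuous_map_diff continuous_coordinate)
       (use h finite_carrier in auto)
  then show "continuous_map sphere_top euclideanreal (\<lambda>y. remoteness y h)"
    unfolding V_space_eq by (rule continuous_map_from_subtopology)
next
  fix g h y assume g: "g \<in> carrier G" and h: "h \<in> carrier G"
  have "remoteness (map_action G g y) h = (\<Sum>h'\<in>carrier G. \<Sum>l<m. \<bar>y (inv g \<otimes> h) l - y (inv g \<otimes> h') l\<bar>)"
    using h by (simp add: remoteness_def map_action_def)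
  also have "\<dots> = remoteness y (inv g \<otimes> h)"
    unfolding remoteness_def
    by (rule sum.reindex_bij_witness[of _ "\<lambda>h. g \<otimes> h" "\<lambda>h. inv g \<otimes> h"])
       (use g in \<open>auto simp: m_assoc[symmetric]\<close>)
  finally show "remoteness (map_action G g y) h = remoteness y (inv g \<otimes> h)" .
qed

text \<open>
  Passing from the majority value \<open>v\<close> to a value at distance \<open>d > 0\<close> increases the distance to more than half of
  the values by \<open>d\<close> and decreases the distance to each of the others by at most \<open>d\<close>.
\<close>

lemma remoteness_majority:
  assumes y: "y \<in> Maps" "\<not> y constant_on carrier G"
    and J: "J \<subseteq> carrier G" "y constant_on J" and maj: "card (carrier G) < 2 * card J"
  shows "remoteness y constant_on J \<and> \<not> remoteness y constant_on carrier G"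
proof
  obtain v where v: "\<And>h. h \<in> J \<Longrightarrow> y h = v" using J(2) by (auto simp: constant_on_def)
  show "remoteness y constant_on J"
    unfolding constant_on_def remoteness_def
    by (rule exI[of _ "\<Sum>h'\<in>carrier G. \<Sum>l<m. \<bar>v l - y h' l\<bar>"]) (simp add: v)
  have finJ: "finite J" using J(1) finite_carrier finite_subset by blast
  have "J \<noteq> {}" using maj by auto
  then obtain j where j: "j \<in> J" by blast
  have "\<exists>b\<in>carrier G. y b \<noteq> v"
    using y(2) unfolding constant_on_def by blast
  then obtain b where b: "b \<in> carrier G" "y b \<noteq> v" by blast
  define d where "d h h' = (\<Sum>l<m. \<bar>y h l - y h' l\<bar>)" for h h'
  have j_car: "j \<in> carrier G" using j J(1) by blast
  have d_pos: "0 < d b j"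
  proof -
    obtain l where l: "y b l \<noteq> v l" using b(2) by blast
    have "l < m"
    proof (rule ccontr)
      assume "\<not> l < m"
      then have "y b l = 0" "y j l = 0" using y(1) b(1) j_car by (simp_all add: Maps_iff)
      then show False using l v[OF j] by simp
    qed
    then have "\<bar>y b l - y j l\<bar> \<le> d b j"
      unfolding d_def by (intro member_le_sum) auto
    then show ?thesis using l v[OF j] by auto
  qed
  have on_J: "d b h - d j h = d b j" if "h \<in> J" for h
    using v[OF that] v[OF j] by (simp add: d_def)
  have off_J: "- d b j \<le> d b h - d j h" for h
  proof -
    have "d j h \<le> (\<Sum>l<m. \<bar>y b l - y j l\<bar> + \<bar>y b l - y h l\<bar>)"
      unfolding d_def by (intro sum_mono) linarith
    then show ?thesis by (simp add: d_def sum.distrib)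
  qed
  have "remoteness y b - remoteness y j = (\<Sum>h\<in>carrier G. d b h - d j h)"
    by (simp add: remoteness_def d_def sum_subtractf)
  also have "\<dots> = (\<Sum>h\<in>J. d b h - d j h) + (\<Sum>h\<in>carrier G - J. d b h - d j h)"
    using sum.subset_diff[OF J(1) finite_carrier, of "\<lambda>h. d b h - d j h"] by simp
  also have "(\<Sum>h\<in>J. d b h - d j h) = real (card J) * d b j"
    by (simp add: on_J)
  finally have "remoteness y b - remoteness y j
      = real (card J) * d b j + (\<Sum>h\<in>carrier G - J. d b h - d j h)" .
  moreover have "(\<Sum>h\<in>carrier G - J. - d b j) \<le> (\<Sum>h\<in>carrier G - J. d b h - d j h)"
    by (intro sum_mono off_J)
  moreover have "(\<Sum>h\<in>carrier G - J. - d b j) = - (real (card (carrier G)) - real (card J)) * d b j"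
    using card_Diff_subset[OF finJ J(1)] card_mono[OF finite_carrier J(1)] by (simp add: of_nat_diff algebra_simps)
  ultimately have "(2 * real (card J) - real (card (carrier G))) * d b j \<le> remoteness y b - remoteness y j"
    by (simp add: algebra_simps)
  moreover have "0 < (2 * real (card J) - real (card (carrier G))) * d b j"
    using maj d_pos by (intro mult_pos_pos) linarith+
  ultimately have "remoteness y b \<noteq> remoteness y j" by simp
  then show "\<not> remoteness y constant_on carrier G"
    using b(1) j_car unfolding constant_on_def by metis
qed

end

section \<open>The genus\<close>

theorem theorem5p5:
  fixes G :: "('g, 'b) monoid_scheme" and p n q m k :: nat
  assumes "prime p" and "n \<ge> 1"
    and "group G" and "G \<cong> product_group {1..n} (\<lambda>_. integer_mod_group p)"
    and "q = order G"
    and "m \<ge> 1" and "2 \<le> k" and "k \<le> q"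
  shows "genus G (V_space (carrier G) 1 k) (map_action G) = enat (k - 1)
       \<and> genus G (W_space (carrier G) k) (map_action G) = enat (k - 1)
       \<and> genus G (V1_space (carrier G) m k) (map_action G) = enat ((m - 1) * (q - 1) + k - 1)
       \<and> (real k > real q / 2 \<longrightarrow>
            genus G (V_space (carrier G) m k) (map_action G) = enat ((m - 1) * (q - 1) + k - 1))"
proof -
  have q: "q = card (carrier G)" using assms(5) by (simp add: order_def)
  have "finite (carrier G)" using assms(7,8) q by (metis card.infinite not_numeral_le_zero order_trans)
  then interpret elementary_abelian G p
    using elementary_abelian_if_iso assms by blast
  interpret M: point_space G p m by unfold_locales
  interpret L: point_space G p 1 by unfold_locales
  have k: "1 \<le> k" "k \<le> card (carrier G)" using assms q by simp_all
  have lower_line: "k - 1 \<le> n'" if "covered G (V_space (carrier G) 1 k) (map_action G) n'" for n'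
  proof -
    have "(1 - 1) * (card (carrier G) - 1) + k - 1 \<le> n'"
    proof (rule L.lower_V[OF _ k that L.sphere_coord_family[of 0]])
      fix y J assume y: "y \<in> L.Maps" "\<not> y constant_on carrier G" and J: "J \<subseteq> carrier G" "y constant_on J"
      have "y constant_on A \<longleftrightarrow> (\<lambda>h. y h 0) constant_on A" if "A \<subseteq> carrier G" for A
        using L.constant_iff_coordinates[OF y(1) that] by simp
      then show "(\<lambda>h. y h 0) constant_on J \<and> \<not> (\<lambda>h. y h 0) constant_on carrier G"
        using y(2) J by blast
    qed simp
    then show ?thesis by simp
  qed
  have pull_line: "covered G (V_space (carrier G) 1 k) (map_action G) n'"
    if "covered G (W_space (carrier G) k) (map_action G) n'" for n'
  proof (rule covered_pullback[OF _ _ _ that, where \<phi> = "\<lambda>y. \<lambda>h\<in>carrier G. y h 0"])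
    let ?\<phi> = "\<lambda>y::'g \<Rightarrow> nat \<Rightarrow> real. \<lambda>h\<in>carrier G. y h 0"
    have top: "topspace (V_space (carrier G) 1 k) = L.Maps - diagonal (carrier G) k (Euclidean_space 1)"
      unfolding L.V_space_eq by (rule L.topspace_sub) blast
    show "continuous_map (V_space (carrier G) 1 k) (W_space (carrier G) k) ?\<phi>"
      unfolding W_space_def continuous_map_in_subtopology
    proof
      show "continuous_map (V_space (carrier G) 1 k) (product_topology (\<lambda>_. euclideanreal) (carrier G)) ?\<phi>"
        unfolding continuous_map_componentwise
      proof (intro conjI ballI)
        fix h assume h: "h \<in> carrier G"
        then show "continuous_map (V_space (carrier G) 1 k) euclideanreal (\<lambda>y. ?\<phi> y h)"
          unfolding L.V_space_eq
          using continuous_map_from_subtopology[OF continuous_coordinate[OF h, of 1 0]] by simp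
      qed auto
      show "?\<phi> \<in> topspace (V_space (carrier G) 1 k) \<rightarrow> (carrier G \<rightarrow>\<^sub>E UNIV) - max_diagonal (carrier G) k"
      proof
        fix y assume "y \<in> topspace (V_space (carrier G) 1 k)"
        then have y: "y \<in> L.Maps" "y \<notin> diagonal (carrier G) k (Euclidean_space 1)" unfolding top by auto
        have "?\<phi> y \<notin> max_diagonal (carrier G) k"
        proof
          assume "?\<phi> y \<in> max_diagonal (carrier G) k"
          then obtain J c where J: "J \<subseteq> carrier G" "card J = k" "\<forall>i\<in>J. ?\<phi> y i = c"
            by (auto simp: max_diagonal_def)
          then have "\<forall>i\<in>J. y i 0 = c" by (auto simp: subset_iff)
          then have "y constant_on J"
            using L.constant_iff_coordinates[OF y(1) J(1)] by (auto simp: constant_on_def)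
          then show False using y(2) J L.diagonal_iff[OF y(1)] by blast
        qed
        then show "?\<phi> y \<in> (carrier G \<rightarrow>\<^sub>E UNIV) - max_diagonal (carrier G) k" by auto
      qed
    qed
    show "map_action G g y \<in> topspace (V_space (carrier G) 1 k)"
      if "g \<in> carrier G" "y \<in> topspace (V_space (carrier G) 1 k)" for g y
      using that L.V_act[OF k(2)] unfolding top by blast
    show "?\<phi> (map_action G g y) = map_action G g (?\<phi> y)" if "g \<in> carrier G" for g y
      using that by (auto simp: map_action_def fun_eq_iff)
  qed
  have "genus G (W_space (carrier G) k) (map_action G) = enat (k - 1)"
    by (rule genus_eqI[OF covered_W[OF k(2)]]) (use pull_line lower_line in blast)
  moreover have "genus G (V_space (carrier G) 1 k) (map_action G) = enat (k - 1)"
    by (rule genus_eqI[OF pull_line[OF covered_W[OF k(2)]] lower_line])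
  moreover have "genus G (V1_space (carrier G) m k) (map_action G) = enat ((m - 1) * (q - 1) + k - 1)"
    unfolding q by (rule genus_eqI[OF M.covered_V1[OF assms(6) k] M.lower_V1[OF assms(6) k]])
  moreover have "genus G (V_space (carrier G) m k) (map_action G) = enat ((m - 1) * (q - 1) + k - 1)"
    if maj: "real k > real q / 2"
    unfolding q
  proof (rule genus_eqI[OF M.covered_V[OF assms(6) k]])
    fix n' assume cov: "covered G (V_space (carrier G) m k) (map_action G) n'"
    show "(m - 1) * (card (carrier G) - 1) + k - 1 \<le> n'"
    proof (rule M.lower_V[OF assms(6) k cov M.remoteness_family])
      fix y J assume "y \<in> M.Maps" "\<not> y constant_on carrier G" "J \<subseteq> carrier G" "card J = k" "y constant_on J"
      then show "M.remoteness y constant_on J \<and> \<not> M.remoteness y constant_on carrier G"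
        using maj q by (intro M.remoteness_majority) auto
    qed
  qed
  ultimately show ?thesis by blast
qed

end
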